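(* Let $\mathfrak t$ be a Lie algebroid over $M$, $\mathfrak g\subset J^1\mathfrak t$ an infinitesimal geometric structure, $\mathfrak g^{(1)}\subset J^1\mathfrak g$ its prolongation, and $\mathfrak g^{(1)}_1:=p(\mathfrak g^{(1)})\subset\mathfrak g$ its $\Theta$-reduction, where $p\colon J^1\mathfrak g\to\mathfrak g$ is the natural projection. If $\mathfrak g^{(1)}_1$ and $\mathfrak g^{(1)}$ have constant rank, then $\mathfrak g^{(1)}_1$ is a reduction of $\mathfrak g$. One has $\mathfrak g^{(1)}_1=\mathfrak g$ if and only if $\mathfrak g^{(1)}$ is surjective.
   Context: Everything is $C^\infty$. $J^kE$ is the bundle of $k$-jets of sections of a vector bundle $E$, with $J^k\sigma$ the prolongation of a section $\sigma$. For a Lie algebroid $\mathfrak t$ over $M$, $J^1\mathfrak t$ is a Lie algebroid with anchor $J^1\mathfrak t\to\mathfrak t\xrightarrow{\#}TM$ and the unique bracket with $[J^1X,J^1Y]=J^1[X,Y]$. A subalgebroid is a constant-rank subbundle whose sections are closed under the bracket. An infinitesimal geometric structure on $\mathfrak t$ is a subalgebroid $\mathfrak g\subset J^1\mathfrak t$. A symmetry of $\mathfrak g$ is a section $W$ of $\mathfrak t$ such that $J^1W$ is a section of $\mathfrak g$. A reduction of $\mathfrak g$ is a subalgebroid $\mathfrak g'\subset\mathfrak g$ with the same symmetries as $\mathfrak g$. $J^1\mathfrak g$ and $J^2\mathfrak t$ are regarded as subbundles of $J^1(J^1\mathfrak t)$, the latter via $J^2W(m)\mapsto J^1(J^1W)(m)$.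 The prolongation of $\mathfrak g$ is $\mathfrak g^{(1)}:=J^1\mathfrak g\cap J^2\mathfrak t\subset J^1\mathfrak g$. It is called surjective if $p(\mathfrak g^{(1)})=\mathfrak g$. *)

theory Defs
  imports "HOL-Analysis.Analysis"
begin

(* Manifolds are modelled on a finite-dimensional inner product space and the
   fibres of vector bundles on a finite-dimensional normed space.  The class
   euclidean_space is not used because it excludes dimension 0, and because
   spaces of linear maps, needed for jets, are not an instance of it. *)
definition fin_dim :: "'a::real_vector itself \<Rightarrow> bool" where
  "fin_dim _ \<longleftrightarrow> (\<exists>B::'a set. finite B \<and> span B = UNIV)"

text \<open>Meant for open \<open>S\<close> and finite-dimensional \<open>'a\<close>, where continuity of all iterated
  directional derivatives is the same as continuity of the iterated total derivatives.\<close>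

primrec Ck_on :: "nat \<Rightarrow> 'a::real_normed_vector set \<Rightarrow> ('a \<Rightarrow> 'b::real_normed_vector) \<Rightarrow> bool" where
  "Ck_on 0 S f \<longleftrightarrow> continuous_on S f"
| "Ck_on (Suc k) S f \<longleftrightarrow>
     (\<forall>x\<in>S. f differentiable (at x)) \<and> (\<forall>v. Ck_on k S (\<lambda>x. frechet_derivative f (at x) v))"

definition smooth_on :: "'a::real_normed_vector set \<Rightarrow> ('a \<Rightarrow> 'b::real_normed_vector) \<Rightarrow> bool" where
  "smooth_on S f \<longleftrightarrow> (\<forall>k. Ck_on k S f)"

text \<open>A manifold is a Hausdorff, second countable type \<open>'m\<close> with a smooth atlas.
  A chart is given by its domain and its coordinate map, whose values outside
  the domain are irrelevant.\<close>

type_synonym ('m, 'e) chart = "'m set \<times> ('m \<Rightarrow> 'e)"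

definition smooth_atlas ::
  "('m::{t2_space,second_countable_topology}, 'e::real_inner) chart set \<Rightarrow> bool" where
  "smooth_atlas A \<longleftrightarrow>
     fin_dim TYPE('e) \<and>
     (\<Union>(D, \<psi>)\<in>A. D) = UNIV \<and>
     (\<forall>(D, \<psi>)\<in>A. open D \<and> open (\<psi> ` D) \<and> homeomorphism D (\<psi> ` D) \<psi> (inv_into D \<psi>)) \<and>
     (\<forall>(D, \<psi>)\<in>A. \<forall>(D', \<psi>')\<in>A. smooth_on (\<psi> ` (D \<inter> D')) (\<psi>' \<circ> inv_into D \<psi>))"

definition smooth_fun ::
  "('m::{t2_space,second_countable_topology}, 'e::real_inner) chart set \<Rightarrow> 'm set
     \<Rightarrow> ('m \<Rightarrow> 'b::real_normed_vector) \<Rightarrow> bool" where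
  "smooth_fun A U f \<longleftrightarrow> (\<forall>(D, \<psi>)\<in>A. smooth_on (\<psi> ` (U \<inter> D)) (f \<circ> inv_into D \<psi>))"

abbreviation Cinf ::
  "('m::{t2_space,second_countable_topology}, 'e::real_inner) chart set \<Rightarrow> ('m \<Rightarrow> real) set" where
  "Cinf A \<equiv> {f. smooth_fun A UNIV f}"

text \<open>Tangent vectors at \<open>m\<close> are the directional derivatives at \<open>m\<close>, as operators on
  smooth functions; values on other functions are irrelevant.\<close>

definition tangent_vector ::
  "('m::{t2_space,second_countable_topology}, 'e::real_inner) chart set \<Rightarrow> 'm
     \<Rightarrow> (('m \<Rightarrow> real) \<Rightarrow> real) \<Rightarrow> bool" where
  "tangent_vector A m D \<longleftrightarrow>
     (\<exists>(S, \<psi>)\<in>A. m \<in> S \<and>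
        (\<exists>v. \<forall>f\<in>Cinf A. D f = frechet_derivative (f \<circ> inv_into S \<psi>) (at (\<psi> m)) v))"

text \<open>A local trivialisation over \<open>U\<close> is a family of bijections \<open>\<phi> m\<close> from the fibre at
  \<open>m \<in> U\<close> to the model space \<open>'f\<close>.  Transition maps are linear, and the
  vector space structure of a fibre is the one transported from \<open>'f\<close>.\<close>

record ('m, 'v, 'f) vbundle =
  fibre :: "'m \<Rightarrow> 'v set"
  trivs :: "('m set \<times> ('m \<Rightarrow> 'v \<Rightarrow> 'f)) set"

definition vector_bundle ::
  "('m::{t2_space,second_countable_topology}, 'e::real_inner) chart set
     \<Rightarrow> ('m, 'v, 'f::real_normed_vector) vbundle \<Rightarrow> bool" where
  "vector_bundle A E \<longleftrightarrow>
     fin_dim TYPE('f) \<and>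
     (\<Union>(U, \<phi>)\<in>trivs E. U) = UNIV \<and>
     (\<forall>(U, \<phi>)\<in>trivs E. open U \<and> (\<forall>m\<in>U. bij_betw (\<phi> m) (fibre E m) UNIV)) \<and>
     (\<forall>(U, \<phi>)\<in>trivs E. \<forall>(U', \<phi>')\<in>trivs E.
        (\<forall>m\<in>U \<inter> U'. linear (\<lambda>v. \<phi>' m (inv_into (fibre E m) (\<phi> m) v))) \<and>
        (\<forall>v. smooth_fun A (U \<inter> U') (\<lambda>m. \<phi>' m (inv_into (fibre E m) (\<phi> m) v))))"

text \<open>Some linear isomorphism from the fibre at \<open>m\<close> to \<open>'f\<close>.\<close>

definition coord :: "('m, 'v, 'f::real_normed_vector) vbundle \<Rightarrow> 'm \<Rightarrow> 'v \<Rightarrow> 'f" where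
  "coord E m = (SOME \<phi>m. \<exists>U \<phi>. (U, \<phi>) \<in> trivs E \<and> m \<in> U \<and> \<phi>m = \<phi> m)"

definition vzero :: "('m, 'v, 'f::real_normed_vector) vbundle \<Rightarrow> 'm \<Rightarrow> 'v" where
  "vzero E m = inv_into (fibre E m) (coord E m) 0"

definition vadd :: "('m, 'v, 'f::real_normed_vector) vbundle \<Rightarrow> 'm \<Rightarrow> 'v \<Rightarrow> 'v \<Rightarrow> 'v" where
  "vadd E m v w = inv_into (fibre E m) (coord E m) (coord E m v + coord E m w)"

definition vscale :: "('m, 'v, 'f::real_normed_vector) vbundle \<Rightarrow> 'm \<Rightarrow> real \<Rightarrow> 'v \<Rightarrow> 'v" where
  "vscale E m c v = inv_into (fibre E m) (coord E m) (c *\<^sub>R coord E m v)"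

definition smooth_section ::
  "('m::{t2_space,second_countable_topology}, 'e::real_inner) chart set
     \<Rightarrow> ('m, 'v, 'f::real_normed_vector) vbundle \<Rightarrow> 'm set \<Rightarrow> ('m \<Rightarrow> 'v) \<Rightarrow> bool" where
  "smooth_section A E U \<sigma> \<longleftrightarrow>
     (\<forall>m\<in>U. \<sigma> m \<in> fibre E m) \<and>
     (\<forall>(V, \<phi>)\<in>trivs E. smooth_fun A (U \<inter> V) (\<lambda>m. \<phi> m (\<sigma> m)))"

definition sections ::
  "('m::{t2_space,second_countable_topology}, 'e::real_inner) chart set
     \<Rightarrow> ('m, 'v, 'f::real_normed_vector) vbundle \<Rightarrow> ('m \<Rightarrow> 'v) set" where
  "sections A E = {\<sigma>. smooth_section A E UNIV \<sigma>}"

definition sec_add ::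
  "('m, 'v, 'f::real_normed_vector) vbundle \<Rightarrow> ('m \<Rightarrow> 'v) \<Rightarrow> ('m \<Rightarrow> 'v) \<Rightarrow> 'm \<Rightarrow> 'v" where
  "sec_add E \<sigma> \<tau> = (\<lambda>m. vadd E m (\<sigma> m) (\<tau> m))"

definition sec_mult ::
  "('m, 'v, 'f::real_normed_vector) vbundle \<Rightarrow> ('m \<Rightarrow> real) \<Rightarrow> ('m \<Rightarrow> 'v) \<Rightarrow> 'm \<Rightarrow> 'v" where
  "sec_mult E f \<sigma> = (\<lambda>m. vscale E m (f m) (\<sigma> m))"

text \<open>Families \<open>S m\<close> of subsets of the fibres.  In \<open>subbundle\<close> the number \<open>k\<close>
  is the rank and \<open>e\<close> a smooth local frame.\<close>

definition constant_rank ::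
  "('m, 'v, 'f::real_normed_vector) vbundle \<Rightarrow> ('m \<Rightarrow> 'v set) \<Rightarrow> bool" where
  "constant_rank E S \<longleftrightarrow> (\<exists>k. \<forall>m. dim (coord E m ` S m) = k)"

definition subbundle ::
  "('m::{t2_space,second_countable_topology}, 'e::real_inner) chart set
     \<Rightarrow> ('m, 'v, 'f::real_normed_vector) vbundle \<Rightarrow> ('m \<Rightarrow> 'v set) \<Rightarrow> bool" where
  "subbundle A E S \<longleftrightarrow>
     (\<forall>m. S m \<subseteq> fibre E m) \<and>
     (\<exists>k::nat. \<forall>m. \<exists>U e. open U \<and> m \<in> U \<and>
        (\<forall>i<k. smooth_section A E U (e i)) \<and>
        (\<forall>q\<in>U. inj_on (\<lambda>i. coord E q (e i q)) {..<k} \<and>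
                independent ((\<lambda>i. coord E q (e i q)) ` {..<k}) \<and>
                span ((\<lambda>i. coord E q (e i q)) ` {..<k}) = coord E q ` S q))"

definition sub_sections ::
  "('m::{t2_space,second_countable_topology}, 'e::real_inner) chart set
     \<Rightarrow> ('m, 'v, 'f::real_normed_vector) vbundle \<Rightarrow> ('m \<Rightarrow> 'v set) \<Rightarrow> ('m \<Rightarrow> 'v) set" where
  "sub_sections A E S = {\<sigma> \<in> sections A E. \<forall>m. \<sigma> m \<in> S m}"

definition local_rep ::
  "('m, 'e) chart \<Rightarrow> ('m \<Rightarrow> 'v \<Rightarrow> 'f) \<Rightarrow> ('m \<Rightarrow> 'v) \<Rightarrow> 'e \<Rightarrow> 'f" where
  "local_rep c \<phi> \<sigma> = (\<lambda>x. let q = inv_into (fst c) (snd c) x in \<phi> q (\<sigma> q))"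

definition same_1jet ::
  "('m::{t2_space,second_countable_topology}, 'e::real_inner) chart set
     \<Rightarrow> ('m, 'v, 'f::real_normed_vector) vbundle \<Rightarrow> 'm \<Rightarrow> ('m \<Rightarrow> 'v) \<Rightarrow> ('m \<Rightarrow> 'v) \<Rightarrow> bool" where
  "same_1jet A E m \<sigma> \<tau> \<longleftrightarrow>
     \<sigma> m = \<tau> m \<and>
     (\<forall>(D, \<psi>)\<in>A. \<forall>(V, \<phi>)\<in>trivs E. m \<in> D \<inter> V \<longrightarrow>
        frechet_derivative (local_rep (D, \<psi>) \<phi> \<sigma>) (at (\<psi> m)) =
        frechet_derivative (local_rep (D, \<psi>) \<phi> \<tau>) (at (\<psi> m)))"

text \<open>The 1-jet of a section at a point is its equivalence class among smooth sections;
  \<open>j1 A E \<sigma>\<close> is the prolongation \<open>m \<mapsto> J\<^sup>1\<sigma>(m)\<close>.\<close>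

definition j1 ::
  "('m::{t2_space,second_countable_topology}, 'e::real_inner) chart set
     \<Rightarrow> ('m, 'v, 'f::real_normed_vector) vbundle \<Rightarrow> ('m \<Rightarrow> 'v) \<Rightarrow> 'm \<Rightarrow> ('m \<Rightarrow> 'v) set" where
  "j1 A E \<sigma> m = {\<tau> \<in> sections A E. same_1jet A E m \<sigma> \<tau>}"

text \<open>A chart of the base and a trivialisation of \<open>E\<close> give the trivialisation of the jet bundle
  that sends a 1-jet to the value and the derivative of a local representative.\<close>

definition J1_triv ::
  "('m, 'e::real_inner) chart \<Rightarrow> ('m \<Rightarrow> 'v \<Rightarrow> 'f::real_normed_vector)
     \<Rightarrow> 'm \<Rightarrow> ('m \<Rightarrow> 'v) set \<Rightarrow> 'f \<times> ('e \<Rightarrow>\<^sub>L 'f)" where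
  "J1_triv c \<phi> m \<theta> =
     (let \<sigma> = (SOME \<sigma>. \<sigma> \<in> \<theta>); F = local_rep c \<phi> \<sigma>; x = snd c m
      in (F x, Blinfun (frechet_derivative F (at x))))"

definition J1 ::
  "('m::{t2_space,second_countable_topology}, 'e::real_inner) chart set
     \<Rightarrow> ('m, 'v, 'f::real_normed_vector) vbundle
     \<Rightarrow> ('m, ('m \<Rightarrow> 'v) set, 'f \<times> ('e \<Rightarrow>\<^sub>L 'f)) vbundle" where
  "J1 A E =
     \<lparr> fibre = (\<lambda>m. (\<lambda>\<sigma>. j1 A E \<sigma> m) ` sections A E),
       trivs = (\<lambda>(c, (V, \<phi>)). (fst c \<inter> V, J1_triv c \<phi>)) ` (A \<times> trivs E) \<rparr>"

text \<open>The projection \<open>p\<close> from 1-jets at \<open>m\<close> to the fibre at \<open>m\<close>.\<close>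

definition jet_proj :: "'m \<Rightarrow> ('m \<Rightarrow> 'v) set \<Rightarrow> 'v" where
  "jet_proj m \<theta> = (THE v. \<forall>\<sigma>\<in>\<theta>. \<sigma> m = v)"

text \<open>Smoothness of the anchor \<open>\<rho>\<close> is expressed by smoothness of \<open>\<rho>(X) f\<close> for
  sections \<open>X\<close> and functions \<open>f\<close>.\<close>

definition lie_algebroid ::
  "('m::{t2_space,second_countable_topology}, 'e::real_inner) chart set
     \<Rightarrow> ('m, 'v, 'f::real_normed_vector) vbundle
     \<Rightarrow> ('m \<Rightarrow> 'v \<Rightarrow> ('m \<Rightarrow> real) \<Rightarrow> real)
     \<Rightarrow> (('m \<Rightarrow> 'v) \<Rightarrow> ('m \<Rightarrow> 'v) \<Rightarrow> 'm \<Rightarrow> 'v) \<Rightarrow> bool" where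
  "lie_algebroid A E \<rho> br \<longleftrightarrow>
     vector_bundle A E \<and>
     (\<forall>m. \<forall>v\<in>fibre E m. tangent_vector A m (\<rho> m v)) \<and>
     (\<forall>m. \<forall>v\<in>fibre E m. \<forall>w\<in>fibre E m. \<forall>f\<in>Cinf A. \<rho> m (vadd E m v w) f = \<rho> m v f + \<rho> m w f) \<and>
     (\<forall>m c. \<forall>v\<in>fibre E m. \<forall>f\<in>Cinf A. \<rho> m (vscale E m c v) f = c * \<rho> m v f) \<and>
     (\<forall>X\<in>sections A E. \<forall>f\<in>Cinf A. (\<lambda>m. \<rho> m (X m) f) \<in> Cinf A) \<and>
     (\<forall>X\<in>sections A E. \<forall>Y\<in>sections A E. br X Y \<in> sections A E) \<and>
     (\<forall>X\<in>sections A E. \<forall>Y\<in>sections A E. \<forall>Z\<in>sections A E.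
        br X (sec_add E Y Z) = sec_add E (br X Y) (br X Z)) \<and>
     (\<forall>X\<in>sections A E. \<forall>Y\<in>sections A E. \<forall>c.
        br X (sec_mult E (\<lambda>_. c) Y) = sec_mult E (\<lambda>_. c) (br X Y)) \<and>
     (\<forall>X\<in>sections A E. \<forall>Y\<in>sections A E. br Y X = sec_mult E (\<lambda>_. -1) (br X Y)) \<and>
     (\<forall>X\<in>sections A E. \<forall>Y\<in>sections A E. \<forall>Z\<in>sections A E.
        sec_add E (br X (br Y Z)) (sec_add E (br Y (br Z X)) (br Z (br X Y))) = vzero E) \<and>
     (\<forall>X\<in>sections A E. \<forall>Y\<in>sections A E. \<forall>f\<in>Cinf A.
        br X (sec_mult E f Y) =
        sec_add E (sec_mult E f (br X Y)) (sec_mult E (\<lambda>m. \<rho> m (X m) f) Y))"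

definition subalgebroid ::
  "('m::{t2_space,second_countable_topology}, 'e::real_inner) chart set
     \<Rightarrow> ('m, 'v, 'f::real_normed_vector) vbundle
     \<Rightarrow> (('m \<Rightarrow> 'v) \<Rightarrow> ('m \<Rightarrow> 'v) \<Rightarrow> 'm \<Rightarrow> 'v) \<Rightarrow> ('m \<Rightarrow> 'v set) \<Rightarrow> bool" where
  "subalgebroid A E br S \<longleftrightarrow>
     subbundle A E S \<and>
     (\<forall>X\<in>sub_sections A E S. \<forall>Y\<in>sub_sections A E S. br X Y \<in> sub_sections A E S)"

text \<open>\<open>jbr\<close> is the bracket of the Lie algebroid of 1-jets of sections of \<open>t\<close>, which is determined
  by the following properties.\<close>

definition is_jet_bracket ::
  "('m::{t2_space,second_countable_topology}, 'e::real_inner) chart set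
     \<Rightarrow> ('m, 'v, 'f::real_normed_vector) vbundle
     \<Rightarrow> ('m \<Rightarrow> 'v \<Rightarrow> ('m \<Rightarrow> real) \<Rightarrow> real)
     \<Rightarrow> (('m \<Rightarrow> 'v) \<Rightarrow> ('m \<Rightarrow> 'v) \<Rightarrow> 'm \<Rightarrow> 'v)
     \<Rightarrow> (('m \<Rightarrow> ('m \<Rightarrow> 'v) set) \<Rightarrow> ('m \<Rightarrow> ('m \<Rightarrow> 'v) set) \<Rightarrow> 'm \<Rightarrow> ('m \<Rightarrow> 'v) set) \<Rightarrow> bool" where
  "is_jet_bracket A t \<rho> br jbr \<longleftrightarrow>
     lie_algebroid A (J1 A t) (\<lambda>m \<theta>. \<rho> m (jet_proj m \<theta>)) jbr \<and>
     (\<forall>X\<in>sections A t. \<forall>Y\<in>sections A t. jbr (j1 A t X) (j1 A t Y) = j1 A t (br X Y))"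

definition infinitesimal_structure ::
  "('m::{t2_space,second_countable_topology}, 'e::real_inner) chart set
     \<Rightarrow> ('m, 'v, 'f::real_normed_vector) vbundle
     \<Rightarrow> (('m \<Rightarrow> ('m \<Rightarrow> 'v) set) \<Rightarrow> ('m \<Rightarrow> ('m \<Rightarrow> 'v) set) \<Rightarrow> 'm \<Rightarrow> ('m \<Rightarrow> 'v) set)
     \<Rightarrow> ('m \<Rightarrow> ('m \<Rightarrow> 'v) set set) \<Rightarrow> bool" where
  "infinitesimal_structure A t jbr g \<longleftrightarrow> subalgebroid A (J1 A t) jbr g"

definition symmetries ::
  "('m::{t2_space,second_countable_topology}, 'e::real_inner) chart set
     \<Rightarrow> ('m, 'v, 'f::real_normed_vector) vbundle
     \<Rightarrow> ('m \<Rightarrow> ('m \<Rightarrow> 'v) set set) \<Rightarrow> ('m \<Rightarrow> 'v) set" where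
  "symmetries A t g = {W \<in> sections A t. j1 A t W \<in> sub_sections A (J1 A t) g}"

definition reduction ::
  "('m::{t2_space,second_countable_topology}, 'e::real_inner) chart set
     \<Rightarrow> ('m, 'v, 'f::real_normed_vector) vbundle
     \<Rightarrow> (('m \<Rightarrow> ('m \<Rightarrow> 'v) set) \<Rightarrow> ('m \<Rightarrow> ('m \<Rightarrow> 'v) set) \<Rightarrow> 'm \<Rightarrow> ('m \<Rightarrow> 'v) set)
     \<Rightarrow> ('m \<Rightarrow> ('m \<Rightarrow> 'v) set set) \<Rightarrow> ('m \<Rightarrow> ('m \<Rightarrow> 'v) set set) \<Rightarrow> bool" where
  "reduction A t jbr g g' \<longleftrightarrow>
     subalgebroid A (J1 A t) jbr g' \<and> (\<forall>m. g' m \<subseteq> g m) \<and> symmetries A t g' = symmetries A t g"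

text \<open>\<open>J1_sub A E S\<close> and \<open>J2_emb A E\<close> are \<open>J\<^sup>1S\<close>, for a subbundle \<open>S\<close> of \<open>E\<close>,
  and \<open>J\<^sup>2E\<close>, regarded as subbundles of \<open>J\<^sup>1E\<close> and \<open>J\<^sup>1(J\<^sup>1E)\<close> respectively.\<close>

definition J1_sub ::
  "('m::{t2_space,second_countable_topology}, 'e::real_inner) chart set
     \<Rightarrow> ('m, 'v, 'f::real_normed_vector) vbundle
     \<Rightarrow> ('m \<Rightarrow> 'v set) \<Rightarrow> 'm \<Rightarrow> ('m \<Rightarrow> 'v) set set" where
  "J1_sub A E S m = (\<lambda>\<sigma>. j1 A E \<sigma> m) ` sub_sections A E S"

definition J2_emb ::
  "('m::{t2_space,second_countable_topology}, 'e::real_inner) chart set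
     \<Rightarrow> ('m, 'v, 'f::real_normed_vector) vbundle \<Rightarrow> 'm \<Rightarrow> ('m \<Rightarrow> ('m \<Rightarrow> 'v) set) set set" where
  "J2_emb A E m = (\<lambda>W. j1 A (J1 A E) (j1 A E W) m) ` sections A E"

definition prolongation ::
  "('m::{t2_space,second_countable_topology}, 'e::real_inner) chart set
     \<Rightarrow> ('m, 'v, 'f::real_normed_vector) vbundle
     \<Rightarrow> ('m \<Rightarrow> ('m \<Rightarrow> 'v) set set) \<Rightarrow> 'm \<Rightarrow> ('m \<Rightarrow> ('m \<Rightarrow> 'v) set) set set" where
  "prolongation A t g m = J1_sub A (J1 A t) g m \<inter> J2_emb A t m"

definition Theta_reduction ::
  "('m::{t2_space,second_countable_topology}, 'e::real_inner) chart set
     \<Rightarrow> ('m, 'v, 'f::real_normed_vector) vbundle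
     \<Rightarrow> ('m \<Rightarrow> ('m \<Rightarrow> 'v) set set) \<Rightarrow> 'm \<Rightarrow> ('m \<Rightarrow> 'v) set set" where
  "Theta_reduction A t g m = jet_proj m ` prolongation A t g m"

definition surjective_prolongation ::
  "('m::{t2_space,second_countable_topology}, 'e::real_inner) chart set
     \<Rightarrow> ('m, 'v, 'f::real_normed_vector) vbundle \<Rightarrow> ('m \<Rightarrow> ('m \<Rightarrow> 'v) set set) \<Rightarrow> bool" where
  "surjective_prolongation A t g \<longleftrightarrow> (\<forall>m. jet_proj m ` prolongation A t g m = g m)"

end

theory Submission
  imports Defs
begin

text \<open>In a chart and a trivialisation the fibre of the prolongation is the intersection of the
  smooth subbundle \<open>J\<^sup>1g\<close> with the constant subspace of holonomic jets. If its rank is constant,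
  Gaussian elimination gives smooth local frames, and the constant rank of the projection to \<open>g\<close>
  then makes \<open>g\<^sub>1 = p(g\<^sup>(\<^sup>1\<^sup>))\<close> a subbundle whose sections lift smoothly to \<open>g\<^sup>(\<^sup>1\<^sup>)\<close>.

  For the bracket, a lift of a section \<open>X\<close> of \<open>g\<^sub>1\<close> is written both as \<open>\<Sum> f\<^sub>i J\<^sup>1S\<^sub>i\<close> with sections
  \<open>S\<^sub>i\<close> of \<open>g\<close> and as \<open>\<Sum> h\<^sub>k J\<^sup>1(J\<^sup>1P\<^sub>k)\<close> with sections \<open>P\<^sub>k\<close> of \<open>t\<close>, and likewise for \<open>Y\<close>. The Leibniz
  expression for the bracket of the lifts at a point does not depend on the representation. Evaluated
  with the \<open>S\<^sub>i\<close> it lies in \<open>J\<^sup>1g\<close>, evaluated with the \<open>J\<^sup>1P\<^sub>k\<close> it lies in \<open>J\<^sup>2t\<close>, and its projection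
  is \<open>[X, Y]\<close>.\<close>

section \<open>Finite-dimensional spaces\<close>

text \<open>In the Lie algebroid \<open>J\<^sup>1(J\<^sup>1t)\<close> both \<open>J\<^sup>1g\<close>
  and \<open>J\<^sup>2t\<close> are closed under the bracket, hence so is their intersection; but
  \<open>is_jet_bracket\<close> supplies a bracket one level lower only, on \<open>J1 A t\<close>.
  All that is needed of the higher one is this: if the sum of
  \<open>f\<^sub>i J\<^sup>1S\<^sub>i\<close> vanishes near a point, then the sum of
  \<open>f\<^sub>i J\<^sup>1[T, S\<^sub>i] + (#T f\<^sub>i) J\<^sup>1S\<^sub>i\<close> vanishes
  there. Freezing the coefficients at the point gives a section \<open>X\<close> with zero 1-jet.
  The 1-jet of \<open>[T, X]\<close> is then a second derivative of \<open>X\<close>, one direction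
  being \<open>#T\<close>, and the product rule cancels it against the terms with
  \<open>#T f\<^sub>i\<close>. As \<open>T\<close> is a genuine section, the two slots of the
  bracket are exchanged one after the other, with antisymmetry in between.

  Near a point, the rank of an intersection can only drop and that of the image of a frame can only
  grow. Here the two constant ranks enter: elimination bounds nearby intersections from above,
  independence bounds nearby images from below, and constancy turns both bounds into
  equalities.\<close>

lemma fin_dim_independent_finite:
  fixes S :: "'a::real_vector set"
  assumes "fin_dim TYPE('a)" "independent S"
  shows "finite S"
  using assms independent_span_bound[of _ S] by (auto simp: fin_dim_def)

lemma finite_spanning_basis:
  fixes H :: "'a::real_vector set"
  assumes "fin_dim TYPE('a)" "subspace H"
  obtains B where "finite B" "independent B" "span B = H"
  by (metis assms fin_dim_independent_finite maximal_independent_subset span_subspace)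

text \<open>The bound makes the coefficients of a convergent sequence Cauchy, and their limits are
  coefficients of the limit. Closedness is what gives a vector outside the span a positive distance
  from it in the next induction.\<close>

lemma closed_span_if_coeff_bounded:
  fixes B :: "'a::real_normed_vector set"
  assumes fin: "finite B"
    and C: "\<And>u b. b \<in> B \<Longrightarrow> \<bar>u b\<bar> \<le> C * norm (\<Sum>b\<in>B. u b *\<^sub>R b)"
  shows "closed (span B)"
  unfolding closed_sequential_limits
proof (intro allI impI, elim conjE)
  fix x l assume x: "\<forall>n::nat. x n \<in> span B" and lim: "x \<longlonglongrightarrow> l"
  have "\<forall>n. \<exists>u. x n = (\<Sum>b\<in>B. u b *\<^sub>R b)"
    using x span_finite[OF fin] by auto
  then obtain u where u: "\<And>n. x n = (\<Sum>b\<in>B. u n b *\<^sub>R b)" by metis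
  have cau: "Cauchy (\<lambda>n. u n b)" if b: "b \<in> B" for b
  proof (rule metric_CauchyI)
    fix e :: real assume e: "e > 0"
    have "Cauchy x" using lim by (simp add: LIMSEQ_imp_Cauchy)
    \<comment> \<open>\<open>C\<close> may be zero or negative, so the tolerance is divided by
      \<open>\<bar>C\<bar> + 1\<close>.\<close>
    then obtain M where M: "\<And>m n. m \<ge> M \<Longrightarrow> n \<ge> M \<Longrightarrow> dist (x m) (x n) < e / (\<bar>C\<bar> + 1)"
      using metric_CauchyD[of x "e / (\<bar>C\<bar> + 1)"] e by (metis abs_add_one_gt_zero divide_pos_pos add.commute)
    have "dist (u m b) (u n b) < e" if "m \<ge> M" "n \<ge> M" for m n
    proof -
      have "\<bar>u m b - u n b\<bar> \<le> C * norm (\<Sum>b\<in>B. (u m b - u n b) *\<^sub>R b)"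
        using C[OF b, of "\<lambda>b. u m b - u n b"] by simp
      also have "(\<Sum>b\<in>B. (u m b - u n b) *\<^sub>R b) = x m - x n"
        by (simp add: u algebra_simps sum_subtractf)
      also have "C * norm (x m - x n) \<le> (\<bar>C\<bar> + 1) * norm (x m - x n)"
        by (intro mult_right_mono) auto
      also have "\<dots> < e"
        using M[OF that] by (simp add: dist_norm field_simps pos_less_divide_eq)
      finally show ?thesis by (simp add: dist_real_def)
    qed
    then show "\<exists>M. \<forall>m\<ge>M. \<forall>n\<ge>M. dist (u m b) (u n b) < e" by blast
  qed
  define v where "v b = lim (\<lambda>n. u n b)" for b
  have v: "(\<lambda>n. u n b) \<longlonglongrightarrow> v b" if "b \<in> B" for b
    unfolding v_def using Cauchy_convergent[OF cau[OF that]] convergent_LIMSEQ_iff by blast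
  have "(\<lambda>n. \<Sum>b\<in>B. u n b *\<^sub>R b) \<longlonglongrightarrow> (\<Sum>b\<in>B. v b *\<^sub>R b)"
    by (intro tendsto_intros v)
  then have "l = (\<Sum>b\<in>B. v b *\<^sub>R b)"
    by (intro LIMSEQ_unique[OF lim]) (simp flip: u)
  then show "l \<in> span B" by (simp add: span_sum span_scale span_base)
qed

text \<open>Induction on the basis: the distance \<open>d\<close> of the new vector \<open>a\<close>
  from the closed span of the others controls the coefficient of \<open>a\<close>, and the triangle
  inequality then controls the remaining ones.\<close>

lemma independent_coeff_bounded:
  fixes B :: "'a::real_normed_vector set"
  assumes "finite B" "independent B"
  shows "\<exists>C. \<forall>u. \<forall>b\<in>B. \<bar>u b\<bar> \<le> C * norm (\<Sum>b\<in>B. u b *\<^sub>R b)"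
  using assms
proof (induction B)
  case empty
  show ?case by simp
next
  case (insert a B)
  then have ind: "independent B" and a: "a \<notin> span B"
    by (simp_all add: independent_insert)
  obtain C where C: "\<And>u b. b \<in> B \<Longrightarrow> \<bar>u b\<bar> \<le> C * norm (\<Sum>b\<in>B. u b *\<^sub>R b)"
    using insert.IH[OF ind] by blast
  have "closed (span B)"
    by (rule closed_span_if_coeff_bounded[OF insert.hyps(1) C])
  define d where "d = infdist a (span B)"
  have d: "d > 0"
    unfolding d_def by (rule infdist_pos_not_in_closed[OF \<open>closed (span B)\<close> _ a]) (auto intro: span_zero)
  \<comment> \<open>The first entry bounds the coefficient of \<open>a\<close>. The second bounds
    the others: removing the \<open>a\<close>-part from the sum costs at most its norm times
    \<open>norm a / d\<close>.\<close>
  define K where "K = max (1 / d) (\<bar>C\<bar> * (1 + norm a / d))"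
  have "\<bar>u b\<bar> \<le> K * norm (\<Sum>b\<in>insert a B. u b *\<^sub>R b)" if b: "b \<in> insert a B" for u b
  proof -
    define y where "y = (\<Sum>b\<in>B. u b *\<^sub>R b)"
    have y: "y \<in> span B" by (simp add: y_def span_sum span_scale span_base)
    let ?s = "u a *\<^sub>R a + y"
    have s: "(\<Sum>b\<in>insert a B. u b *\<^sub>R b) = ?s"
      using insert.hyps by (simp add: y_def)
    have ua: "\<bar>u a\<bar> * d \<le> norm ?s"
    proof (cases "u a = 0")
      case False
      \<comment> \<open>Up to the factor \<open>u a\<close>, the sum is the difference of
        \<open>a\<close> and a vector of the span.\<close>
      have "d \<le> dist a ((- 1 / u a) *\<^sub>R y)"
        unfolding d_def by (intro infdist_le span_scale y)
      then have "\<bar>u a\<bar> * d \<le> \<bar>u a\<bar> * norm (a - (- 1 / u a) *\<^sub>R y)"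
        by (simp add: dist_norm mult_left_mono)
      also have "\<dots> = norm (u a *\<^sub>R (a - (- 1 / u a) *\<^sub>R y))" by simp
      also have "u a *\<^sub>R (a - (- 1 / u a) *\<^sub>R y) = ?s"
        using False by (simp add: algebra_simps)
      finally show ?thesis .
    qed simp
    then have ua': "\<bar>u a\<bar> \<le> (1 / d) * norm ?s" using d by (simp add: field_simps)
    show ?thesis
    proof (cases "b = a")
      case True
      have "(1 / d) * norm ?s \<le> K * norm ?s"
        by (rule mult_right_mono) (auto simp: K_def)
      then show ?thesis unfolding s True using ua' by linarith
    next
      case False
      then have "\<bar>u b\<bar> \<le> C * norm y" unfolding y_def using C b by auto
      also have "\<dots> \<le> \<bar>C\<bar> * norm y" by (simp add: mult_right_mono)
      also have "norm y \<le> norm ?s + norm (u a *\<^sub>R a)"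
        by (metis add.commute add_diff_cancel_left' norm_triangle_ineq4)
      also have "norm (u a *\<^sub>R a) \<le> (1 / d) * norm ?s * norm a"
        using mult_right_mono[OF ua', of "norm a"] by simp
      finally have "\<bar>u b\<bar> \<le> \<bar>C\<bar> * (norm ?s + 1 / d * norm ?s * norm a)"
        by (simp add: mult_left_mono)
      also have "\<dots> = \<bar>C\<bar> * (1 + norm a / d) * norm ?s" by (simp add: algebra_simps)
      also have "\<dots> \<le> K * norm ?s" by (rule mult_right_mono) (auto simp: K_def)
      finally show ?thesis unfolding s .
    qed
  qed
  then show ?case by blast
qed

lemma fin_dim_linear_bounded:
  fixes f :: "'a::real_normed_vector \<Rightarrow> 'b::real_normed_vector"
  assumes "fin_dim TYPE('a)" "linear f"
  shows "bounded_linear f"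
proof -
  obtain B :: "'a set" where B: "finite B" "independent B" "span B = UNIV"
    using finite_spanning_basis[OF assms(1) subspace_UNIV] .
  obtain C where C: "\<And>u b. b \<in> B \<Longrightarrow> \<bar>u b\<bar> \<le> C * norm (\<Sum>b\<in>B. u b *\<^sub>R b)"
    using independent_coeff_bounded[OF B(1,2)] by blast
  have "norm (f x) \<le> norm x * (\<Sum>b\<in>B. C * norm (f b))" for x
  proof -
    have x: "x = (\<Sum>b\<in>B. representation B x b *\<^sub>R b)"
      using sum_representation_eq[of B x B] B by auto
    have "norm (f x) = norm (\<Sum>b\<in>B. representation B x b *\<^sub>R f b)"
      by (subst x) (simp add: linear_sum[OF assms(2)] linear_scale[OF assms(2)])
    also have "\<dots> \<le> (\<Sum>b\<in>B. C * norm x * norm (f b))"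
      using C[of _ "representation B x"] x
      by (intro sum_norm_le) (simp add: mult_right_mono)
    also have "\<dots> = norm x * (\<Sum>b\<in>B. C * norm (f b))"
      by (simp add: sum_distrib_left algebra_simps)
    finally show ?thesis .
  qed
  then show ?thesis
    using assms(2) by (intro bounded_linear_intro) (auto simp: linear_add linear_scale)
qed

lemma linear_representation_coeff:
  fixes B :: "'a::real_vector set"
  assumes "independent B" "span B = UNIV"
  shows "linear (\<lambda>v. representation B v b)"
  using assms by (intro linearI) (simp_all add: representation_add representation_scale)

text \<open>A basis with its dual basis. Nearly every statement about vector-valued maps below is
  reduced to real-valued ones, or to finitely many fixed directions, through this expansion.\<close>

lemma fin_dim_coordinates:
  assumes "fin_dim TYPE('a)"
  obtains B and \<beta> :: "'a::real_normed_vector \<Rightarrow> 'a \<Rightarrow> real"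
  where "finite B" "independent B" "span B = UNIV" "\<And>b. bounded_linear (\<beta> b)"
    "\<And>x. x = (\<Sum>b\<in>B. \<beta> b x *\<^sub>R b)"
    "\<And>b c. b \<in> B \<Longrightarrow> c \<in> B \<Longrightarrow> \<beta> b c = (if b = c then 1 else 0)"
proof -
  obtain B :: "'a set" where B: "finite B" "independent B" "span B = UNIV"
    using finite_spanning_basis[OF assms subspace_UNIV] .
  show ?thesis
  proof (rule that[of B "\<lambda>b x. representation B x b"])
    show "bounded_linear (\<lambda>x. representation B x b)" for b
      by (rule fin_dim_linear_bounded[OF assms linear_representation_coeff[OF B(2,3)]])
    show "x = (\<Sum>b\<in>B. representation B x b *\<^sub>R b)" for x
      using sum_representation_eq[of B x B] B by auto
    show "representation B c b = (if b = c then 1 else 0)" if "b \<in> B" "c \<in> B" for b c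
      using representation_basis[OF B(2), of c] that by auto
  qed (use B in auto)
qed

lemma linear_eq_coordinates:
  assumes "linear f" "finite B" "\<And>x. x = (\<Sum>b\<in>B. \<beta> b x *\<^sub>R b)"
  shows "f y = (\<Sum>b\<in>B. \<beta> b y *\<^sub>R f b)"
proof -
  have "f y = f (\<Sum>b\<in>B. \<beta> b y *\<^sub>R b)" using assms(3)[of y] by (rule arg_cong)
  also have "\<dots> = (\<Sum>b\<in>B. \<beta> b y *\<^sub>R f b)"
    by (simp only: linear_sum[OF assms(1)] linear_scale[OF assms(1)])
  finally show ?thesis .
qed

section \<open>Model fibres of jet bundles: products and spaces of linear maps\<close>

lemma fin_dim_prod:
  assumes "fin_dim TYPE('a::real_vector)" "fin_dim TYPE('b::real_vector)"
  shows "fin_dim TYPE('a \<times> 'b)"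
proof -
  obtain B :: "'a set" where B: "finite B" "span B = UNIV" using assms by (auto simp: fin_dim_def)
  obtain C :: "'b set" where C: "finite C" "span C = UNIV" using assms by (auto simp: fin_dim_def)
  let ?S = "(\<lambda>b. (b, 0)) ` B \<union> (\<lambda>c. (0, c)) ` C"
  have l1: "linear (\<lambda>b::'a. (b, 0::'b))" and l2: "linear (\<lambda>c::'b. (0::'a, c))"
    by (auto simp: linear_iff)
  have "(x, y) \<in> span ?S" for x y
  proof -
    have "(x, 0) \<in> (\<lambda>b. (b, 0::'b)) ` span B" using B by auto
    then have 1: "(x, 0) \<in> span ?S"
      using linear_span_image[OF l1, of B] span_mono[of "(\<lambda>b. (b, 0)) ` B" ?S] by auto
    have "(0, y) \<in> (\<lambda>c. (0::'a, c)) ` span C" using C by auto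
    then have 2: "(0, y) \<in> span ?S"
      using linear_span_image[OF l2, of C] span_mono[of "(\<lambda>c. (0, c)) ` C" ?S] by auto
    show ?thesis using span_add[OF 1 2] by simp
  qed
  then have "span ?S = UNIV" by auto
  then show ?thesis unfolding fin_dim_def using B C by (intro exI[of _ ?S]) auto
qed

text \<open>The rank-one operator of a functional and a vector. Finitely many of them span the
  bounded linear maps, so the model fibres of jet bundles are again finite-dimensional.\<close>

definition tensor :: "('a::real_normed_vector \<Rightarrow> real) \<Rightarrow> 'b::real_normed_vector \<Rightarrow> 'a \<Rightarrow>\<^sub>L 'b" where
  "tensor l y = Blinfun (\<lambda>v. l v *\<^sub>R y)"

lemma tensor_apply [simp]:
  "bounded_linear l \<Longrightarrow> blinfun_apply (tensor l y) v = l v *\<^sub>R y"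
  unfolding tensor_def
  by (subst bounded_linear_Blinfun_apply) (auto intro: bounded_linear_scaleR_const)

lemma bounded_linear_tensor:
  assumes "bounded_linear l"
  shows "bounded_linear (tensor l)"
proof -
  obtain K where K: "\<And>v. norm (l v) \<le> norm v * K" "K \<ge> 0"
    using bounded_linear.nonneg_bounded[OF assms] by blast
  show ?thesis
  proof (rule bounded_linear_intro[where K=K])
    show "tensor l (x + y) = tensor l x + tensor l y" for x y :: 'b
      by (rule blinfun_eqI) (simp add: assms blinfun.add_left scaleR_add_right)
    show "tensor l (r *\<^sub>R x) = r *\<^sub>R tensor l x" for r and x :: 'b
      by (rule blinfun_eqI) (simp add: assms blinfun.scaleR_left)
    show "norm (tensor l x) \<le> norm x * K" for x :: 'b
    proof (rule norm_blinfun_bound)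
      show "norm (blinfun_apply (tensor l x) v) \<le> norm x * K * norm v" for v
        using mult_right_mono[OF K(1)[of v] norm_ge_zero[of x]]
        by (simp add: assms algebra_simps)
    qed (use K in auto)
  qed
qed

lemma blinfun_eq_tensor_sum:
  fixes \<beta> :: "'a::real_normed_vector \<Rightarrow> 'a \<Rightarrow> real"
  assumes "finite B" "\<And>b. bounded_linear (\<beta> b)" "\<And>x. x = (\<Sum>b\<in>B. \<beta> b x *\<^sub>R b)"
  shows "A = (\<Sum>b\<in>B. tensor (\<beta> b) (blinfun_apply A b))"
proof (rule blinfun_eqI)
  fix v
  show "blinfun_apply A v = blinfun_apply (\<Sum>b\<in>B. tensor (\<beta> b) (blinfun_apply A b)) v"
    using linear_eq_coordinates[OF _ assms(1,3), of "blinfun_apply A" v] assms(2)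
    by (simp add: blinfun.sum_left bounded_linear.linear[OF blinfun.bounded_linear_right])
qed

lemma fin_dim_blinfun:
  assumes "fin_dim TYPE('a::real_normed_vector)" "fin_dim TYPE('b::real_normed_vector)"
  shows "fin_dim TYPE('a \<Rightarrow>\<^sub>L 'b)"
proof -
  obtain B and \<beta> :: "'a \<Rightarrow> 'a \<Rightarrow> real" where B: "finite B" "independent B" "span B = UNIV"
    "\<And>b. bounded_linear (\<beta> b)" "\<And>x. x = (\<Sum>b\<in>B. \<beta> b x *\<^sub>R b)"
    using fin_dim_coordinates[OF assms(1)] by metis
  obtain C :: "'b set" where C: "finite C" "span C = UNIV" using assms by (auto simp: fin_dim_def)
  let ?S = "\<Union>b\<in>B. tensor (\<beta> b) ` C"
  have "A \<in> span ?S" for A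
  proof -
    have "tensor (\<beta> b) (blinfun_apply A b) \<in> span ?S" if "b \<in> B" for b
    proof -
      have "tensor (\<beta> b) (blinfun_apply A b) \<in> tensor (\<beta> b) ` span C" using C by auto
      also have "\<dots> = span (tensor (\<beta> b) ` C)"
        by (intro linear_span_image[symmetric] bounded_linear.linear bounded_linear_tensor B)
      also have "\<dots> \<subseteq> span ?S" using that by (intro span_mono) auto
      finally show ?thesis .
    qed
    then show ?thesis
      by (subst blinfun_eq_tensor_sum[OF B(1,4,5)]) (auto intro: span_sum)
  qed
  then have "span ?S = UNIV" by auto
  then show ?thesis unfolding fin_dim_def using B C by (intro exI[of _ ?S]) auto
qed

text \<open>The functionals are the coordinates along those vectors that extend a basis of
  \<open>H\<close> to one of the whole space. Elimination imposes them one at a time.\<close>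

lemma subspace_eq_common_kernel:
  fixes H :: "'a::real_vector set"
  assumes fd: "fin_dim TYPE('a)" and H: "subspace H"
  obtains \<Lambda> :: "('a \<Rightarrow> real) set"
  where "finite \<Lambda>" "\<And>l. l \<in> \<Lambda> \<Longrightarrow> linear l" "H = {y. \<forall>l\<in>\<Lambda>. l y = 0}"
proof -
  obtain B where B: "finite B" "independent B" "span B = H" using finite_spanning_basis[OF fd H] .
  obtain B' where B': "B \<subseteq> B'" "independent B'" "UNIV \<subseteq> span B'"
    using maximal_independent_subset_extend[of B UNIV] B by auto
  then have fin: "finite B'" and sp: "span B' = UNIV" using fin_dim_independent_finite[OF fd] by auto
  define \<Lambda> where "\<Lambda> = (\<lambda>b v. representation B' v b) ` (B' - B)"
  show ?thesis
  proof (rule that[of \<Lambda>])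
    show "finite \<Lambda>" using fin by (simp add: \<Lambda>_def)
    show "linear l" if "l \<in> \<Lambda>" for l
      using that linear_representation_coeff[OF B'(2) sp] by (auto simp: \<Lambda>_def)
    show "H = {y. \<forall>l\<in>\<Lambda>. l y = 0}"
    proof safe
      fix y l assume "y \<in> H" "l \<in> \<Lambda>"
      then obtain b where b: "b \<in> B' - B" "l = (\<lambda>v. representation B' v b)" by (auto simp: \<Lambda>_def)
      have "representation B' y = representation B y"
        using \<open>y \<in> H\<close> B B' by (metis representation_extend)
      then show "l y = 0" using b representation_ne_zero by fastforce
    next
      fix y assume y: "\<forall>l\<in>\<Lambda>. l y = 0"
      have "y = (\<Sum>b\<in>B'. representation B' y b *\<^sub>R b)"
        using sum_representation_eq[of B' y B'] B' fin sp by auto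
      also have "\<dots> = (\<Sum>b\<in>B. representation B' y b *\<^sub>R b)"
        using y fin B' by (intro sum.mono_neutral_right) (auto simp: \<Lambda>_def)
      also have "\<dots> \<in> H" unfolding B(3)[symmetric] by (intro span_sum span_scale span_base)
      finally show "y \<in> H" .
    qed
  qed
qed

lemma subspace_eq_if_dim_eq:
  fixes S :: "'a::real_vector set"
  assumes fd: "fin_dim TYPE('a)" and "subspace S" "subspace T" "S \<subseteq> T" "dim T \<le> dim S"
  shows "S = T"
proof -
  obtain B where B: "finite B" "independent B" "span B = S"
    using finite_spanning_basis[OF fd \<open>subspace S\<close>] .
  have BT: "B \<subseteq> T" using assms B span_superset by auto
  obtain B' where B': "B \<subseteq> B'" "B' \<subseteq> T" "independent B'" "T \<subseteq> span B'"
    using maximal_independent_subset_extend[OF BT B(2)] by auto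
  have "card B' = dim T" by (rule basis_card_eq_dim) (use B' in auto)
  moreover have "card B = dim S"
    by (rule basis_card_eq_dim) (use B span_superset in auto)
  ultimately have "B = B'"
    using B' fin_dim_independent_finite[OF fd, of B'] assms
    by (metis card_seteq)
  then show ?thesis using B B' assms by auto
qed

lemma dim_image_inj_linear:
  fixes f :: "'a::real_vector \<Rightarrow> 'b::real_vector"
  assumes "fin_dim TYPE('a)" "linear f" "inj f" "subspace S"
  shows "dim (f ` S) = dim S"
proof -
  obtain B where B: "finite B" "independent B" "span B = S"
    using finite_spanning_basis[OF assms(1,4)] .
  have "independent (f ` B)"
    using linear_independent_injective_image[OF assms(2) B(2)] assms(3) inj_on_subset by blast
  moreover have "span (f ` B) = f ` S" using linear_span_image[OF assms(2)] B by simp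
  ultimately have "dim (f ` S) = card (f ` B)" using dim_span_eq_card_independent by metis
  also have "\<dots> = card B" using assms(3) by (meson card_image inj_on_subset subset_UNIV)
  finally show ?thesis using B dim_span_eq_card_independent by metis
qed

text \<open>Independence of the image set alone would accept a family that takes the same value at
  two indices; injectivity excludes this.\<close>

definition indep_family :: "'i set \<Rightarrow> ('i \<Rightarrow> 'a::real_vector) \<Rightarrow> bool" where
  "indep_family I w \<longleftrightarrow> inj_on w I \<and> independent (w ` I)"

lemma indep_familyI:
  assumes "finite I" "\<And>u i. (\<Sum>i\<in>I. u i *\<^sub>R w i) = 0 \<Longrightarrow> i \<in> I \<Longrightarrow> u i = (0::real)"
  shows "indep_family I w"
proof -
  have inj: "inj_on w I"
  proof (rule inj_onI, rule ccontr)
    fix i j assume ij: "i \<in> I" "j \<in> I" "w i = w j" "i \<noteq> j"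
    \<comment> \<open>Two equal members satisfy the nontrivial relation with coefficients 1 and
      -1.\<close>
    let ?u = "\<lambda>k. if k = i then 1 else if k = j then -1 else (0::real)"
    have "(\<Sum>k\<in>I. ?u k *\<^sub>R w k) = (\<Sum>k\<in>{i,j}. ?u k *\<^sub>R w k)"
      using ij assms(1) by (intro sum.mono_neutral_right) auto
    also have "\<dots> = 0" using ij by simp
    finally have "?u i = 0" using assms(2)[of ?u i] ij by blast
    then show False by simp
  qed
  moreover have "independent (w ` I)"
  proof (rule independent_if_scalars_zero)
    fix f x assume f: "(\<Sum>x\<in>w ` I. f x *\<^sub>R x) = 0" and x: "x \<in> w ` I"
    then have "(\<Sum>i\<in>I. f (w i) *\<^sub>R w i) = 0" using inj by (simp add: sum.reindex)
    then show "f x = 0" using assms(2)[of "f \<circ> w"] x by auto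
  qed (use assms in auto)
  ultimately show ?thesis by (simp add: indep_family_def)
qed

lemma indep_familyD:
  assumes "indep_family I w" "finite I" "(\<Sum>i\<in>I. u i *\<^sub>R w i) = 0" "i \<in> I"
  shows "u i = (0::real)"
proof -
  have inj: "inj_on w I" and ind: "independent (w ` I)" using assms by (auto simp: indep_family_def)
  let ?u = "\<lambda>v. u (the_inv_into I w v)"
  have "(\<Sum>v\<in>w ` I. ?u v *\<^sub>R v) = (\<Sum>i\<in>I. u i *\<^sub>R w i)"
    using inj by (subst sum.reindex) (auto intro!: sum.cong simp: the_inv_into_f_f)
  then have "?u (w i) = 0"
    using independentD[OF ind, of "w ` I" ?u "w i"] assms by auto
  then show ?thesis using inj assms by (simp add: the_inv_into_f_f)
qed

lemma indep_family_mono: "indep_family I w \<Longrightarrow> J \<subseteq> I \<Longrightarrow> indep_family J w"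
  unfolding indep_family_def by (meson image_mono independent_mono inj_on_subset)

lemma indep_family_cong: "(\<And>i. i \<in> I \<Longrightarrow> v i = w i) \<Longrightarrow> indep_family I v = indep_family I w"
  unfolding indep_family_def by (metis image_cong inj_on_cong)

lemma indep_family_dim:
  assumes "indep_family I w"
  shows "dim (span (w ` I)) = card I"
  using assms unfolding indep_family_def
  by (simp add: card_image dim_eq_card_independent del: dim_span) (simp add: card_image dim_eq_card_independent)

lemma indep_family_image:
  assumes "linear f" "inj f" "finite I"
  shows "indep_family I (\<lambda>i. f (w i)) \<longleftrightarrow> indep_family I w"
proof -
  have *: "(\<Sum>i\<in>I. u i *\<^sub>R f (w i)) = 0 \<longleftrightarrow> (\<Sum>i\<in>I. u i *\<^sub>R w i) = 0" for u
  proof -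
    have "(\<Sum>i\<in>I. u i *\<^sub>R f (w i)) = f (\<Sum>i\<in>I. u i *\<^sub>R w i)"
      by (simp only: linear_sum[OF assms(1)] linear_scale[OF assms(1)])
    then show ?thesis
      using linear_injective_0[OF assms(1)] assms(2) linear_0[OF assms(1)] by auto
  qed
  show ?thesis
  proof
    assume "indep_family I (\<lambda>i. f (w i))"
    from indep_familyD[OF this assms(3)] show "indep_family I w"
      by (intro indep_familyI[OF assms(3)]) (auto simp only: *)
  next
    assume "indep_family I w"
    from indep_familyD[OF this assms(3)] show "indep_family I (\<lambda>i. f (w i))"
      by (intro indep_familyI[OF assms(3)]) (auto simp only: *)
  qed
qed

lemma span_image_family:
  "finite I \<Longrightarrow> span (w ` I) = range (\<lambda>u. \<Sum>i\<in>I. u i *\<^sub>R w i)"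
proof (intro subset_antisym subsetI)
  fix y assume fin: "finite I" and y: "y \<in> span (w ` I)"
  from y show "y \<in> range (\<lambda>u. \<Sum>i\<in>I. u i *\<^sub>R w i)"
  proof (induction rule: span_induct_alt)
    case base
    show ?case by (rule range_eqI[where x="\<lambda>_. 0"]) simp
  next
    case (step c x y)
    then obtain i u where i: "i \<in> I" "x = w i" "y = (\<Sum>i\<in>I. u i *\<^sub>R w i)" by auto
    have "(\<Sum>j\<in>I. (if j = i then c else 0) *\<^sub>R w j) = (\<Sum>j\<in>{i}. (if j = i then c else 0) *\<^sub>R w j)"
      using i fin by (intro sum.mono_neutral_right) auto
    then have "c *\<^sub>R x + y = (\<Sum>j\<in>I. ((if j = i then c else 0) + u j) *\<^sub>R w j)"
      using i by (simp add: scaleR_add_left sum.distrib)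
    then show ?case by (rule range_eqI[where x="\<lambda>j. (if j = i then c else 0) + u j"])
  qed
qed (auto intro: span_sum span_scale span_base)

section \<open>Smooth functions\<close>

lemma frechet_derivative_eqI:
  "(f has_derivative f') (at x) \<Longrightarrow> frechet_derivative f (at x) = f'"
  using frechet_derivative_at by metis

lemma differentiable_cong_open:
  assumes "open S" "x \<in> S" "\<And>y. y \<in> S \<Longrightarrow> f y = g y" "f differentiable (at x)"
  shows "g differentiable (at x)"
  using assms has_derivative_transform_within_open[of f _ x UNIV S g] unfolding differentiable_def by fastforce

lemma frechet_derivative_cong_open:
  assumes "open S" "x \<in> S" "\<And>y. y \<in> S \<Longrightarrow> f y = g y"
  shows "frechet_derivative f (at x) = frechet_derivative g (at x)"
proof -
  have "(f has_derivative D) (at x) \<longleftrightarrow> (g has_derivative D) (at x)" for D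
    using has_derivative_transform_within_open[of f D x UNIV S g]
      has_derivative_transform_within_open[of g D x UNIV S f] assms by fastforce
  then show ?thesis by (simp add: frechet_derivative_def)
qed

lemma Ck_on_cong:
  assumes "open S" "\<And>x. x \<in> S \<Longrightarrow> f x = g x" "Ck_on k S f"
  shows "Ck_on k S g"
  using assms(2,3)
proof (induction k arbitrary: f g)
  case 0
  then show ?case using continuous_on_cong[of S S f g] by simp
next
  case (Suc k)
  have "Ck_on k S (\<lambda>x. frechet_derivative g (at x) v)" for v
    by (rule Suc.IH[of "\<lambda>x. frechet_derivative f (at x) v"])
       (use Suc.prems frechet_derivative_cong_open[OF assms(1), of _ f g] in auto)
  moreover have "g differentiable (at x)" if "x \<in> S" for x
    using differentiable_cong_open[OF assms(1) that, of f g] Suc.prems that by simp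
  ultimately show ?case by simp
qed

lemma Ck_on_subset: "T \<subseteq> S \<Longrightarrow> Ck_on k S f \<Longrightarrow> Ck_on k T f"
  by (induction k arbitrary: f) (auto intro: continuous_on_subset)

lemma Ck_on_SucD: "Ck_on (Suc k) S f \<Longrightarrow> Ck_on k S f"
proof (induction k arbitrary: f)
  case 0
  then show ?case
    by (simp add: continuous_at_imp_continuous_on differentiable_imp_continuous_within)
next
  case (Suc k)
  have "Ck_on k S (\<lambda>x. frechet_derivative f (at x) v)" for v
    using Suc.prems by (intro Suc.IH) simp
  then show ?case using Suc.prems by simp
qed

text \<open>As all orders occur at once, the shift from \<open>k\<close> to \<open>Suc k\<close>
  disappears, and a derivative can be taken without keeping count. The converse gets order 0 from
  \<open>Ck_on_SucD\<close>.\<close>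

lemma smooth_on_iff:
  "smooth_on S f \<longleftrightarrow>
     (\<forall>x\<in>S. f differentiable (at x)) \<and> (\<forall>v. smooth_on S (\<lambda>x. frechet_derivative f (at x) v))"
proof
  assume "smooth_on S f"
  then have "Ck_on (Suc k) S f" for k by (simp only: smooth_on_def)
  then show "(\<forall>x\<in>S. f differentiable (at x)) \<and> (\<forall>v. smooth_on S (\<lambda>x. frechet_derivative f (at x) v))"
    by (auto simp: smooth_on_def)
next
  assume *: "(\<forall>x\<in>S. f differentiable (at x)) \<and> (\<forall>v. smooth_on S (\<lambda>x. frechet_derivative f (at x) v))"
  then have "Ck_on (Suc k) S f" for k by (simp add: smooth_on_def)
  then show "smooth_on S f" unfolding smooth_on_def using Ck_on_SucD by blast
qed

lemma smooth_on_differentiable: "smooth_on S f \<Longrightarrow> x \<in> S \<Longrightarrow> f differentiable (at x)"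
  using smooth_on_iff by blast

lemma smooth_on_derivative: "smooth_on S f \<Longrightarrow> smooth_on S (\<lambda>x. frechet_derivative f (at x) v)"
  using smooth_on_iff by blast

lemma smooth_on_has_derivative:
  "smooth_on S f \<Longrightarrow> x \<in> S \<Longrightarrow> (f has_derivative frechet_derivative f (at x)) (at x)"
  using smooth_on_differentiable frechet_derivative_works by blast

lemma smooth_on_linear_derivative:
  "smooth_on S f \<Longrightarrow> x \<in> S \<Longrightarrow> bounded_linear (frechet_derivative f (at x))"
  using smooth_on_has_derivative has_derivative_bounded_linear by blast

lemma smooth_on_continuous: "smooth_on S f \<Longrightarrow> continuous_on S f"
  using Ck_on.simps(1) smooth_on_def by blast

lemma smooth_on_cong:
  "open S \<Longrightarrow> (\<And>x. x \<in> S \<Longrightarrow> f x = g x) \<Longrightarrow> smooth_on S f \<Longrightarrow> smooth_on S g"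
  unfolding smooth_on_def using Ck_on_cong by blast

lemma smooth_on_subset: "smooth_on S f \<Longrightarrow> T \<subseteq> S \<Longrightarrow> smooth_on T f"
  unfolding smooth_on_def using Ck_on_subset by blast

lemma Ck_on_local:
  assumes "\<And>x. x \<in> S \<Longrightarrow> \<exists>U. open U \<and> x \<in> U \<and> Ck_on k U f"
  shows "Ck_on k S f"
  using assms
proof (induction k arbitrary: f)
  case 0
  show ?case unfolding Ck_on.simps continuous_on_eq_continuous_within
  proof
    fix x assume "x \<in> S"
    then obtain U where "open U" "x \<in> U" "Ck_on 0 U f" using 0 by blast
    then have "continuous (at x) f" by (simp add: continuous_on_eq_continuous_at)
    then show "continuous (at x within S) f" by (rule continuous_at_imp_continuous_at_within)
  qed
next
  case (Suc k)
  have "f differentiable (at x)" if "x \<in> S" for x using Suc.prems[OF that] by auto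
  moreover have "Ck_on k S (\<lambda>x. frechet_derivative f (at x) v)" for v
  proof (rule Suc.IH)
    fix x assume "x \<in> S"
    then show "\<exists>U. open U \<and> x \<in> U \<and> Ck_on k U (\<lambda>x. frechet_derivative f (at x) v)"
      using Suc.prems[of x] by auto
  qed
  ultimately show ?case by simp
qed

lemma smooth_on_local:
  assumes "\<And>x. x \<in> S \<Longrightarrow> \<exists>U. open U \<and> x \<in> U \<and> smooth_on U f"
  shows "smooth_on S f"
  unfolding smooth_on_def
proof (intro allI Ck_on_local)
  fix k x assume "x \<in> S"
  then obtain U where "open U" "x \<in> U" "smooth_on U f" using assms by metis
  then show "\<exists>U. open U \<and> x \<in> U \<and> Ck_on k U f" by (auto simp: smooth_on_def)
qed

lemma smooth_on_const [simp, intro]: "smooth_on S (\<lambda>x. c)"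
proof -
  have "Ck_on k S (\<lambda>x. c)" for k by (induction k arbitrary: c) simp_all
  then show ?thesis by (simp add: smooth_on_def)
qed

lemma Ck_on_bounded_linear:
  assumes L: "bounded_linear L" and S: "open S" and "Ck_on k S f"
  shows "Ck_on k S (\<lambda>x. L (f x))"
  using assms(3)
proof (induction k arbitrary: f)
  case 0
  then show ?case using continuous_on_compose2[OF linear_continuous_on[OF L, of UNIV]] by auto
next
  case (Suc k)
  have der: "((\<lambda>x. L (f x)) has_derivative (\<lambda>v. L (frechet_derivative f (at x) v))) (at x)" if "x \<in> S" for x
    using Suc.prems that by (intro bounded_linear.has_derivative[OF L]) (simp add: frechet_derivative_works)
  have "Ck_on k S (\<lambda>x. frechet_derivative (\<lambda>x. L (f x)) (at x) v)" for v
    by (rule Ck_on_cong[OF S _ Suc.IH[of "\<lambda>x. frechet_derivative f (at x) v"]])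
       (use Suc.prems frechet_derivative_eqI[OF der] in auto)
  then show ?case using der by (auto simp: differentiable_def)
qed

lemma smooth_on_bounded_linear:
  "bounded_linear L \<Longrightarrow> open S \<Longrightarrow> smooth_on S f \<Longrightarrow> smooth_on S (\<lambda>x. L (f x))"
  unfolding smooth_on_def using Ck_on_bounded_linear by blast

lemma Ck_on_add:
  assumes S: "open S" and "Ck_on k S f" "Ck_on k S g"
  shows "Ck_on k S (\<lambda>x. f x + g x)"
  using assms(2,3)
proof (induction k arbitrary: f g)
  case 0
  then show ?case by (auto intro: continuous_intros)
next
  case (Suc k)
  have der: "((\<lambda>x. f x + g x) has_derivative
      (\<lambda>v. frechet_derivative f (at x) v + frechet_derivative g (at x) v)) (at x)" if "x \<in> S" for x
    using Suc.prems that by (intro has_derivative_add) (simp_all add: frechet_derivative_works)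
  have "Ck_on k S (\<lambda>x. frechet_derivative (\<lambda>x. f x + g x) (at x) v)" for v
    by (rule Ck_on_cong[OF S _ Suc.IH[of "\<lambda>x. frechet_derivative f (at x) v" "\<lambda>x. frechet_derivative g (at x) v"]])
       (use Suc.prems frechet_derivative_eqI[OF der] in auto)
  then show ?case using der by (auto simp: differentiable_def)
qed

lemma smooth_on_add:
  "open S \<Longrightarrow> smooth_on S f \<Longrightarrow> smooth_on S g \<Longrightarrow> smooth_on S (\<lambda>x. f x + g x)"
  unfolding smooth_on_def using Ck_on_add by blast

lemma smooth_on_sum:
  assumes "open S" "\<And>i. i \<in> I \<Longrightarrow> smooth_on S (f i)"
  shows "smooth_on S (\<lambda>x. \<Sum>i\<in>I. f i x)"
  using assms by (induction I rule: infinite_finite_induct) (auto intro: smooth_on_add)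

text \<open>Each term of the product rule has one undifferentiated factor, which is one order too
  good for the induction hypothesis; \<open>Ck_on_SucD\<close> lowers it.\<close>

lemma Ck_on_bilinear:
  assumes B: "bounded_bilinear B" and S: "open S" and "Ck_on k S f" "Ck_on k S g"
  shows "Ck_on k S (\<lambda>x. B (f x) (g x))"
  using assms(3,4)
proof (induction k arbitrary: f g)
  case 0
  then show ?case using bounded_bilinear.continuous_on[OF B] by auto
next
  case (Suc k)
  have der: "((\<lambda>x. B (f x) (g x)) has_derivative
      (\<lambda>v. B (f x) (frechet_derivative g (at x) v) + B (frechet_derivative f (at x) v) (g x))) (at x)" if "x \<in> S" for x
    using Suc.prems that by (intro bounded_bilinear.FDERIV[OF B]) (simp_all add: frechet_derivative_works)
  have "Ck_on k S (\<lambda>x. B (f x) (frechet_derivative g (at x) v) + B (frechet_derivative f (at x) v) (g x))" for v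
    using Suc.prems by (intro Ck_on_add[OF S] Suc.IH) (auto intro: Ck_on_SucD[of k S] simp del: Ck_on.simps simp: Ck_on.simps(2))
  then have "Ck_on k S (\<lambda>x. frechet_derivative (\<lambda>x. B (f x) (g x)) (at x) v)" for v
    by (rule Ck_on_cong[OF S, rotated]) (use frechet_derivative_eqI[OF der] in auto)
  then show ?case using der by (auto simp: differentiable_def)
qed

lemma smooth_on_bilinear:
  "bounded_bilinear B \<Longrightarrow> open S \<Longrightarrow> smooth_on S f \<Longrightarrow> smooth_on S g \<Longrightarrow> smooth_on S (\<lambda>x. B (f x) (g x))"
  unfolding smooth_on_def using Ck_on_bilinear by blast

lemmas smooth_on_scaleR = smooth_on_bilinear[OF bounded_bilinear_scaleR]
lemmas smooth_on_mult = smooth_on_bilinear[OF bounded_bilinear_mult]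

lemma smooth_on_minus: "open S \<Longrightarrow> smooth_on S f \<Longrightarrow> smooth_on S (\<lambda>x. - f x)"
  by (rule smooth_on_bounded_linear[OF bounded_linear_minus[OF bounded_linear_ident]])

lemma smooth_on_diff:
  "open S \<Longrightarrow> smooth_on S f \<Longrightarrow> smooth_on S g \<Longrightarrow> smooth_on S (\<lambda>x. f x - g x)"
  using smooth_on_add[of S f "\<lambda>x. - g x"] smooth_on_minus[of S g] by simp

lemma smooth_on_ident [simp, intro]: "smooth_on S (\<lambda>x. x)"
  by (subst smooth_on_iff) auto

lemma smooth_on_linear: "bounded_linear L \<Longrightarrow> open S \<Longrightarrow> smooth_on S L"
  using smooth_on_bounded_linear[of L S "\<lambda>x. x"] by simp

text \<open>With \<open>f\<close> smooth from the start the induction concerns the inverse alone: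
  its derivative is a product of two copies of itself and a derivative of \<open>f\<close>.\<close>

lemma Ck_on_inverse:
  fixes f :: "'a::real_normed_vector \<Rightarrow> real"
  assumes S: "open S" and f: "smooth_on S f" and nz: "\<And>x. x \<in> S \<Longrightarrow> f x \<noteq> 0"
  shows "Ck_on k S (\<lambda>x. inverse (f x))"
proof (induction k)
  case 0
  then show ?case using f nz by (simp add: smooth_on_continuous continuous_on_inverse)
next
  case (Suc k)
  have der: "((\<lambda>x. inverse (f x)) has_derivative
      (\<lambda>v. - (inverse (f x) * frechet_derivative f (at x) v * inverse (f x)))) (at x)" if "x \<in> S" for x
    using f nz that by (intro Deriv.has_derivative_inverse smooth_on_has_derivative)
  have "Ck_on k S (\<lambda>x. - (inverse (f x) * frechet_derivative f (at x) v * inverse (f x)))" for v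
    using Suc.IH smooth_on_derivative[OF f]
    by (intro Ck_on_bounded_linear[OF bounded_linear_minus[OF bounded_linear_ident] S]
         Ck_on_bilinear[OF bounded_bilinear_mult S]) (auto simp: smooth_on_def)
  then have "Ck_on k S (\<lambda>x. frechet_derivative (\<lambda>x. inverse (f x)) (at x) v)" for v
    by (rule Ck_on_cong[OF S, rotated]) (use frechet_derivative_eqI[OF der] in auto)
  then show ?case using der by (auto simp: differentiable_def)
qed

lemma smooth_on_inverse:
  fixes f :: "'a::real_normed_vector \<Rightarrow> real"
  shows "open S \<Longrightarrow> smooth_on S f \<Longrightarrow> (\<And>x. x \<in> S \<Longrightarrow> f x \<noteq> 0) \<Longrightarrow> smooth_on S (\<lambda>x. inverse (f x))"
  using Ck_on_inverse[of S f] by (auto simp: smooth_on_def[of S "\<lambda>x. inverse (f x)"])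

lemma smooth_on_divide:
  fixes f :: "'a::real_normed_vector \<Rightarrow> real"
  assumes "open S" "smooth_on S f" "smooth_on S g" "\<And>x. x \<in> S \<Longrightarrow> g x \<noteq> 0"
  shows "smooth_on S (\<lambda>x. f x / g x)"
  using smooth_on_mult[OF assms(1,2) smooth_on_inverse[OF assms(1,3,4)]] by (simp add: divide_inverse)

text \<open>The chain rule applies the derivative of \<open>f\<close> at a moving point to a moving
  vector. Expanding the vector in coordinates separates the two, and what remains is a partial
  derivative of \<open>f\<close> composed with \<open>g\<close>; hence the induction runs over all
  \<open>f\<close>.\<close>

lemma Ck_on_compose:
  fixes f :: "'b::real_normed_vector \<Rightarrow> 'c::real_normed_vector" and g :: "'a::real_normed_vector \<Rightarrow> 'b"
  assumes fd: "fin_dim TYPE('b)" and S: "open S" and T: "open T" and gS: "g ` S \<subseteq> T"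
    and g: "smooth_on S g" and f: "smooth_on T f"
  shows "Ck_on k S (\<lambda>x. f (g x))"
  using f
proof (induction k arbitrary: f)
  case 0
  then show ?case
    using continuous_on_compose2[OF smooth_on_continuous smooth_on_continuous gS] g by auto
next
  case (Suc k)
  obtain B and \<beta> :: "'b \<Rightarrow> 'b \<Rightarrow> real" where B: "finite B" "\<And>b. bounded_linear (\<beta> b)"
    "\<And>x. x = (\<Sum>b\<in>B. \<beta> b x *\<^sub>R b)"
    using fin_dim_coordinates[OF fd] by metis
  have der: "((\<lambda>x. f (g x)) has_derivative
      (\<lambda>v. frechet_derivative f (at (g x)) (frechet_derivative g (at x) v))) (at x)" if "x \<in> S" for x
    using diff_chain_at[OF smooth_on_has_derivative[OF g that] smooth_on_has_derivative[OF Suc.prems]] gS that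
    by (auto simp: o_def)
  have eq: "frechet_derivative f (at (g x)) (frechet_derivative g (at x) v) =
     (\<Sum>b\<in>B. \<beta> b (frechet_derivative g (at x) v) *\<^sub>R frechet_derivative f (at (g x)) b)" if "x \<in> S" for x v
    using gS that
    by (intro linear_eq_coordinates[OF _ B(1,3)] bounded_linear.linear smooth_on_linear_derivative[OF Suc.prems]) auto
  have sumC: "Ck_on k S (\<lambda>x. \<Sum>b\<in>B'. \<beta> b (frechet_derivative g (at x) v) *\<^sub>R frechet_derivative f (at (g x)) b)"
    if "finite B'" for B' v
    using that
  proof (induction B')
    case empty
    show ?case using smooth_on_const[of S "0::'c"] by (simp del: smooth_on_const add: smooth_on_def)
  next
    case (insert b B')
    have "Ck_on k S (\<lambda>x. \<beta> b (frechet_derivative g (at x) v) *\<^sub>R frechet_derivative f (at (g x)) b)"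
      using smooth_on_bounded_linear[OF B(2) S smooth_on_derivative[OF g, of v], of b]
        Suc.IH[OF smooth_on_derivative[OF Suc.prems, of b]]
      by (intro Ck_on_bilinear[OF bounded_bilinear_scaleR S]) (auto simp: smooth_on_def)
    then show ?case using insert by (simp add: Ck_on_add[OF S])
  qed
  have "Ck_on k S (\<lambda>x. frechet_derivative (\<lambda>x. f (g x)) (at x) v)" for v
    by (rule Ck_on_cong[OF S _ sumC[OF B(1), of v]])
       (simp add: frechet_derivative_eqI[OF der] eq)
  then show ?case using der by (auto simp: differentiable_def)
qed

lemma smooth_on_compose:
  fixes f :: "'b::real_normed_vector \<Rightarrow> 'c::real_normed_vector" and g :: "'a::real_normed_vector \<Rightarrow> 'b"
  assumes "fin_dim TYPE('b)" "open S" "open T" "smooth_on T f" "smooth_on S g" "g ` S \<subseteq> T"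
  shows "smooth_on S (\<lambda>x. f (g x))"
  using Ck_on_compose[OF assms(1-3,6,5,4)] by (simp add: smooth_on_def)

section \<open>Flat functions and bump functions\<close>

lemma fin_dim_real: "fin_dim TYPE(real)"
  unfolding fin_dim_def
proof (intro exI conjI)
  have "x \<in> span {1}" for x :: real using span_scale[OF span_base[of 1 "{1::real}"], of x] by simp
  then show "span {1::real} = UNIV" by auto
qed simp

text \<open>The classical function that is flat at 0. The extra power of the inverse makes the
  family closed under differentiation up to linear combinations, so that smoothness follows by
  induction over all \<open>n\<close> together.\<close>

definition flat_exp :: "nat \<Rightarrow> real \<Rightarrow> real" where
  "flat_exp n x = (if x > 0 then inverse x ^ n * exp (- inverse x) else 0)"

lemma flat_exp_tendsto_0: "(flat_exp n \<longlongrightarrow> 0) (at 0)"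
proof -
  have "((\<lambda>x. inverse x ^ n / exp (inverse x)) \<longlongrightarrow> 0) (at_right (0::real))"
    by (rule filterlim_compose[OF tendsto_power_div_exp_0 filterlim_inverse_at_top_right])
  then have "(flat_exp n \<longlongrightarrow> 0) (at_right 0)"
    by (rule Lim_transform_eventually)
       (auto simp: eventually_at_filter flat_exp_def exp_minus divide_inverse)
  moreover have "(flat_exp n \<longlongrightarrow> 0) (at_left 0)"
    by (rule tendsto_eventually) (auto simp: eventually_at_filter flat_exp_def)
  ultimately show ?thesis by (simp add: filterlim_at_split)
qed

lemma flat_exp_has_derivative:
  "(flat_exp n has_real_derivative flat_exp (n + 2) x - real n * flat_exp (n + 1) x) (at x)"
proof -
  consider "x > 0" | "x < 0" | "x = 0" by linarith
  then show ?thesis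
  proof cases
    case 1
    have "((\<lambda>x. inverse x ^ n * exp (- inverse x)) has_real_derivative
       (real n * (- (inverse x * inverse x) * inverse x ^ (n - 1)) * exp (- inverse x)
         + inverse x ^ n * (exp (- inverse x) * (inverse x * inverse x)))) (at x)"
      using 1 by (auto intro!: derivative_eq_intros simp: power2_eq_square)
    moreover have "real n * (- (inverse x * inverse x) * inverse x ^ (n - 1)) * exp (- inverse x)
         + inverse x ^ n * (exp (- inverse x) * (inverse x * inverse x)) =
       flat_exp (n + 2) x - real n * flat_exp (n + 1) x"
      using 1 by (cases n) (auto simp: flat_exp_def algebra_simps)
    ultimately have "((\<lambda>x. inverse x ^ n * exp (- inverse x)) has_real_derivative
       flat_exp (n + 2) x - real n * flat_exp (n + 1) x) (at x)" by simp
    then show ?thesis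
      by (rule has_field_derivative_transform_within_open[where S="{0<..}"]) (use 1 in \<open>auto simp: flat_exp_def\<close>)
  next
    case 2
    have "((\<lambda>x. 0) has_real_derivative flat_exp (n + 2) x - real n * flat_exp (n + 1) x) (at x)"
      using 2 by (simp add: flat_exp_def)
    then show ?thesis
      by (rule has_field_derivative_transform_within_open[where S="{..<0}"]) (use 2 in \<open>auto simp: flat_exp_def\<close>)
  next
    case 3
    \<comment> \<open>At 0 the difference quotient is again a member of the family, whose limit is
      known.\<close>
    have "flat_exp (Suc n) h = (flat_exp n (0 + h) - flat_exp n 0) / h" if "h \<noteq> 0" for h
      using that by (auto simp: flat_exp_def divide_inverse)
    then have "(\<lambda>h. (flat_exp n (0 + h) - flat_exp n 0) / h) \<midarrow>0\<rightarrow> 0"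
      using Lim_transform_eventually[OF flat_exp_tendsto_0[of "Suc n"]]
      by (auto simp: eventually_at_filter)
    then show ?thesis using 3 by (simp add: DERIV_def flat_exp_def)
  qed
qed

lemma smooth_flat_exp: "smooth_on UNIV (flat_exp n)"
proof -
  have "Ck_on k UNIV (flat_exp n)" for k
  proof (induction k arbitrary: n)
    case 0
    show ?case
      using DERIV_isCont[OF flat_exp_has_derivative] by (simp add: continuous_at_imp_continuous_on)
  next
    case (Suc k)
    have der: "(flat_exp n has_derivative (\<lambda>v. (flat_exp (n + 2) x - real n * flat_exp (n + 1) x) * v)) (at x)" for x
      using flat_exp_has_derivative[of n x] by (simp add: has_field_derivative_def)
    have "Ck_on k UNIV (\<lambda>x. v * flat_exp (n + 2) x + (- v * real n) * flat_exp (n + 1) x)" for v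
      by (intro Ck_on_add Ck_on_bounded_linear[OF bounded_linear_mult_right] Suc.IH open_UNIV)
    then have "Ck_on k UNIV (\<lambda>x. frechet_derivative (flat_exp n) (at x) v)" for v
      by (simp add: frechet_derivative_eqI[OF der] algebra_simps)
    then show ?case using der by (auto simp: differentiable_def)
  qed
  then show ?thesis by (simp add: smooth_on_def)
qed

lemma flat_exp_pos: "x > 0 \<Longrightarrow> flat_exp n x > 0" and flat_exp_nonneg: "flat_exp n x \<ge> 0"
  and flat_exp_zero: "x \<le> 0 \<Longrightarrow> flat_exp n x = 0"
  by (auto simp: flat_exp_def)

text \<open>In the quotient of \<open>a\<close> by \<open>a + b\<close>, the function
  \<open>a\<close> is positive inside the large ball and \<open>b\<close> outside the closed small
  one, so the denominator never vanishes. The squared distance is used because, unlike the distance,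
  it is smooth at \<open>x0\<close>.\<close>

lemma smooth_bump:
  fixes x0 :: "'a::real_inner"
  assumes "r > 0"
  obtains \<eta> :: "'a \<Rightarrow> real"
  where "smooth_on UNIV \<eta>" "\<And>x. x \<in> ball x0 (r/2) \<Longrightarrow> \<eta> x = 1" "\<And>x. x \<notin> ball x0 r \<Longrightarrow> \<eta> x = 0"
proof
  define d where "d x = (x - x0) \<bullet> (x - x0)" for x :: 'a
  define a where "a x = flat_exp 0 (r\<^sup>2 - d x)" for x :: 'a
  define b where "b x = flat_exp 0 (d x - (r/2)\<^sup>2)" for x :: 'a
  have d: "d x = (dist x0 x)\<^sup>2" for x by (simp add: d_def dist_norm norm_minus_commute[of x0] power2_norm_eq_inner)
  have smd: "smooth_on UNIV d"
    unfolding d_def by (intro smooth_on_bilinear[OF bounded_bilinear_inner] smooth_on_diff smooth_on_ident smooth_on_const open_UNIV)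
  have sma: "smooth_on UNIV a" unfolding a_def
    by (rule smooth_on_compose[OF fin_dim_real _ _ smooth_flat_exp]) (auto intro: smooth_on_diff smd)
  have smb: "smooth_on UNIV b" unfolding b_def
    by (rule smooth_on_compose[OF fin_dim_real _ _ smooth_flat_exp]) (auto intro: smooth_on_diff smd)
  have pos: "a x + b x > 0" for x
  proof (cases "d x < r\<^sup>2")
    case True
    then show ?thesis using flat_exp_pos[of "r\<^sup>2 - d x" 0] flat_exp_nonneg[of 0 "d x - (r/2)\<^sup>2"] by (simp add: a_def b_def)
  next
    case False
    moreover have "(r/2)\<^sup>2 < r\<^sup>2" using assms by (simp add: power_divide)
    ultimately show ?thesis
      using flat_exp_pos[of "d x - (r/2)\<^sup>2" 0] flat_exp_nonneg[of 0 "r\<^sup>2 - d x"] by (simp add: a_def b_def)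
  qed
  show "smooth_on UNIV (\<lambda>x. a x / (a x + b x))"
    using pos by (intro smooth_on_divide smooth_on_add sma smb open_UNIV) (metis less_irrefl)
  show "a x / (a x + b x) = 1" if "x \<in> ball x0 (r/2)" for x
  proof -
    have "d x \<le> (r/2)\<^sup>2" using that unfolding d by (intro power_mono) auto
    then have "b x = 0" by (simp add: b_def flat_exp_zero)
    then show ?thesis using pos[of x] by simp
  qed
  show "a x / (a x + b x) = 0" if "x \<notin> ball x0 r" for x
  proof -
    have "r\<^sup>2 \<le> d x" using that assms unfolding d by (intro power_mono) auto
    then show ?thesis by (simp add: a_def flat_exp_zero)
  qed
qed

text \<open>The mean value theorem is applied along \<open>v\<close> to a difference in the
  direction \<open>w\<close>, and then along \<open>w\<close>. The left-hand side is symmetric in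
  \<open>v\<close> and \<open>w\<close>, and this is the source of the symmetry of second
  derivatives.\<close>

lemma second_difference_mvt:
  fixes f :: "'a::real_normed_vector \<Rightarrow> real"
  assumes f: "smooth_on S f" and h: "h > 0"
    and seg: "\<And>s t. 0 \<le> s \<Longrightarrow> s \<le> h \<Longrightarrow> 0 \<le> t \<Longrightarrow> t \<le> h \<Longrightarrow> x + s *\<^sub>R v + t *\<^sub>R w \<in> S"
  shows "\<exists>s t. 0 < s \<and> s < h \<and> 0 < t \<and> t < h \<and>
    f (x + h *\<^sub>R v + h *\<^sub>R w) - f (x + h *\<^sub>R v) - f (x + h *\<^sub>R w) + f x =
      h * h * frechet_derivative (\<lambda>y. frechet_derivative f (at y) v) (at (x + s *\<^sub>R v + t *\<^sub>R w)) w"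
proof -
  let ?D = "\<lambda>y. frechet_derivative f (at y) v"
  have D: "smooth_on S ?D" by (rule smooth_on_derivative[OF f])
  have lin: "frechet_derivative g (at y) (c *\<^sub>R u) = c * frechet_derivative g (at y) u"
    if "smooth_on S g" "y \<in> S" for g :: "'a \<Rightarrow> real" and y c u
    using linear_scale[OF bounded_linear.linear[OF smooth_on_linear_derivative[OF that]], of c u] by simp
  have d1: "((\<lambda>s. f (x + s *\<^sub>R v + t *\<^sub>R w)) has_real_derivative ?D (x + s *\<^sub>R v + t *\<^sub>R w)) (at s)"
    if "0 \<le> s" "s \<le> h" "0 \<le> t" "t \<le> h" for s t
  proof -
    have "((\<lambda>s. x + s *\<^sub>R v + t *\<^sub>R w) has_derivative (\<lambda>c. c *\<^sub>R v)) (at s)"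
      by (auto intro!: derivative_eq_intros)
    note diff_chain_at[OF this smooth_on_has_derivative[OF f seg[OF that]]]
    moreover have "frechet_derivative f (at (x + s *\<^sub>R v + t *\<^sub>R w)) (c *\<^sub>R v) = ?D (x + s *\<^sub>R v + t *\<^sub>R w) * c" for c
      unfolding lin[OF f seg[OF that]] by (rule mult.commute)
    ultimately show ?thesis by (simp add: has_field_derivative_def o_def)
  qed
  define p where "p s = f (x + s *\<^sub>R v + h *\<^sub>R w) - f (x + s *\<^sub>R v + 0 *\<^sub>R w)" for s
  have "(p has_real_derivative ?D (x + s *\<^sub>R v + h *\<^sub>R w) - ?D (x + s *\<^sub>R v + 0 *\<^sub>R w)) (at s)"
    if "0 \<le> s" "s \<le> h" for s
    unfolding p_def using that h by (intro DERIV_diff d1) auto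
  from MVT2[OF h this] obtain s where s: "0 < s" "s < h"
    "p h - p 0 = h * (?D (x + s *\<^sub>R v + h *\<^sub>R w) - ?D (x + s *\<^sub>R v + 0 *\<^sub>R w))" by auto
  have "((\<lambda>t. ?D (x + s *\<^sub>R v + t *\<^sub>R w)) has_real_derivative
      frechet_derivative ?D (at (x + s *\<^sub>R v + t *\<^sub>R w)) w) (at t)" if "0 \<le> t" "t \<le> h" for t
  proof -
    have 1: "((\<lambda>t. x + s *\<^sub>R v + t *\<^sub>R w) has_derivative (\<lambda>c. c *\<^sub>R w)) (at t)"
      by (auto intro!: derivative_eq_intros)
    have 2: "x + s *\<^sub>R v + t *\<^sub>R w \<in> S" using seg that s by simp
    note diff_chain_at[OF 1 smooth_on_has_derivative[OF D 2]]
    moreover have "frechet_derivative ?D (at (x + s *\<^sub>R v + t *\<^sub>R w)) (c *\<^sub>R w) =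
        frechet_derivative ?D (at (x + s *\<^sub>R v + t *\<^sub>R w)) w * c" for c
      unfolding lin[OF D 2] by (rule mult.commute)
    ultimately show ?thesis by (simp add: has_field_derivative_def o_def)
  qed
  from MVT2[OF h this] obtain t where t: "0 < t" "t < h"
    "?D (x + s *\<^sub>R v + h *\<^sub>R w) - ?D (x + s *\<^sub>R v + 0 *\<^sub>R w) =
       h * frechet_derivative ?D (at (x + s *\<^sub>R v + t *\<^sub>R w)) w" by auto
  have "f (x + h *\<^sub>R v + h *\<^sub>R w) - f (x + h *\<^sub>R v) - f (x + h *\<^sub>R w) + f x = p h - p 0"
    by (simp add: p_def)
  also have "\<dots> = h * h * frechet_derivative ?D (at (x + s *\<^sub>R v + t *\<^sub>R w)) w" using s(3) t(3) by simp
  finally show ?thesis using s t by blast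
qed

text \<open>Both mixed derivatives, each at some point near \<open>x\<close>, equal the same second
  difference divided by \<open>h * h\<close>; continuity carries this over to
  \<open>x\<close>.\<close>

lemma second_derivative_symmetric_real:
  fixes f :: "'a::real_normed_vector \<Rightarrow> real"
  assumes f: "smooth_on S f" and S: "open S" "x \<in> S"
  shows "frechet_derivative (\<lambda>y. frechet_derivative f (at y) v) (at x) w =
         frechet_derivative (\<lambda>y. frechet_derivative f (at y) w) (at x) v"
proof -
  let ?P = "\<lambda>y. frechet_derivative (\<lambda>y. frechet_derivative f (at y) v) (at y) w"
  let ?Q = "\<lambda>y. frechet_derivative (\<lambda>y. frechet_derivative f (at y) w) (at y) v"
  have "continuous_on S ?P" "continuous_on S ?Q"
    by (intro smooth_on_continuous smooth_on_derivative f)+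
  then have "continuous (at x) ?P" "continuous (at x) ?Q"
    using S continuous_on_eq_continuous_at by blast+
  then have "\<bar>?P x - ?Q x\<bar> \<le> e" if "e > 0" for e
  proof -
    from \<open>continuous (at x) ?P\<close> obtain d1 where d1: "d1 > 0" "\<And>y. dist y x < d1 \<Longrightarrow> dist (?P y) (?P x) < e/2"
      unfolding continuous_at_eps_delta using \<open>e > 0\<close> by (meson half_gt_zero)
    from \<open>continuous (at x) ?Q\<close> obtain d2 where d2: "d2 > 0" "\<And>y. dist y x < d2 \<Longrightarrow> dist (?Q y) (?Q x) < e/2"
      unfolding continuous_at_eps_delta using \<open>e > 0\<close> by (meson half_gt_zero)
    obtain d3 where d3: "d3 > 0" "ball x d3 \<subseteq> S" using S open_contains_ball by blast
    define d where "d = min d1 (min d2 d3)"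
    \<comment> \<open>The parallelogram with sides \<open>h *\<^sub>R v\<close> and
      \<open>h *\<^sub>R w\<close> then stays within distance \<open>d\<close> of \<open>x\<close>.
      The summand 1 keeps the denominator positive when both vectors are zero.\<close>
    define h where "h = d / (2 * (norm v + norm w + 1))"
    have "d > 0" using d1 d2 d3 by (simp add: d_def)
    then have h: "h > 0" by (simp add: h_def add_nonneg_pos)
    have close: "dist (x + s *\<^sub>R a + t *\<^sub>R b) x < d"
      if "0 \<le> s" "s \<le> h" "0 \<le> t" "t \<le> h" "(a = v \<and> b = w) \<or> (a = w \<and> b = v)" for s t a b
    proof -
      have "dist (x + s *\<^sub>R a + t *\<^sub>R b) x = norm (s *\<^sub>R a + t *\<^sub>R b)" by (simp add: dist_norm)
      also have "\<dots> \<le> s * norm a + t * norm b"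
        using norm_triangle_ineq[of "s *\<^sub>R a" "t *\<^sub>R b"] that by simp
      also have "\<dots> \<le> h * norm a + h * norm b"
        using that by (intro add_mono mult_right_mono) auto
      also have "\<dots> = h * (norm v + norm w)" using that(5) by (auto simp: algebra_simps)
      also have "\<dots> < h * (2 * (norm v + norm w + 1))"
        using h by (intro mult_strict_left_mono) (auto simp: add_nonneg_pos add.commute intro: add_strict_increasing)
      also have "\<dots> = d" by (simp add: h_def add_nonneg_eq_0_iff add_nonneg_pos field_simps)
      finally show ?thesis .
    qed
    have seg: "x + s *\<^sub>R a + t *\<^sub>R b \<in> S"
      if "0 \<le> s" "s \<le> h" "0 \<le> t" "t \<le> h" "(a = v \<and> b = w) \<or> (a = w \<and> b = v)" for s t a b
      using close[OF that] d3 by (auto simp: d_def dist_commute subset_iff)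
    obtain s t where st: "0 < s" "s < h" "0 < t" "t < h"
      "f (x + h *\<^sub>R v + h *\<^sub>R w) - f (x + h *\<^sub>R v) - f (x + h *\<^sub>R w) + f x = h * h * ?P (x + s *\<^sub>R v + t *\<^sub>R w)"
      using second_difference_mvt[OF f h seg, of v w] by auto
    obtain s' t' where st': "0 < s'" "s' < h" "0 < t'" "t' < h"
      "f (x + h *\<^sub>R w + h *\<^sub>R v) - f (x + h *\<^sub>R w) - f (x + h *\<^sub>R v) + f x = h * h * ?Q (x + s' *\<^sub>R w + t' *\<^sub>R v)"
      using second_difference_mvt[OF f h seg, of w v] by auto
    have "h * h * ?P (x + s *\<^sub>R v + t *\<^sub>R w) = h * h * ?Q (x + s' *\<^sub>R w + t' *\<^sub>R v)"
      using st(5) st'(5) by (simp add: algebra_simps)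
    then have "?P (x + s *\<^sub>R v + t *\<^sub>R w) = ?Q (x + s' *\<^sub>R w + t' *\<^sub>R v)" using h by simp
    moreover have "dist (?P (x + s *\<^sub>R v + t *\<^sub>R w)) (?P x) < e/2"
      using close[of s t v w] st d1 by (simp add: d_def)
    moreover have "dist (?Q (x + s' *\<^sub>R w + t' *\<^sub>R v)) (?Q x) < e/2"
      using close[of s' t' w v] st' d2 by (simp add: d_def)
    ultimately show ?thesis unfolding dist_real_def by arith
  qed
  then have "\<bar>?P x - ?Q x\<bar> \<le> 0" using dense_ge[of 0 "\<bar>?P x - ?Q x\<bar>"] by blast
  then show ?thesis by simp
qed

lemma frechet_derivative_bounded_linear:
  assumes "bounded_linear L" "f differentiable (at x)"
  shows "frechet_derivative (\<lambda>x. L (f x)) (at x) = (\<lambda>v. L (frechet_derivative f (at x) v))"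
  by (rule frechet_derivative_eqI[OF bounded_linear.has_derivative[OF assms(1)]])
     (rule assms(2)[unfolded frechet_derivative_works])

lemma second_derivative_symmetric:
  fixes f :: "'a::real_normed_vector \<Rightarrow> 'b::real_normed_vector"
  assumes fd: "fin_dim TYPE('b)" and f: "smooth_on S f" and S: "open S" "x \<in> S"
  shows "frechet_derivative (\<lambda>y. frechet_derivative f (at y) v) (at x) w =
         frechet_derivative (\<lambda>y. frechet_derivative f (at y) w) (at x) v" (is "?L = ?R")
proof -
  obtain B and \<beta> :: "'b \<Rightarrow> 'b \<Rightarrow> real" where B: "finite B" "\<And>b. bounded_linear (\<beta> b)"
    "\<And>x. x = (\<Sum>b\<in>B. \<beta> b x *\<^sub>R b)"
    using fin_dim_coordinates[OF fd] by metis
  have eq: "\<beta> b (frechet_derivative (\<lambda>y. frechet_derivative f (at y) v) (at x) w) =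
    frechet_derivative (\<lambda>y. frechet_derivative (\<lambda>x. \<beta> b (f x)) (at y) v) (at x) w" for b v w
  proof -
    have "frechet_derivative (\<lambda>y. frechet_derivative (\<lambda>x. \<beta> b (f x)) (at y) v) (at x) =
          frechet_derivative (\<lambda>y. \<beta> b (frechet_derivative f (at y) v)) (at x)"
      by (rule frechet_derivative_cong_open[OF S])
         (simp add: frechet_derivative_bounded_linear[OF B(2) smooth_on_differentiable[OF f]])
    also have "\<dots> = (\<lambda>w. \<beta> b (frechet_derivative (\<lambda>y. frechet_derivative f (at y) v) (at x) w))"
      by (rule frechet_derivative_bounded_linear[OF B(2) smooth_on_differentiable[OF smooth_on_derivative[OF f] S(2)]])
    finally show ?thesis by simp
  qed
  have \<beta>: "\<beta> b ?L = \<beta> b ?R" for b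
    unfolding eq by (rule second_derivative_symmetric_real[OF smooth_on_bounded_linear[OF B(2) S(1) f] S])
  have "?L = (\<Sum>b\<in>B. \<beta> b ?L *\<^sub>R b)" by (rule B(3))
  also have "\<dots> = (\<Sum>b\<in>B. \<beta> b ?R *\<^sub>R b)" by (simp only: \<beta>)
  also have "\<dots> = ?R" by (rule B(3)[symmetric])
  finally show ?thesis .
qed

section \<open>Smooth frames\<close>

text \<open>In coordinates the result is a finite sum of products. Smoothness of \<open>G\<close> at
  each fixed vector is exactly what \<open>vector_bundle\<close> demands of transition maps.\<close>

lemma smooth_on_apply_linear_family:
  fixes G :: "'a::real_normed_vector \<Rightarrow> 'b::real_normed_vector \<Rightarrow> 'c::real_normed_vector"
  assumes fd: "fin_dim TYPE('b)" and S: "open S" and lin: "\<And>x. x \<in> S \<Longrightarrow> linear (G x)"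
    and G: "\<And>y. smooth_on S (\<lambda>x. G x y)" and s: "smooth_on S s"
  shows "smooth_on S (\<lambda>x. G x (s x))"
proof -
  obtain B and \<beta> :: "'b \<Rightarrow> 'b \<Rightarrow> real" where B: "finite B" "\<And>b. bounded_linear (\<beta> b)"
    "\<And>x. x = (\<Sum>b\<in>B. \<beta> b x *\<^sub>R b)"
    using fin_dim_coordinates[OF fd] by metis
  have "smooth_on S (\<lambda>x. \<Sum>b\<in>B. \<beta> b (s x) *\<^sub>R G x b)"
    by (intro smooth_on_sum S smooth_on_scaleR smooth_on_bounded_linear[OF B(2)] G s)
  then show ?thesis
    by (rule smooth_on_cong[OF S, rotated]) (rule linear_eq_coordinates[OF lin B(1,3), symmetric])
qed

text \<open>Functionals, smooth in the point, that read off the coefficients with respect to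
  \<open>w\<close>. They take the place of an inverse matrix of the frame.\<close>

definition dual_family :: "'i set \<Rightarrow> ('i \<Rightarrow> 'a::real_normed_vector \<Rightarrow> 'b::real_normed_vector) \<Rightarrow> 'a set
     \<Rightarrow> ('i \<Rightarrow> 'a \<Rightarrow> 'b \<Rightarrow> real) \<Rightarrow> bool" where
  "dual_family I w U \<mu> \<longleftrightarrow> (\<forall>i\<in>I. \<forall>x\<in>U. linear (\<mu> i x)) \<and>
    (\<forall>i\<in>I. \<forall>j\<in>I. \<forall>x\<in>U. \<mu> i x (w j x) = (if i = j then 1 else 0)) \<and>
    (\<forall>i\<in>I. \<forall>y. smooth_on U (\<lambda>x. \<mu> i x y))"

text \<open>Induction on the frame, in the manner of Gram-Schmidt: the new vector, stripped of its
  components along the old ones, is non-zero at \<open>x0\<close> by independence, hence has a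
  coordinate that is non-zero on a neighbourhood.\<close>

lemma dual_frame:
  fixes w :: "'i \<Rightarrow> 'a::real_normed_vector \<Rightarrow> 'b::real_normed_vector"
  assumes fd: "fin_dim TYPE('b)" and S: "open S" "x0 \<in> S" and "finite I"
    and "\<And>i. i \<in> I \<Longrightarrow> smooth_on S (w i)" and "indep_family I (\<lambda>i. w i x0)"
  shows "\<exists>U \<mu>. open U \<and> x0 \<in> U \<and> U \<subseteq> S \<and> dual_family I w U \<mu>"
  using assms(4-6)
proof (induction I)
  case empty
  then show ?case using S by (auto simp: dual_family_def)
next
  case (insert a I)
  obtain B and \<beta> :: "'b \<Rightarrow> 'b \<Rightarrow> real" where B: "finite B" "\<And>b. bounded_linear (\<beta> b)"
    "\<And>x. x = (\<Sum>b\<in>B. \<beta> b x *\<^sub>R b)"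
    using fin_dim_coordinates[OF fd] by metis
  have "indep_family I (\<lambda>i. w i x0)" using insert.prems(2) by (rule indep_family_mono) auto
  then obtain U \<mu> where U: "open U" "x0 \<in> U" "U \<subseteq> S" and \<mu>: "dual_family I w U \<mu>"
    using insert.IH insert.prems(1) by blast
  then have lin: "\<And>i x. i \<in> I \<Longrightarrow> x \<in> U \<Longrightarrow> linear (\<mu> i x)"
    and dual: "\<And>i j x. i \<in> I \<Longrightarrow> j \<in> I \<Longrightarrow> x \<in> U \<Longrightarrow> \<mu> i x (w j x) = (if i = j then 1 else 0::real)"
    and sm: "\<And>i y. i \<in> I \<Longrightarrow> smooth_on U (\<lambda>x. \<mu> i x y)"
    by (simp_all add: dual_family_def)
  have wU: "smooth_on U (w i)" if "i \<in> insert a I" for i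
    using insert.prems(1)[OF that] U(3) by (rule smooth_on_subset)
  \<comment> \<open>The projection that kills the vectors already treated.\<close>
  define P where "P x y = y - (\<Sum>i\<in>I. \<mu> i x y *\<^sub>R w i x)" for x y
  have linP: "linear (P x)" if "x \<in> U" for x
    using lin[OF _ that]
    by (intro linearI)
       (simp_all add: P_def linear_add linear_scale scaleR_add_left sum.distrib scaleR_right_diff_distrib scaleR_sum_right)
  have Pw: "P x (w j x) = 0" if "x \<in> U" "j \<in> I" for x j
  proof -
    have "(\<Sum>i\<in>I. \<mu> i x (w j x) *\<^sub>R w i x) = (\<Sum>i\<in>I. if j = i then w j x else 0)"
      using dual[OF _ that(2,1)] by (intro sum.cong) auto
    then show ?thesis using insert.hyps(1) that by (simp add: P_def)
  qed
  have smP: "smooth_on U (\<lambda>x. P x (s x))" if "smooth_on U s" for s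
    unfolding P_def
    by (intro smooth_on_diff U(1) smooth_on_sum smooth_on_scaleR that wU
          smooth_on_apply_linear_family[OF fd U(1) lin sm]) auto
  have "P x0 (w a x0) \<noteq> 0"
  proof
    assume "P x0 (w a x0) = 0"
    moreover have "(\<Sum>i\<in>I. (if i = a then 1 else - \<mu> i x0 (w a x0)) *\<^sub>R w i x0) = - (\<Sum>i\<in>I. \<mu> i x0 (w a x0) *\<^sub>R w i x0)"
      unfolding sum_negf[symmetric] using insert.hyps by (intro sum.cong) auto
    ultimately have "(\<Sum>i\<in>insert a I. (if i = a then 1 else - \<mu> i x0 (w a x0)) *\<^sub>R w i x0) = 0"
      using insert.hyps by (simp add: P_def)
    from indep_familyD[OF insert.prems(2) _ this, of a] insert.hyps show False by simp
  qed
  then obtain b where b: "\<beta> b (P x0 (w a x0)) \<noteq> 0"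
    using arg_cong[OF B(3)[of "P x0 (w a x0)"], of "\<lambda>y. y \<noteq> 0"] by (metis (no_types, lifting) scaleR_zero_left sum.neutral)
  define \<nu> where "\<nu> x = \<beta> b (P x (w a x))" for x
  have sm\<nu>: "smooth_on U \<nu>"
    unfolding \<nu>_def by (intro smooth_on_bounded_linear[OF B(2) U(1)] smP wU) simp
  define V where "V = U \<inter> \<nu> -` (- {0})"
  have "open V" unfolding V_def
    using continuous_open_preimage[OF smooth_on_continuous[OF sm\<nu>] U(1), of "- {0}"] by auto
  then have V: "open V" "x0 \<in> V" "V \<subseteq> U" using U b by (auto simp: V_def \<nu>_def)
  \<comment> \<open>The functional of the new vector: it vanishes on the old ones because
    \<open>P\<close> does, and division by \<open>\<nu> x\<close> normalises it.\<close>
  define \<mu>a where "\<mu>a x y = \<beta> b (P x y) / \<nu> x" for x y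
  have lina: "linear (\<mu>a x)" if "x \<in> V" for x
    using linP[of x] that V(3) bounded_linear.linear[OF B(2), of b]
    by (intro linearI) (auto simp: \<mu>a_def linear_add linear_scale add_divide_distrib subset_iff)
  have sma: "smooth_on V (\<lambda>x. \<mu>a x (s x))" if "smooth_on U s" for s
    unfolding \<mu>a_def
    by (intro smooth_on_divide V(1) smooth_on_bounded_linear[OF B(2) V(1)])
       (use smooth_on_subset[OF smP[OF that] V(3)] smooth_on_subset[OF sm\<nu> V(3)] in \<open>auto simp: V_def\<close>)
  \<comment> \<open>The old functionals are corrected so as to vanish on the new vector.\<close>
  define \<mu>' where "\<mu>' i x y = (if i = a then \<mu>a x y else \<mu> i x y - \<mu> i x (w a x) * \<mu>a x y)" for i x y
  have a: "a \<notin> I" by (rule insert.hyps(2))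
  have aa: "\<mu>a x (w a x) = 1" if "x \<in> V" for x using that by (simp add: \<mu>a_def V_def flip: \<nu>_def)
  have ai: "\<mu>a x (w i x) = 0" if "x \<in> V" "i \<in> I" for x i
    using that V(3) Pw[of x i] linear_0[OF bounded_linear.linear[OF B(2), of b]] by (auto simp: \<mu>a_def)
  have "dual_family (insert a I) w V \<mu>'"
    unfolding dual_family_def
  proof (intro conjI ballI allI)
    show "linear (\<mu>' i x)" if "i \<in> insert a I" "x \<in> V" for i x
    proof (cases "i = a")
      case True
      then show ?thesis using lina[OF that(2)] by (simp add: \<mu>'_def[abs_def])
    next
      case False
      then have "linear (\<mu> i x)" using lin[of i x] that V(3) by auto
      with lina[OF that(2)] show ?thesis using False
        by (intro linearI) (simp_all add: \<mu>'_def linear_add linear_scale algebra_simps)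
    qed
    show "\<mu>' i x (w j x) = (if i = j then 1 else 0)" if "i \<in> insert a I" "j \<in> insert a I" "x \<in> V" for i j x
      using that a aa[of x] ai[of x j] dual[of i j x] V(3) by (auto simp: \<mu>'_def)
    show "smooth_on V (\<lambda>x. \<mu>' i x y)" if "i \<in> insert a I" for i y
    proof (cases "i = a")
      case True
      then show ?thesis using sma[of "\<lambda>_. y"] by (simp add: \<mu>'_def)
    next
      case False
      with that have i: "i \<in> I" by simp
      have "smooth_on V (\<lambda>x. \<mu> i x (w a x))"
        by (rule smooth_on_subset[OF smooth_on_apply_linear_family[OF fd U(1) lin[OF i] sm[OF i] wU] V(3)]) auto
      then have "smooth_on V (\<lambda>x. \<mu> i x y - \<mu> i x (w a x) * \<mu>a x y)"
        by (intro smooth_on_diff smooth_on_mult V(1) sma smooth_on_const smooth_on_subset[OF sm[OF i] V(3)])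
      then show ?thesis using False by (simp add: \<mu>'_def)
    qed
  qed
  then show ?case using V U by blast
qed

text \<open>The quantification over open subsets \<open>V\<close> lets the property survive the
  repeated shrinking of neighbourhoods. Smooth coefficients are demanded only of smooth maps that
  lie in the span pointwise.\<close>

definition smooth_coeffs :: "'a::real_normed_vector set \<Rightarrow> 'i set \<Rightarrow> ('i \<Rightarrow> 'a \<Rightarrow> 'b::real_normed_vector) \<Rightarrow> bool" where
  "smooth_coeffs U I w \<longleftrightarrow> (\<forall>V s. open V \<longrightarrow> V \<subseteq> U \<longrightarrow> smooth_on V s \<longrightarrow>
     (\<forall>x\<in>V. s x \<in> span ((\<lambda>i. w i x) ` I)) \<longrightarrow>
     (\<exists>c. (\<forall>i\<in>I. smooth_on V (c i)) \<and> (\<forall>x\<in>V. s x = (\<Sum>i\<in>I. c i x *\<^sub>R w i x))))"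

lemma smooth_coeffsE:
  assumes "smooth_coeffs U I w" "open V" "V \<subseteq> U" "smooth_on V s"
    "\<And>x. x \<in> V \<Longrightarrow> s x \<in> span ((\<lambda>i. w i x) ` I)"
  obtains c where "\<And>i. i \<in> I \<Longrightarrow> smooth_on V (c i)" "\<And>x. x \<in> V \<Longrightarrow> s x = (\<Sum>i\<in>I. c i x *\<^sub>R w i x)"
proof -
  have "\<exists>c. (\<forall>i\<in>I. smooth_on V (c i)) \<and> (\<forall>x\<in>V. s x = (\<Sum>i\<in>I. c i x *\<^sub>R w i x))"
    using assms(1)[unfolded smooth_coeffs_def, THEN spec, THEN spec, THEN mp, THEN mp, THEN mp, THEN mp,
        OF assms(2-4)] assms(5) by simp
  then show ?thesis by (elim exE conjE) (rule that; simp)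
qed

text \<open>The dual functionals recover the coefficients of every combination. Applied to zero they
  give independence near \<open>x0\<close>, applied to a smooth map in the span they give smooth
  coefficients.\<close>

lemma smooth_frame:
  fixes w :: "'i \<Rightarrow> 'a::real_normed_vector \<Rightarrow> 'b::real_normed_vector"
  assumes fd: "fin_dim TYPE('b)" and S: "open S" "x0 \<in> S" and I: "finite I"
    and sm: "\<And>i. i \<in> I \<Longrightarrow> smooth_on S (w i)" and ind: "indep_family I (\<lambda>i. w i x0)"
  obtains U where "open U" "x0 \<in> U" "U \<subseteq> S" "\<And>x. x \<in> U \<Longrightarrow> indep_family I (\<lambda>i. w i x)"
    "smooth_coeffs U I w"
proof -
  obtain U \<mu> where U: "open U" "x0 \<in> U" "U \<subseteq> S" and \<mu>: "dual_family I w U \<mu>"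
    using dual_frame[OF fd S I sm ind] by blast
  then have lin: "\<And>i x. i \<in> I \<Longrightarrow> x \<in> U \<Longrightarrow> linear (\<mu> i x)"
    and dual: "\<And>i j x. i \<in> I \<Longrightarrow> j \<in> I \<Longrightarrow> x \<in> U \<Longrightarrow> \<mu> i x (w j x) = (if i = j then 1 else 0::real)"
    and sm\<mu>: "\<And>i y. i \<in> I \<Longrightarrow> smooth_on U (\<lambda>x. \<mu> i x y)"
    by (simp_all add: dual_family_def)
  have coeff: "\<mu> i x (\<Sum>j\<in>I. u j *\<^sub>R w j x) = u i" if "i \<in> I" "x \<in> U" for i x u
  proof -
    have "\<mu> i x (\<Sum>j\<in>I. u j *\<^sub>R w j x) = (\<Sum>j\<in>I. u j * \<mu> i x (w j x))"
      using lin[OF that] by (simp add: linear_sum linear_scale)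
    also have "\<dots> = (\<Sum>j\<in>I. if i = j then u j else 0)"
      using dual[OF that(1) _ that(2)] by (intro sum.cong) auto
    finally show ?thesis using I that by simp
  qed
  show ?thesis
  proof (rule that[OF U])
    show "indep_family I (\<lambda>i. w i x)" if "x \<in> U" for x
    proof (rule indep_familyI[OF I])
      fix u i assume "(\<Sum>i\<in>I. u i *\<^sub>R w i x) = 0" "i \<in> I"
      then show "u i = 0" using coeff[OF \<open>i \<in> I\<close> that, of u] linear_0[OF lin[OF \<open>i \<in> I\<close> that]] by simp
    qed
  next
    show "smooth_coeffs U I w"
      unfolding smooth_coeffs_def
    proof (intro allI impI)
      fix V s assume V: "open V" "V \<subseteq> U" "smooth_on V s" and sp: "\<forall>x\<in>V. s x \<in> span ((\<lambda>i. w i x) ` I)"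
      define c where "c i x = \<mu> i x (s x)" for i x
      have "smooth_on V (c i)" if "i \<in> I" for i
        unfolding c_def
        by (rule smooth_on_apply_linear_family[OF fd V(1) _ _ V(3)])
           (use V(2) that lin smooth_on_subset[OF sm\<mu>] in auto)
      moreover have "s x = (\<Sum>i\<in>I. c i x *\<^sub>R w i x)" if x: "x \<in> V" for x
      proof -
        obtain u where u: "s x = (\<Sum>i\<in>I. u i *\<^sub>R w i x)"
          using bspec[OF sp x] span_image_family[OF I, of "\<lambda>i. w i x"] by auto
        have "c i x = u i" if "i \<in> I" for i
          unfolding c_def u using coeff[OF that] x V(2) by blast
        then show ?thesis unfolding u by simp
      qed
      ultimately show "\<exists>c. (\<forall>i\<in>I. smooth_on V (c i)) \<and> (\<forall>x\<in>V. s x = (\<Sum>i\<in>I. c i x *\<^sub>R w i x))" by blast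
    qed
  qed
qed

text \<open>Gaussian elimination, one functional at a time: near \<open>x0\<close> only those functionals are used
  that cut down the kernel at \<open>x0\<close> itself.\<close>

definition kernel_family ::
  "'i set \<Rightarrow> ('i \<Rightarrow> 'a::real_normed_vector \<Rightarrow> 'b::real_normed_vector) \<Rightarrow> 'a \<Rightarrow> ('b \<Rightarrow> real) set \<Rightarrow> 'a set
     \<Rightarrow> 'i set \<Rightarrow> ('i \<Rightarrow> 'a \<Rightarrow> 'b) \<Rightarrow> bool" where
  "kernel_family I w x0 \<Lambda> U J b \<longleftrightarrow> J \<subseteq> I \<and> (\<forall>j\<in>J. smooth_on U (b j)) \<and>
    indep_family J (\<lambda>j. b j x0) \<and> (\<forall>j\<in>J. \<forall>l\<in>\<Lambda>. l (b j x0) = 0) \<and>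
    (\<forall>j\<in>J. \<forall>x\<in>U. b j x \<in> span ((\<lambda>i. w i x) ` I)) \<and>
    (\<forall>x\<in>U. span ((\<lambda>i. w i x) ` I) \<inter> {y. \<forall>l\<in>\<Lambda>. l y = 0} \<subseteq> span ((\<lambda>j. b j x) ` J))"

text \<open>A functional that vanishes on the whole current family at \<open>x0\<close> is skipped,
  even if it does not vanish on it nearby; otherwise some member serves as pivot on a neighbourhood.
  Because of the skipped functionals the family spans the kernel at \<open>x0\<close>, but only
  bounds it from above at other points.\<close>

lemma kernel_family_exists:
  fixes w :: "'i \<Rightarrow> 'a::real_normed_vector \<Rightarrow> 'b::real_normed_vector"
  assumes fd: "fin_dim TYPE('b)" and S: "open S" "x0 \<in> S" and I: "finite I"
    and sm: "\<And>i. i \<in> I \<Longrightarrow> smooth_on S (w i)" and ind: "indep_family I (\<lambda>i. w i x0)"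
    and "finite \<Lambda>" "\<And>l. l \<in> \<Lambda> \<Longrightarrow> linear (l :: 'b \<Rightarrow> real)"
  shows "\<exists>U J b. open U \<and> x0 \<in> U \<and> U \<subseteq> S \<and> kernel_family I w x0 \<Lambda> U J b"
  using assms(7,8)
proof (induction \<Lambda>)
  case empty
  have "kernel_family I w x0 {} S I w" using sm ind by (auto simp: kernel_family_def intro: span_base)
  then show ?case using S by blast
next
  case (insert l \<Lambda>)
  then obtain U J b where U: "open U" "x0 \<in> U" "U \<subseteq> S" and kf: "kernel_family I w x0 \<Lambda> U J b"
    by auto
  then have J: "J \<subseteq> I"
    and smb: "\<And>j. j \<in> J \<Longrightarrow> smooth_on U (b j)" and indb: "indep_family J (\<lambda>j. b j x0)"
    and kb: "\<And>j l. j \<in> J \<Longrightarrow> l \<in> \<Lambda> \<Longrightarrow> l (b j x0) = 0"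
    and bw: "\<And>j x. j \<in> J \<Longrightarrow> x \<in> U \<Longrightarrow> b j x \<in> span ((\<lambda>i. w i x) ` I)"
    and kw: "\<And>x. x \<in> U \<Longrightarrow> span ((\<lambda>i. w i x) ` I) \<inter> {y. \<forall>l\<in>\<Lambda>. l y = 0} \<subseteq> span ((\<lambda>j. b j x) ` J)"
    by (simp_all add: kernel_family_def)
  have finJ: "finite J" using J I finite_subset by blast
  have linl: "linear l" using insert.prems by simp
  have bl: "bounded_linear l" by (rule fin_dim_linear_bounded[OF fd linl])
  show ?case
  proof (cases "\<forall>j\<in>J. l (b j x0) = 0")
    case True
    then have "kernel_family I w x0 (insert l \<Lambda>) U J b"
      unfolding kernel_family_def
    proof (intro conjI ballI)
      show "l' (b j x0) = 0" if "j \<in> J" "l' \<in> insert l \<Lambda>" for j l' using that kb True by auto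
      show "span ((\<lambda>i. w i x) ` I) \<inter> {y. \<forall>l\<in>insert l \<Lambda>. l y = 0} \<subseteq> span ((\<lambda>j. b j x) ` J)" if "x \<in> U" for x
        using kw[OF that] by auto
    qed (simp_all add: J smb indb bw)
    then show ?thesis using U by blast
  next
    case False
    then obtain a where a: "a \<in> J" "l (b a x0) \<noteq> 0" by blast
    have sml: "smooth_on U (\<lambda>x. l (b j x))" if "j \<in> J" for j
      by (rule smooth_on_bounded_linear[OF bl U(1) smb[OF that]])
    define V where "V = U \<inter> (\<lambda>x. l (b a x)) -` (- {0})"
    have V: "open V" "x0 \<in> V" "V \<subseteq> U"
      unfolding V_def using U a continuous_open_preimage[OF smooth_on_continuous[OF sml[OF a(1)]] U(1), of "- {0}"] by auto
    \<comment> \<open>The multiple of the pivot \<open>b a\<close> that makes \<open>l\<close>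
      vanish is subtracted; the pivot itself leaves the family.\<close>
    define b' where "b' j x = b j x - (l (b j x) / l (b a x)) *\<^sub>R b a x" for j x
    let ?J = "J - {a}"
    have sum_b': "(\<Sum>j\<in>?J. u j *\<^sub>R b' j x) = (\<Sum>j\<in>J. (if j = a then - (\<Sum>j\<in>?J. u j * l (b j x) / l (b a x)) else u j) *\<^sub>R b j x)"
      for u x
      using finJ a(1)
      by (simp add: sum.remove b'_def scaleR_right_diff_distrib sum_subtractf scaleR_sum_left)
    have smb': "smooth_on V (b' j)" if "j \<in> ?J" for j
      unfolding b'_def
      by (intro smooth_on_diff smooth_on_scaleR smooth_on_divide V(1) smooth_on_subset[OF smb V(3)]
           smooth_on_subset[OF sml V(3)]) (use that a in \<open>auto simp: V_def\<close>)
    have ind': "indep_family ?J (\<lambda>j. b' j x0)"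
    proof (rule indep_familyI)
      fix u i assume "(\<Sum>j\<in>?J. u j *\<^sub>R b' j x0) = 0" and i: "i \<in> ?J"
      from indep_familyD[OF indb finJ this(1)[unfolded sum_b'], of i] i show "u i = 0" by simp
    qed (use finJ in simp)
    have k': "l' (b' j x0) = 0" if "j \<in> ?J" "l' \<in> insert l \<Lambda>" for j l'
      using that kb[of j l'] kb[of a l'] a insert.prems[OF that(2)]
      by (auto simp: b'_def linear_diff linear_scale)
    have bw': "b' j x \<in> span ((\<lambda>i. w i x) ` I)" if "j \<in> ?J" "x \<in> V" for j x
      unfolding b'_def using that a V(3) by (intro span_diff span_scale bw) auto
    have kw': "span ((\<lambda>i. w i x) ` I) \<inter> {y. \<forall>l\<in>insert l \<Lambda>. l y = 0} \<subseteq> span ((\<lambda>j. b' j x) ` ?J)"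
      if x: "x \<in> V" for x
    proof
      fix y assume y: "y \<in> span ((\<lambda>i. w i x) ` I) \<inter> {y. \<forall>l\<in>insert l \<Lambda>. l y = 0}"
      then have "y \<in> span ((\<lambda>j. b j x) ` J)" using kw[of x] x V(3) by auto
      then obtain c where c: "y = (\<Sum>j\<in>J. c j *\<^sub>R b j x)"
        using span_image_family[OF finJ, of "\<lambda>j. b j x"] by auto
      have nz: "l (b a x) \<noteq> 0" using x by (simp add: V_def)
      have "0 = l y" using y by simp
      also have "\<dots> = c a * l (b a x) + (\<Sum>j\<in>?J. c j * l (b j x))"
        unfolding c using sum.remove[OF finJ a(1), of "\<lambda>j. c j * l (b j x)"]
        by (simp add: linear_sum[OF linl] linear_scale[OF linl])
      \<comment> \<open>A vector in the kernel of \<open>l\<close> has its pivot coefficient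
        determined by the others, so it is a combination of the reduced family.\<close>
      finally have "c a = - (\<Sum>j\<in>?J. c j * l (b j x) / l (b a x))"
        using nz by (simp add: field_simps flip: sum_divide_distrib)
      then have "y = (\<Sum>j\<in>?J. c j *\<^sub>R b' j x)"
        unfolding sum_b' c by (intro sum.cong) auto
      then show "y \<in> span ((\<lambda>j. b' j x) ` ?J)"
        by (simp only:) (intro span_sum span_scale span_base imageI)
    qed
    have "kernel_family I w x0 (insert l \<Lambda>) V ?J b'"
      unfolding kernel_family_def
    proof (intro conjI ballI)
      show "?J \<subseteq> I" using J by auto
    qed (simp_all only: smb' ind' k' bw' kw')
    then show ?thesis using V U by blast
  qed
qed

text \<open>At \<open>x0\<close> the family lies in the kernel, so its size is the rank
  \<open>k\<close>. Nearby the kernel is contained in the span of the family and has the same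
  dimension, so the two are equal.\<close>

lemma kernel_frame:
  fixes w :: "'i \<Rightarrow> 'a::real_normed_vector \<Rightarrow> 'b::real_normed_vector"
  assumes fd: "fin_dim TYPE('b)" and S: "open S" "x0 \<in> S" and I: "finite I"
    and sm: "\<And>i. i \<in> I \<Longrightarrow> smooth_on S (w i)" and ind: "indep_family I (\<lambda>i. w i x0)"
    and H: "subspace H" and rank: "\<And>x. x \<in> S \<Longrightarrow> dim (span ((\<lambda>i. w i x) ` I) \<inter> H) = k"
  obtains U J b where "open U" "x0 \<in> U" "U \<subseteq> S" "finite J" "\<And>j. j \<in> J \<Longrightarrow> smooth_on U (b j)"
    "\<And>x. x \<in> U \<Longrightarrow> indep_family J (\<lambda>j::'i. b j x)"
    "\<And>x. x \<in> U \<Longrightarrow> span ((\<lambda>j. b j x) ` J) = span ((\<lambda>i. w i x) ` I) \<inter> H"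
proof -
  obtain \<Lambda> :: "('b \<Rightarrow> real) set" where \<Lambda>: "finite \<Lambda>" "\<And>l. l \<in> \<Lambda> \<Longrightarrow> linear l"
    "H = {y. \<forall>l\<in>\<Lambda>. l y = 0}"
    using subspace_eq_common_kernel[OF fd H] by blast
  obtain U J b where U: "open U" "x0 \<in> U" "U \<subseteq> S" and kf: "kernel_family I w x0 \<Lambda> U J b"
    using kernel_family_exists[OF fd S I sm ind \<Lambda>(1,2)] by blast
  then have J: "J \<subseteq> I"
    and smb: "\<And>j. j \<in> J \<Longrightarrow> smooth_on U (b j)" and indb: "indep_family J (\<lambda>j. b j x0)"
    and kb: "\<And>j l. j \<in> J \<Longrightarrow> l \<in> \<Lambda> \<Longrightarrow> l (b j x0) = 0"
    and bw: "\<And>j x. j \<in> J \<Longrightarrow> x \<in> U \<Longrightarrow> b j x \<in> span ((\<lambda>i. w i x) ` I)"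
    and kw: "\<And>x. x \<in> U \<Longrightarrow> span ((\<lambda>i. w i x) ` I) \<inter> H \<subseteq> span ((\<lambda>j. b j x) ` J)"
    by (simp_all add: kernel_family_def \<Lambda>(3))
  have finJ: "finite J" using J I finite_subset by blast
  have subK: "subspace (span ((\<lambda>i. w i x) ` I) \<inter> H)" for x using H by (simp add: subspace_inter)
  have "span ((\<lambda>j. b j x0) ` J) \<subseteq> span ((\<lambda>i. w i x0) ` I) \<inter> H"
    using bw kb U(2) by (intro span_minimal subK) (auto simp: \<Lambda>(3))
  with kw[OF U(2)] have "span ((\<lambda>i. w i x0) ` I) \<inter> H = span ((\<lambda>j. b j x0) ` J)" by blast
  then have k: "k = card J" using rank[of x0] S indep_family_dim[OF indb] by metis
  obtain V where V: "open V" "x0 \<in> V" "V \<subseteq> U" "\<And>x. x \<in> V \<Longrightarrow> indep_family J (\<lambda>j. b j x)"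
    using smooth_frame[OF fd U(1,2) finJ smb indb] by metis
  show ?thesis
  proof (rule that[of V J b])
    show "span ((\<lambda>j. b j x) ` J) = span ((\<lambda>i. w i x) ` I) \<inter> H" if "x \<in> V" for x
      using kw[of x] rank[of x] indep_family_dim[OF V(4)[OF that]] k that V U
      by (intro subspace_eq_if_dim_eq[OF fd subK, symmetric]) auto
    show "smooth_on V (b j)" if "j \<in> J" for j by (rule smooth_on_subset[OF smb[OF that] V(3)])
  qed (use V U finJ in auto)
qed

text \<open>A basis chosen among the vectors at \<open>x0\<close> stays independent nearby, and the
  constant rank leaves no room for the whole family to span more.\<close>

lemma constant_rank_frame:
  fixes v :: "'i \<Rightarrow> 'a::real_normed_vector \<Rightarrow> 'b::real_normed_vector"
  assumes fd: "fin_dim TYPE('b)" and S: "open S" "x0 \<in> S" and I: "finite I"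
    and sm: "\<And>i. i \<in> I \<Longrightarrow> smooth_on S (v i)"
    and rank: "\<And>x. x \<in> S \<Longrightarrow> dim (span ((\<lambda>i. v i x) ` I)) = k"
  obtains U J where "open U" "x0 \<in> U" "U \<subseteq> S" "J \<subseteq> I" "card J = k"
    "\<And>x. x \<in> U \<Longrightarrow> indep_family J (\<lambda>j. v j x)"
    "\<And>x. x \<in> U \<Longrightarrow> span ((\<lambda>j. v j x) ` J) = span ((\<lambda>i. v i x) ` I)"
    "smooth_coeffs U J v"
proof -
  obtain B where B: "B \<subseteq> (\<lambda>i. v i x0) ` I" "independent B" "(\<lambda>i. v i x0) ` I \<subseteq> span B"
    using maximal_independent_subset by metis
  obtain J where J: "J \<subseteq> I" "inj_on (\<lambda>i. v i x0) J" "B = (\<lambda>i. v i x0) ` J"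
    using B(1) subset_image_inj by metis
  have ind: "indep_family J (\<lambda>j. v j x0)" using J B by (simp add: indep_family_def)
  have finJ: "finite J" using J I finite_subset by blast
  have "span B = span ((\<lambda>i. v i x0) ` I)"
    using B by (metis span_mono span_span subset_antisym)
  then have k: "card J = k" using rank[OF S(2)] indep_family_dim[OF ind] J(3) by simp
  obtain U where U: "open U" "x0 \<in> U" "U \<subseteq> S" "\<And>x. x \<in> U \<Longrightarrow> indep_family J (\<lambda>j. v j x)"
    and coeffs: "smooth_coeffs U J v"
    by (rule smooth_frame[OF fd S finJ, of v]) (use sm J(1) ind in auto)
  have eq: "span ((\<lambda>j. v j x) ` J) = span ((\<lambda>i. v i x) ` I)" if "x \<in> U" for x
    using rank[of x] indep_family_dim[OF U(4)[OF that]] k that U(3) J(1)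
    by (intro subspace_eq_if_dim_eq[OF fd] subspace_span span_mono image_mono) auto
  show ?thesis
    by (rule that[OF U(1-3) J(1) k U(4) eq coeffs])
qed

section \<open>Manifolds and vector bundles\<close>

text \<open>A subsequence is thinned out for one coordinate after the other until all of them
  converge. Compactness is needed for the supports of bump functions on the manifold.\<close>

lemma compact_cball_fin_dim:
  fixes x0 :: "'a::real_normed_vector"
  assumes "fin_dim TYPE('a)"
  shows "compact (cball x0 e)"
proof -
  obtain B and \<beta> :: "'a \<Rightarrow> 'a \<Rightarrow> real" where B: "finite B" "\<And>b. bounded_linear (\<beta> b)"
    "\<And>x. x = (\<Sum>b\<in>B. \<beta> b x *\<^sub>R b)"
    using fin_dim_coordinates[OF assms] by metis
  have "\<exists>l r. strict_mono (r :: nat \<Rightarrow> nat) \<and> (\<lambda>n. y (r n)) \<longlonglongrightarrow> l" if y: "\<And>n. y n \<in> cball x0 e" for y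
  proof -
    have bd: "bounded (range (\<lambda>n. \<beta> b (y n)))" for b
      using bounded_linear_image[OF bounded_subset[OF bounded_cball, of "range y" x0 e] B(2), of b] y
      by (simp add: image_image image_subset_iff)
    have "\<exists>r. strict_mono (r :: nat \<Rightarrow> nat) \<and> (\<forall>b\<in>B'. convergent (\<lambda>n. \<beta> b (y (r n))))" if "finite B'" for B'
      using that
    proof induction
      case empty
      show ?case by (auto intro: strict_mono_id)
    next
      case (insert b B')
      then obtain r :: "nat \<Rightarrow> nat" where r: "strict_mono r" "\<And>b. b \<in> B' \<Longrightarrow> convergent (\<lambda>n. \<beta> b (y (r n)))" by auto
      have "bounded (range (\<lambda>n. \<beta> b (y (r n))))" by (rule bounded_subset[OF bd]) auto
      then obtain l r' where r': "strict_mono (r' :: nat \<Rightarrow> nat)" "((\<lambda>n. \<beta> b (y (r n))) \<circ> r') \<longlonglongrightarrow> l"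
        using bounded_imp_convergent_subsequence by blast
      have "convergent (\<lambda>n. \<beta> b' (y (r (r' n))))" if "b' \<in> insert b B'" for b'
        using that convergent_subseq_convergent[OF r(2) r'(1), of b'] r'(2) by (auto simp: o_def convergent_def)
      then show ?case using strict_mono_o[OF r(1) r'(1)] by (auto simp: o_def intro!: exI[of _ "r \<circ> r'"])
    qed
    then obtain r :: "nat \<Rightarrow> nat" where r: "strict_mono r" "\<And>b. b \<in> B \<Longrightarrow> convergent (\<lambda>n. \<beta> b (y (r n)))"
      using B(1) by blast
    then have "(\<lambda>n. \<Sum>b\<in>B. \<beta> b (y (r n)) *\<^sub>R b) \<longlonglongrightarrow> (\<Sum>b\<in>B. lim (\<lambda>n. \<beta> b (y (r n))) *\<^sub>R b)"
      by (intro tendsto_intros) (simp add: convergent_LIMSEQ_iff)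
    moreover have "(\<Sum>b\<in>B. \<beta> b (y (r n)) *\<^sub>R b) = y (r n)" for n by (rule B(3)[symmetric])
    ultimately show ?thesis using r(1) by auto
  qed
  note sub = this
  show ?thesis
    unfolding compact_eq_seq_compact_metric seq_compact_def
  proof (intro allI impI)
    fix y assume y: "\<forall>n::nat. y n \<in> cball x0 e"
    then obtain l and r :: "nat \<Rightarrow> nat" where r: "strict_mono r" "(\<lambda>n. y (r n)) \<longlonglongrightarrow> l"
      using sub[of y] by blast
    moreover have "l \<in> cball x0 e"
      by (rule closed_sequentially[OF closed_cball _ r(2)]) (use y in blast)
    ultimately show "\<exists>l\<in>cball x0 e. \<exists>r. strict_mono r \<and> (y \<circ> r) \<longlonglongrightarrow> l"
      unfolding o_def by blast
  qed
qed

section \<open>Charts and smooth functions on a manifold\<close>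

locale atlas =
  fixes A :: "('m::{t2_space,second_countable_topology}, 'e::real_inner) chart set"
  assumes smooth_atlas: "smooth_atlas A"
begin

lemma fin_dim_model: "fin_dim TYPE('e)"
  using smooth_atlas by (simp add: smooth_atlas_def)

lemma chart_cover: obtains D \<psi> where "(D, \<psi>) \<in> A" "q \<in> D"
proof -
  have "q \<in> (\<Union>(D, \<psi>)\<in>A. D)" using smooth_atlas by (simp add: smooth_atlas_def)
  then show ?thesis using that by auto
qed

lemma chart:
  assumes "(D, \<psi>) \<in> A"
  shows chart_domain_open: "open D" and chart_image_open: "open (\<psi> ` D)"
    and chart_homeomorphism: "homeomorphism D (\<psi> ` D) \<psi> (inv_into D \<psi>)"
  using assms smooth_atlas by (auto simp: smooth_atlas_def)

lemma chart_inv: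
  assumes "(D, \<psi>) \<in> A"
  shows "q \<in> D \<Longrightarrow> inv_into D \<psi> (\<psi> q) = q"
    and "x \<in> \<psi> ` D \<Longrightarrow> \<psi> (inv_into D \<psi> x) = x"
    and "x \<in> \<psi> ` D \<Longrightarrow> inv_into D \<psi> x \<in> D"
  using chart_homeomorphism[OF assms] by (auto simp: homeomorphism_def f_inv_into_f)

lemma open_chart_image:
  assumes "(D, \<psi>) \<in> A" "open U"
  shows "open (\<psi> ` (U \<inter> D))"
proof -
  have "\<psi> ` (U \<inter> D) = \<psi> ` D \<inter> inv_into D \<psi> -` U"
    using chart_inv[OF assms(1)] by force
  moreover have "continuous_on (\<psi> ` D) (inv_into D \<psi>)"
    using chart_homeomorphism[OF assms(1)] by (simp add: homeomorphism_def)
  ultimately show ?thesis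
    using continuous_open_preimage[OF _ chart_image_open[OF assms(1)] assms(2)] by simp
qed

lemma open_chart_preimage:
  assumes "(D, \<psi>) \<in> A" "open W"
  shows "open (D \<inter> \<psi> -` W)"
  using continuous_open_preimage[OF _ chart_domain_open[OF assms(1)] assms(2), of \<psi>]
    chart_homeomorphism[OF assms(1)] by (simp add: homeomorphism_def)

lemma chart_image_preimage:
  "W \<subseteq> \<psi> ` D \<Longrightarrow> \<psi> ` (D \<inter> \<psi> -` W) = W"
  by blast

lemma transition_smooth:
  assumes "(D, \<psi>) \<in> A" "(D', \<psi>') \<in> A"
  shows "smooth_on (\<psi> ` (D \<inter> D')) (\<lambda>x. \<psi>' (inv_into D \<psi> x))"
  using assms smooth_atlas by (force simp: smooth_atlas_def o_def)

lemma smooth_fun_chartD: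
  "smooth_fun A U f \<Longrightarrow> (D, \<psi>) \<in> A \<Longrightarrow> smooth_on (\<psi> ` (U \<inter> D)) (\<lambda>x. f (inv_into D \<psi> x))"
  unfolding smooth_fun_def o_def by fastforce

text \<open>Transition maps carry smoothness from the one chart to all others.\<close>

lemma smooth_fun_chartI:
  assumes c: "(D, \<psi>) \<in> A" and U: "open U" "U \<subseteq> D"
    and f: "smooth_on (\<psi> ` U) (\<lambda>x. f (inv_into D \<psi> x))"
  shows "smooth_fun A U f"
  unfolding smooth_fun_def o_def
proof (safe)
  fix D' \<psi>' assume c': "(D', \<psi>') \<in> A"
  let ?S = "\<psi>' ` (U \<inter> D')"
  have S: "open ?S" by (rule open_chart_image[OF c' U(1)])
  have "smooth_on ?S (\<lambda>x. \<psi> (inv_into D' \<psi>' x))"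
    by (rule smooth_on_subset[OF transition_smooth[OF c' c]]) (use U in auto)
  then have "smooth_on ?S (\<lambda>x. f (inv_into D \<psi> (\<psi> (inv_into D' \<psi>' x))))"
    using open_chart_image[OF c U(1)] U(2)
    by (intro smooth_on_compose[OF fin_dim_model S _ f]) (auto simp: Int_absorb2 chart_inv[OF c'])
  then show "smooth_on ?S (\<lambda>x. f (inv_into D' \<psi>' x))"
    by (rule smooth_on_cong[OF S, rotated]) (use U chart_inv[OF c'] chart_inv[OF c] in auto)
qed

lemma smooth_fun_subset: "smooth_fun A U f \<Longrightarrow> V \<subseteq> U \<Longrightarrow> smooth_fun A V f"
  unfolding smooth_fun_def by (auto intro: smooth_on_subset)

lemma smooth_fun_cong:
  assumes "open U" "\<And>q. q \<in> U \<Longrightarrow> f q = g q" "smooth_fun A U f"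
  shows "smooth_fun A U g"
  unfolding smooth_fun_def
proof safe
  fix D \<psi> assume c: "(D, \<psi>) \<in> A"
  have "smooth_on (\<psi> ` (U \<inter> D)) (\<lambda>x. f (inv_into D \<psi> x))" by (rule smooth_fun_chartD[OF assms(3) c])
  then show "smooth_on (\<psi> ` (U \<inter> D)) (g \<circ> inv_into D \<psi>)"
    by (rule smooth_on_cong[OF open_chart_image[OF c assms(1)], rotated])
       (use assms(2) chart_inv[OF c] in auto)
qed

lemma smooth_fun_local:
  assumes "\<And>q. q \<in> U \<Longrightarrow> \<exists>W. open W \<and> q \<in> W \<and> smooth_fun A W f"
  shows "smooth_fun A U f"
  unfolding smooth_fun_def
proof safe
  fix D \<psi> assume c: "(D, \<psi>) \<in> A"
  show "smooth_on (\<psi> ` (U \<inter> D)) (f \<circ> inv_into D \<psi>)"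
  proof (rule smooth_on_local)
    fix x assume "x \<in> \<psi> ` (U \<inter> D)"
    then obtain q where q: "q \<in> U" "q \<in> D" "x = \<psi> q" by auto
    then obtain W where W: "open W" "q \<in> W" "smooth_fun A W f" using assms by blast
    show "\<exists>U. open U \<and> x \<in> U \<and> smooth_on U (f \<circ> inv_into D \<psi>)"
      using open_chart_image[OF c W(1)] smooth_fun_chartD[OF W(3) c] q W(2)
      by (intro exI[of _ "\<psi> ` (W \<inter> D)"]) (auto simp: o_def)
  qed
qed

lemma smooth_fun_const: "smooth_fun A U (\<lambda>_. c)"
  by (auto simp: smooth_fun_def o_def)

lemma smooth_fun_bilinear:
  assumes "bounded_bilinear B" "open U" "smooth_fun A U f" "smooth_fun A U g"
  shows "smooth_fun A U (\<lambda>q. B (f q) (g q))"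
  unfolding smooth_fun_def
proof safe
  fix D \<psi> assume c: "(D, \<psi>) \<in> A"
  show "smooth_on (\<psi> ` (U \<inter> D)) ((\<lambda>q. B (f q) (g q)) \<circ> inv_into D \<psi>)"
    unfolding o_def
    by (intro smooth_on_bilinear[OF assms(1) open_chart_image[OF c assms(2)]] smooth_fun_chartD[OF _ c] assms)
qed

lemmas smooth_fun_scaleR = smooth_fun_bilinear[OF bounded_bilinear_scaleR]
lemmas smooth_fun_mult = smooth_fun_bilinear[OF bounded_bilinear_mult]

lemma smooth_fun_sum:
  assumes "open U" "\<And>i. i \<in> I \<Longrightarrow> smooth_fun A U (f i)"
  shows "smooth_fun A U (\<lambda>q. \<Sum>i\<in>I. f i q)"
  unfolding smooth_fun_def
proof safe
  fix D \<psi> assume c: "(D, \<psi>) \<in> A"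
  show "smooth_on (\<psi> ` (U \<inter> D)) ((\<lambda>q. \<Sum>i\<in>I. f i q) \<circ> inv_into D \<psi>)"
    unfolding o_def
    by (intro smooth_on_sum open_chart_image[OF c assms(1)] smooth_fun_chartD[OF _ c] assms(2))
qed

lemma smooth_fun_add:
  assumes "open U" "smooth_fun A U f" "smooth_fun A U g"
  shows "smooth_fun A U (\<lambda>q. f q + g q)"
  unfolding smooth_fun_def
proof safe
  fix D \<psi> assume c: "(D, \<psi>) \<in> A"
  show "smooth_on (\<psi> ` (U \<inter> D)) ((\<lambda>q. f q + g q) \<circ> inv_into D \<psi>)"
    unfolding o_def
    by (intro smooth_on_add open_chart_image[OF c assms(1)] smooth_fun_chartD[OF _ c] assms)
qed

lemma smooth_fun_apply_linear_family:
  fixes G :: "'m \<Rightarrow> 'b::real_normed_vector \<Rightarrow> 'c::real_normed_vector"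
  assumes fd: "fin_dim TYPE('b)" and U: "open U" and lin: "\<And>q. q \<in> U \<Longrightarrow> linear (G q)"
    and G: "\<And>y. smooth_fun A U (\<lambda>q. G q y)" and s: "smooth_fun A U s"
  shows "smooth_fun A U (\<lambda>q. G q (s q))"
  unfolding smooth_fun_def
proof safe
  fix D \<psi> assume c: "(D, \<psi>) \<in> A"
  show "smooth_on (\<psi> ` (U \<inter> D)) ((\<lambda>q. G q (s q)) \<circ> inv_into D \<psi>)"
    unfolding o_def
    by (rule smooth_on_apply_linear_family[OF fd open_chart_image[OF c U] _ smooth_fun_chartD[OF G c] smooth_fun_chartD[OF s c]])
       (use lin chart_inv[OF c] in auto)
qed

text \<open>The set \<open>K\<close> is part of the conclusion because it is the tool for extending
  by zero: the chart domain and the complement of \<open>K\<close> are both open and together cover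
  the manifold.\<close>

lemma bump_function:
  assumes c: "(D, \<psi>) \<in> A" and W: "open W" "W \<subseteq> \<psi> ` D" "x0 \<in> W"
  obtains \<eta> W' K where "\<eta> \<in> Cinf A" "open W'" "x0 \<in> W'" "W' \<subseteq> W"
    "\<And>x. x \<in> W' \<Longrightarrow> \<eta> (inv_into D \<psi> x) = 1"
    "closed K" "K \<subseteq> D \<inter> \<psi> -` W" "\<And>q. q \<notin> K \<Longrightarrow> \<eta> q = 0"
proof -
  obtain r where r: "r > 0" "ball x0 r \<subseteq> W" using W open_contains_ball by blast
  have r2: "r / 2 > 0" using r by simp
  obtain h :: "'e \<Rightarrow> real" where h: "smooth_on UNIV h" "\<And>x. x \<in> ball x0 (r/2/2) \<Longrightarrow> h x = 1"
    "\<And>x. x \<notin> ball x0 (r/2) \<Longrightarrow> h x = 0"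
    using smooth_bump[OF r2, of x0] by blast
  \<comment> \<open>The support is taken of half the radius, so that its closure still lies in
    \<open>W\<close>.\<close>
  have sub: "cball x0 (r/2) \<subseteq> W"
    using r by (intro subset_trans[OF _ r(2)]) auto
  have compact: "compact (cball x0 (r/2))" by (rule compact_cball_fin_dim[OF fin_dim_model])
  define K where "K = inv_into D \<psi> ` cball x0 (r/2)"
  have "compact K" unfolding K_def
    using chart_homeomorphism[OF c] sub W(2)
    by (intro compact_continuous_image compact) (auto simp: homeomorphism_def intro: continuous_on_subset)
  \<comment> \<open>A closed set in a chart may fail to be closed in the manifold; a compact one is
    closed because the manifold is Hausdorff.\<close>
  then have K: "closed K" by (rule compact_imp_closed)
  have KD: "K \<subseteq> D \<inter> \<psi> -` W"
  proof
    fix q assume "q \<in> K"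
    then obtain x where x: "x \<in> cball x0 (r/2)" "q = inv_into D \<psi> x" by (auto simp: K_def)
    then have "x \<in> W" "x \<in> \<psi> ` D" using sub W(2) by blast+
    then show "q \<in> D \<inter> \<psi> -` W" using x(2) chart_inv[OF c] by simp
  qed
  define \<eta> where "\<eta> q = (if q \<in> D then h (\<psi> q) else 0)" for q
  have off: "\<eta> q = 0" if "q \<notin> K" for q
  proof (cases "q \<in> D")
    case True
    then have "\<psi> q \<notin> cball x0 (r/2)" using that chart_inv(1)[OF c True] unfolding K_def by force
    then have "\<psi> q \<notin> ball x0 (r/2)" by auto
    then show ?thesis using h(3) by (simp add: \<eta>_def)
  qed (simp add: \<eta>_def)
  have "smooth_fun A UNIV \<eta>"
  proof (rule smooth_fun_local)
    fix q
    show "\<exists>W. open W \<and> q \<in> W \<and> smooth_fun A W \<eta>"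
    proof (cases "q \<in> K")
      case True
      have "smooth_on (\<psi> ` D) (\<lambda>x. \<eta> (inv_into D \<psi> x))"
        by (rule smooth_on_cong[OF chart_image_open[OF c] _ smooth_on_subset[OF h(1)]])
           (auto simp: \<eta>_def chart_inv[OF c])
      then have "smooth_fun A D \<eta>" by (intro smooth_fun_chartI[OF c] chart_domain_open[OF c]) auto
      then show ?thesis using True KD chart_domain_open[OF c] by blast
    next
      case False
      have "smooth_fun A (- K) \<eta>"
        by (rule smooth_fun_cong[OF _ _ smooth_fun_const[of _ 0]]) (use K off in auto)
      then show ?thesis using False K by blast
    qed
  qed
  then show ?thesis
    using r W sub h(2) off K KD chart_inv[OF c]
    by (intro that[of \<eta> "ball x0 (r/2/2)" K]) (auto simp: \<eta>_def subset_iff)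
qed

text \<open>A cutoff times \<open>f\<close>, extended by zero. As \<open>f\<close> may blow up
  towards the boundary of \<open>W\<close>, agreement is promised on a smaller neighbourhood
  only.\<close>

lemma smooth_extension:
  fixes f :: "'e \<Rightarrow> real"
  assumes c: "(D, \<psi>) \<in> A" and W: "open W" "W \<subseteq> \<psi> ` D" "x0 \<in> W" and f: "smooth_on W f"
  obtains F W' where "F \<in> Cinf A" "open W'" "x0 \<in> W'" "W' \<subseteq> W" "\<And>x. x \<in> W' \<Longrightarrow> F (inv_into D \<psi> x) = f x"
proof -
  obtain \<eta> W' K where \<eta>: "\<eta> \<in> Cinf A" "open W'" "x0 \<in> W'" "W' \<subseteq> W"
    "\<And>x. x \<in> W' \<Longrightarrow> \<eta> (inv_into D \<psi> x) = 1"
    "closed K" "K \<subseteq> D \<inter> \<psi> -` W" "\<And>q. q \<notin> K \<Longrightarrow> \<eta> q = 0"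
    using bump_function[OF c W] by blast
  let ?U = "D \<inter> \<psi> -` W"
  have U: "open ?U" by (rule open_chart_preimage[OF c W(1)])
  have fU: "smooth_fun A ?U (\<lambda>q. f (\<psi> q))"
    by (rule smooth_fun_chartI[OF c U])
       (use W f in \<open>auto simp: chart_image_preimage chart_inv[OF c] subset_iff intro: smooth_on_cong[OF W(1) _ f]\<close>)
  have "smooth_fun A UNIV (\<lambda>q. \<eta> q * f (\<psi> q))"
  proof (rule smooth_fun_local)
    fix q
    show "\<exists>W. open W \<and> q \<in> W \<and> smooth_fun A W (\<lambda>q. \<eta> q * f (\<psi> q))"
    proof (cases "q \<in> K")
      case True
      have "smooth_fun A ?U (\<lambda>q. \<eta> q * f (\<psi> q))"
        by (rule smooth_fun_mult[OF U _ fU]) (use \<eta>(1) in \<open>auto intro: smooth_fun_subset\<close>)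
      then show ?thesis using True \<eta>(7) U by blast
    next
      case False
      have "smooth_fun A (- K) (\<lambda>q. \<eta> q * f (\<psi> q))"
        by (rule smooth_fun_cong[OF _ _ smooth_fun_const[of _ 0]]) (use \<eta>(6,8) in auto)
      then show ?thesis using False \<eta>(6) by blast
    qed
  qed
  then show ?thesis
    using \<eta> W chart_inv[OF c] by (intro that[of "\<lambda>q. \<eta> q * f (\<psi> q)" W']) (auto simp: subset_iff)
qed

end

section \<open>Vector bundles and their sections\<close>

locale vbundle = atlas A for A :: "('m::{t2_space,second_countable_topology}, 'e::real_inner) chart set" +
  fixes E :: "('m, 'v, 'f::real_normed_vector) vbundle"
  assumes vector_bundle: "vector_bundle A E"
begin

lemma fin_dim_fibre: "fin_dim TYPE('f)"
  using vector_bundle by (simp add: vector_bundle_def)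

lemma triv_cover: obtains V \<phi> where "(V, \<phi>) \<in> trivs E" "q \<in> V"
proof -
  have "q \<in> (\<Union>(V, \<phi>)\<in>trivs E. V)" using vector_bundle by (simp add: vector_bundle_def)
  then show ?thesis using that by auto
qed

lemma triv:
  assumes "(V, \<phi>) \<in> trivs E"
  shows triv_open: "open V" and triv_bij: "q \<in> V \<Longrightarrow> bij_betw (\<phi> q) (fibre E q) UNIV"
  using assms vector_bundle by (auto simp: vector_bundle_def)

lemma triv_inv:
  assumes "(V, \<phi>) \<in> trivs E" "q \<in> V"
  shows "\<phi> q (inv_into (fibre E q) (\<phi> q) y) = y" "inv_into (fibre E q) (\<phi> q) y \<in> fibre E q"
    "v \<in> fibre E q \<Longrightarrow> inv_into (fibre E q) (\<phi> q) (\<phi> q v) = v"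
  using triv_bij[OF assms] by (auto simp: bij_betw_def f_inv_into_f inv_into_into)

lemma triv_eqI:
  "(V, \<phi>) \<in> trivs E \<Longrightarrow> q \<in> V \<Longrightarrow> v \<in> fibre E q \<Longrightarrow> w \<in> fibre E q \<Longrightarrow> \<phi> q v = \<phi> q w \<Longrightarrow> v = w"
  by (metis triv_inv(3))

lemma
  assumes "(V, \<phi>) \<in> trivs E" "(V', \<phi>') \<in> trivs E"
  shows transition_linear: "q \<in> V \<Longrightarrow> q \<in> V' \<Longrightarrow> linear (\<lambda>y. \<phi>' q (inv_into (fibre E q) (\<phi> q) y))"
    and transition_smooth_fun: "smooth_fun A (V \<inter> V') (\<lambda>q. \<phi>' q (inv_into (fibre E q) (\<phi> q) y))"
  using assms vector_bundle unfolding vector_bundle_def by fastforce+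

lemma coord_is_triv: obtains V \<phi> where "(V, \<phi>) \<in> trivs E" "q \<in> V" "coord E q = \<phi> q"
proof -
  obtain V \<phi> where "(V, \<phi>) \<in> trivs E" "q \<in> V" by (rule triv_cover)
  then have "\<exists>\<phi>m. \<exists>U \<phi>. (U, \<phi>) \<in> trivs E \<and> q \<in> U \<and> \<phi>m = \<phi> q" by blast
  from someI_ex[OF this] show ?thesis using that unfolding coord_def by blast
qed

text \<open>\<open>coord\<close> is an arbitrary choice among the trivialisations at the point, and
  \<open>T\<close> is the transition map to the chosen one. Spans and dimensions stated with
  \<open>coord\<close> are moved to a given trivialisation through \<open>T\<close>.\<close>

lemma coord_linear_iso:
  assumes "(V, \<phi>) \<in> trivs E" "q \<in> V"
  obtains T where "linear T" "inj T" "\<And>v. v \<in> fibre E q \<Longrightarrow> coord E q v = T (\<phi> q v)"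
proof -
  obtain V' \<phi>' where c: "(V', \<phi>') \<in> trivs E" "q \<in> V'" "coord E q = \<phi>' q" by (rule coord_is_triv)
  let ?T = "\<lambda>y. \<phi>' q (inv_into (fibre E q) (\<phi> q) y)"
  have "inj ?T"
    by (rule injI) (metis assms c(1,2) triv_eqI triv_inv(1,2))
  then show ?thesis
    using that[of ?T] transition_linear[OF assms(1) c(1) assms(2) c(2)] triv_inv(3)[OF assms] c(3) by simp
qed

lemma coord_inv:
  "coord E q (inv_into (fibre E q) (coord E q) y) = y" "inv_into (fibre E q) (coord E q) y \<in> fibre E q"
  by (rule coord_is_triv[of q]; simp add: triv_inv)+

lemma fibre_operations [simp, intro]:
  "vadd E q v w \<in> fibre E q" "vscale E q c v \<in> fibre E q" "vzero E q \<in> fibre E q"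
  by (simp_all add: vadd_def vscale_def vzero_def coord_inv)

text \<open>The operations are defined through the chosen \<open>coord\<close>; as transition maps
  are linear and injective, every trivialisation sees the same vector space structure.\<close>

lemma triv_operations:
  assumes "(V, \<phi>) \<in> trivs E" "q \<in> V"
  shows triv_vadd: "v \<in> fibre E q \<Longrightarrow> w \<in> fibre E q \<Longrightarrow> \<phi> q (vadd E q v w) = \<phi> q v + \<phi> q w"
    and triv_vscale: "v \<in> fibre E q \<Longrightarrow> \<phi> q (vscale E q c v) = c *\<^sub>R \<phi> q v"
    and triv_vzero: "\<phi> q (vzero E q) = 0"
proof -
  obtain T where T: "linear T" "inj T" "\<And>v. v \<in> fibre E q \<Longrightarrow> coord E q v = T (\<phi> q v)"
    using coord_linear_iso[OF assms] by blast
  have key: "\<phi> q v = y" if "v \<in> fibre E q" "coord E q v = T y" for v y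
    by (rule injD[OF T(2)], rule trans[OF T(3)[OF that(1), symmetric] that(2)])
  show "\<phi> q (vadd E q v w) = \<phi> q v + \<phi> q w" if "v \<in> fibre E q" "w \<in> fibre E q"
    by (rule key[OF fibre_operations(1)])
       (simp add: vadd_def coord_inv linear_add[OF T(1)] T(3) that)
  show "\<phi> q (vscale E q c v) = c *\<^sub>R \<phi> q v" if "v \<in> fibre E q"
    by (rule key[OF fibre_operations(2)])
       (simp add: vscale_def coord_inv linear_scale[OF T(1)] T(3) that)
  show "\<phi> q (vzero E q) = 0"
    by (rule key[OF fibre_operations(3)]) (simp add: vzero_def coord_inv linear_0[OF T(1)])
qed

lemma section_fibre: "\<sigma> \<in> sections A E \<Longrightarrow> \<sigma> q \<in> fibre E q"
  by (simp add: sections_def smooth_section_def)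

lemma section_smooth_fun:
  "\<sigma> \<in> sections A E \<Longrightarrow> (V, \<phi>) \<in> trivs E \<Longrightarrow> smooth_fun A V (\<lambda>q. \<phi> q (\<sigma> q))"
  unfolding sections_def smooth_section_def by fastforce

text \<open>One trivialisation around each point suffices, since any other differs from it by a
  smooth family of linear maps.\<close>

lemma smooth_section_local:
  assumes fib: "\<And>q. q \<in> U \<Longrightarrow> \<sigma> q \<in> fibre E q"
    and loc: "\<And>q. q \<in> U \<Longrightarrow> \<exists>W V \<phi>. open W \<and> q \<in> W \<and> (V, \<phi>) \<in> trivs E \<and> W \<subseteq> V \<inter> U \<and>
      smooth_fun A W (\<lambda>q. \<phi> q (\<sigma> q))"
  shows "smooth_section A E U \<sigma>"
  unfolding smooth_section_def
proof (intro conjI ballI fib, safe)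
  fix V' \<phi>' assume t': "(V', \<phi>') \<in> trivs E"
  show "smooth_fun A (U \<inter> V') (\<lambda>q. \<phi>' q (\<sigma> q))"
  proof (rule smooth_fun_local)
    fix q assume q: "q \<in> U \<inter> V'"
    then obtain W V \<phi> where W: "open W" "q \<in> W" "(V, \<phi>) \<in> trivs E" "W \<subseteq> V \<inter> U"
      "smooth_fun A W (\<lambda>q. \<phi> q (\<sigma> q))" using loc by blast
    let ?W = "W \<inter> V'"
    have open': "open ?W" using W(1) triv_open[OF t'] by auto
    have "smooth_fun A ?W (\<lambda>q. \<phi>' q (inv_into (fibre E q) (\<phi> q) (\<phi> q (\<sigma> q))))"
      by (rule smooth_fun_apply_linear_family[OF fin_dim_fibre open' transition_linear[OF W(3) t']
            smooth_fun_subset[OF transition_smooth_fun[OF W(3) t']] smooth_fun_subset[OF W(5)]])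
         (use W(4) in auto)
    then have "smooth_fun A ?W (\<lambda>q. \<phi>' q (\<sigma> q))"
      by (rule smooth_fun_cong[OF open', rotated])
         (use W(4) fib triv_inv(3)[OF W(3)] in \<open>auto simp: subset_iff\<close>)
    then show "\<exists>W. open W \<and> q \<in> W \<and> smooth_fun A W (\<lambda>q. \<phi>' q (\<sigma> q))"
      using open' q W(2) by blast
  qed
qed

lemma sectionI:
  assumes "\<And>q. \<sigma> q \<in> fibre E q"
    and "\<And>V \<phi>. (V, \<phi>) \<in> trivs E \<Longrightarrow> smooth_fun A V (\<lambda>q. \<phi> q (\<sigma> q))"
  shows "\<sigma> \<in> sections A E"
  using assms by (auto simp: sections_def smooth_section_def)

text \<open>A sum in the model space instead of an iterated \<open>sec_add\<close>, so that any
  trivialisation commutes with it in one step. \<open>lincomb_insert\<close> connects it with the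
  operations in which the axioms of \<open>lie_algebroid\<close> are stated.\<close>

definition lincomb :: "'i set \<Rightarrow> ('i \<Rightarrow> 'm \<Rightarrow> real) \<Rightarrow> ('i \<Rightarrow> 'm \<Rightarrow> 'v) \<Rightarrow> 'm \<Rightarrow> 'v" where
  "lincomb I f S q = inv_into (fibre E q) (coord E q) (\<Sum>i\<in>I. f i q *\<^sub>R coord E q (S i q))"

lemma lincomb_fibre [simp, intro]: "lincomb I f S q \<in> fibre E q"
  by (simp add: lincomb_def coord_inv)

lemma triv_lincomb:
  assumes "(V, \<phi>) \<in> trivs E" "q \<in> V" "\<And>i. i \<in> I \<Longrightarrow> S i q \<in> fibre E q"
  shows "\<phi> q (lincomb I f S q) = (\<Sum>i\<in>I. f i q *\<^sub>R \<phi> q (S i q))"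
proof -
  obtain T where T: "linear T" "inj T" "\<And>v. v \<in> fibre E q \<Longrightarrow> coord E q v = T (\<phi> q v)"
    using coord_linear_iso[OF assms(1,2)] by blast
  have "T (\<phi> q (lincomb I f S q)) = coord E q (lincomb I f S q)" by (simp add: T(3))
  also have "\<dots> = (\<Sum>i\<in>I. f i q *\<^sub>R coord E q (S i q))"
    unfolding lincomb_def by (rule coord_inv)
  also have "\<dots> = (\<Sum>i\<in>I. f i q *\<^sub>R T (\<phi> q (S i q)))" using T(3) assms(3) by simp
  also have "\<dots> = T (\<Sum>i\<in>I. f i q *\<^sub>R \<phi> q (S i q))"
    by (simp only: linear_sum[OF T(1)] linear_scale[OF T(1)])
  finally show ?thesis by (rule injD[OF T(2)])
qed

lemma triv_lincomb_sections:
  assumes "(V, \<phi>) \<in> trivs E" "q \<in> V" "\<And>i. i \<in> I \<Longrightarrow> S i \<in> sections A E"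
  shows "\<phi> q (lincomb I f S q) = (\<Sum>i\<in>I. f i q *\<^sub>R \<phi> q (S i q))"
  by (rule triv_lincomb[OF assms(1,2)]) (rule section_fibre[OF assms(3)])

lemma lincomb_section:
  assumes "\<And>i. i \<in> I \<Longrightarrow> f i \<in> Cinf A" "\<And>i. i \<in> I \<Longrightarrow> S i \<in> sections A E"
  shows "lincomb I f S \<in> sections A E"
proof (rule sectionI)
  fix V \<phi> assume t: "(V, \<phi>) \<in> trivs E"
  have "smooth_fun A V (\<lambda>q. \<Sum>i\<in>I. f i q *\<^sub>R \<phi> q (S i q))"
    using assms by (intro smooth_fun_sum smooth_fun_scaleR triv_open[OF t] section_smooth_fun[OF _ t])
      (auto intro: smooth_fun_subset)
  then show "smooth_fun A V (\<lambda>q. \<phi> q (lincomb I f S q))"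
    by (rule smooth_fun_cong[OF triv_open[OF t], rotated])
       (rule triv_lincomb_sections[OF t _ assms(2), symmetric])
qed simp

lemma sec_add_section:
  assumes "\<sigma> \<in> sections A E" "\<tau> \<in> sections A E"
  shows "sec_add E \<sigma> \<tau> \<in> sections A E"
proof (rule sectionI)
  fix V \<phi> assume t: "(V, \<phi>) \<in> trivs E"
  have "smooth_fun A V (\<lambda>q. \<phi> q (\<sigma> q) + \<phi> q (\<tau> q))"
    using assms by (intro smooth_fun_add triv_open[OF t] section_smooth_fun[OF _ t])
  then show "smooth_fun A V (\<lambda>q. \<phi> q (sec_add E \<sigma> \<tau> q))"
    by (rule smooth_fun_cong[OF triv_open[OF t], rotated])
       (use triv_vadd[OF t] assms section_fibre in \<open>auto simp: sec_add_def\<close>)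
qed (simp add: sec_add_def)

lemma sec_mult_section:
  assumes "f \<in> Cinf A" "\<sigma> \<in> sections A E"
  shows "sec_mult E f \<sigma> \<in> sections A E"
proof (rule sectionI)
  fix V \<phi> assume t: "(V, \<phi>) \<in> trivs E"
  have "smooth_fun A V (\<lambda>q. f q *\<^sub>R \<phi> q (\<sigma> q))"
    using assms by (intro smooth_fun_scaleR triv_open[OF t] section_smooth_fun[OF _ t])
      (auto intro: smooth_fun_subset)
  then show "smooth_fun A V (\<lambda>q. \<phi> q (sec_mult E f \<sigma> q))"
    by (rule smooth_fun_cong[OF triv_open[OF t], rotated])
       (use triv_vscale[OF t] assms section_fibre in \<open>auto simp: sec_mult_def\<close>)
qed (simp add: sec_mult_def)

lemma lincomb_insert:
  assumes "finite I" "a \<notin> I" "\<And>i. i \<in> insert a I \<Longrightarrow> S i \<in> sections A E"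
  shows "lincomb (insert a I) f S = sec_add E (sec_mult E (f a) (S a)) (lincomb I f S)"
proof
  fix q
  obtain V \<phi> where t: "(V, \<phi>) \<in> trivs E" "q \<in> V" by (rule triv_cover)
  show "lincomb (insert a I) f S q = sec_add E (sec_mult E (f a) (S a)) (lincomb I f S) q"
  proof (rule triv_eqI[OF t])
    have "\<phi> q (lincomb I f S q) = (\<Sum>i\<in>I. f i q *\<^sub>R \<phi> q (S i q))"
      by (rule triv_lincomb_sections[OF t assms(3)]) simp
    moreover have "\<phi> q (lincomb (insert a I) f S q) = (\<Sum>i\<in>insert a I. f i q *\<^sub>R \<phi> q (S i q))"
      by (rule triv_lincomb_sections[OF t assms(3)])
    ultimately show "\<phi> q (lincomb (insert a I) f S q) = \<phi> q (sec_add E (sec_mult E (f a) (S a)) (lincomb I f S) q)"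
      using assms by (simp add: sec_add_def sec_mult_def triv_vadd[OF t] triv_vscale[OF t] section_fibre)
  qed (simp_all add: sec_add_def)
qed

lemma lincomb_empty: "lincomb {} f S = vzero E"
  by (rule ext) (simp add: lincomb_def vzero_def)

end

section \<open>Sections in a chart and a trivialisation\<close>

locale triv_chart = vbundle A E
  for A :: "('m::{t2_space,second_countable_topology}, 'e::real_inner) chart set"
    and E :: "('m, 'v, 'f::real_normed_vector) vbundle" +
  fixes D :: "'m set" and \<psi> :: "'m \<Rightarrow> 'e" and V :: "'m set" and \<phi> :: "'m \<Rightarrow> 'v \<Rightarrow> 'f"
  assumes chart_A: "(D, \<psi>) \<in> A" and triv_E: "(V, \<phi>) \<in> trivs E"
begin

definition \<kappa> :: "'e \<Rightarrow> 'm" where "\<kappa> = inv_into D \<psi>"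
definition \<Omega> :: "'e set" where "\<Omega> = \<psi> ` (D \<inter> V)"
definition rep :: "('m \<Rightarrow> 'v) \<Rightarrow> 'e \<Rightarrow> 'f" where "rep \<sigma> = local_rep (D, \<psi>) \<phi> \<sigma>"

lemma rep_eq: "rep \<sigma> x = \<phi> (\<kappa> x) (\<sigma> (\<kappa> x))"
  by (simp add: rep_def local_rep_def \<kappa>_def Let_def)

lemma open_\<Omega>: "open \<Omega>"
  using open_chart_image[OF chart_A triv_open[OF triv_E]] by (simp add: \<Omega>_def Int_commute)

lemma \<Omega>_sub: "\<Omega> \<subseteq> \<psi> ` D" by (auto simp: \<Omega>_def)

lemma \<kappa>_inv:
  "x \<in> \<Omega> \<Longrightarrow> \<psi> (\<kappa> x) = x" "x \<in> \<Omega> \<Longrightarrow> \<kappa> x \<in> D" "x \<in> \<Omega> \<Longrightarrow> \<kappa> x \<in> V"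
  "q \<in> D \<Longrightarrow> \<kappa> (\<psi> q) = q" "q \<in> D \<Longrightarrow> q \<in> V \<Longrightarrow> \<psi> q \<in> \<Omega>"
  using chart_inv[OF chart_A] by (auto simp: \<kappa>_def \<Omega>_def)

lemma open_chart_neighbourhood: "open W \<Longrightarrow> open (D \<inter> V \<inter> \<psi> -` W)"
  using open_chart_preimage[OF chart_A] triv_open[OF triv_E]
  by (metis Int_commute Int_left_commute open_Int)

lemma rep_smooth:
  assumes "\<sigma> \<in> sections A E" shows "smooth_on \<Omega> (rep \<sigma>)"
  using smooth_fun_chartD[OF section_smooth_fun[OF assms triv_E] chart_A]
  by (simp add: rep_eq[abs_def] \<Omega>_def \<kappa>_def Int_commute)

lemma rep_smooth_on:
  assumes "smooth_section A E U \<sigma>" shows "smooth_on (\<psi> ` (U \<inter> V \<inter> D)) (rep \<sigma>)"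
proof -
  have "smooth_fun A (U \<inter> V) (\<lambda>q. \<phi> q (\<sigma> q))" using assms triv_E by (auto simp: smooth_section_def)
  from smooth_fun_chartD[OF this chart_A] show ?thesis by (simp add: rep_eq[abs_def] \<kappa>_def)
qed

lemma rep_linear:
  assumes "\<sigma> \<in> sections A E" "\<tau> \<in> sections A E" "x \<in> \<Omega>"
  shows rep_add: "rep (sec_add E \<sigma> \<tau>) x = rep \<sigma> x + rep \<tau> x"
    and rep_mult: "rep (sec_mult E f \<sigma>) x = f (\<kappa> x) *\<^sub>R rep \<sigma> x"
  using triv_vadd[OF triv_E] triv_vscale[OF triv_E] assms \<kappa>_inv(3)
  by (simp_all add: rep_eq sec_add_def sec_mult_def section_fibre)

lemma rep_lincomb:
  assumes "\<And>i. i \<in> I \<Longrightarrow> S i \<in> sections A E" "x \<in> \<Omega>"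
  shows "rep (lincomb I f S) x = (\<Sum>i\<in>I. f i (\<kappa> x) *\<^sub>R rep (S i) x)"
  unfolding rep_eq by (rule triv_lincomb_sections[OF triv_E \<kappa>_inv(3)[OF assms(2)] assms(1)])

lemma rep_eq_iff:
  assumes "\<sigma> \<in> sections A E" "\<tau> \<in> sections A E" "x \<in> \<Omega>"
  shows "rep \<sigma> x = rep \<tau> x \<longleftrightarrow> \<sigma> (\<kappa> x) = \<tau> (\<kappa> x)"
  using triv_eqI[OF triv_E \<kappa>_inv(3)[OF assms(3)]] assms section_fibre by (auto simp: rep_eq)

text \<open>The last clause says that the extension is everywhere zero or a multiple of
  \<open>s\<close>. It therefore stays in every subbundle that contains \<open>s\<close>; global
  sections of \<open>g\<close> are obtained in this way.\<close>

lemma section_extension: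
  assumes W: "open W" "W \<subseteq> \<Omega>" "x0 \<in> W" and s: "smooth_on W s"
  obtains \<sigma> W' where "\<sigma> \<in> sections A E" "open W'" "x0 \<in> W'" "W' \<subseteq> W" "\<And>x. x \<in> W' \<Longrightarrow> rep \<sigma> x = s x"
    "\<And>q. \<sigma> q = vzero E q \<or> (q \<in> D \<inter> V \<and> \<psi> q \<in> W \<and> (\<exists>r. \<phi> q (\<sigma> q) = r *\<^sub>R s (\<psi> q)))"
proof -
  obtain \<eta> W' K where \<eta>: "\<eta> \<in> Cinf A" "open W'" "x0 \<in> W'" "W' \<subseteq> W"
    "\<And>x. x \<in> W' \<Longrightarrow> \<eta> (\<kappa> x) = 1" "closed K" "K \<subseteq> D \<inter> \<psi> -` W" "\<And>q. q \<notin> K \<Longrightarrow> \<eta> q = 0"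
    using bump_function[OF chart_A W(1) subset_trans[OF W(2) \<Omega>_sub] W(3), folded \<kappa>_def] by blast
  let ?U = "D \<inter> \<psi> -` W"
  have U: "open ?U" by (rule open_chart_preimage[OF chart_A W(1)])
  have UV: "?U \<subseteq> V"
  proof
    fix q assume "q \<in> ?U"
    then have "\<kappa> (\<psi> q) \<in> V" "\<kappa> (\<psi> q) = q" using W(2) \<kappa>_inv(3)[of "\<psi> q"] \<kappa>_inv(4)[of q] by auto
    then show "q \<in> V" by simp
  qed
  have WD: "W \<subseteq> \<psi> ` D" using W(2) \<Omega>_sub by blast
  define \<sigma> where "\<sigma> q = (if q \<in> ?U then inv_into (fibre E q) (\<phi> q) (\<eta> q *\<^sub>R s (\<psi> q)) else vzero E q)" for q
  have fib: "\<sigma> q \<in> fibre E q" for q using triv_inv(2)[OF triv_E] UV by (auto simp: \<sigma>_def)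
  have \<phi>\<sigma>: "\<phi> q (\<sigma> q) = \<eta> q *\<^sub>R s (\<psi> q)" if "q \<in> ?U" for q
    using that UV triv_inv(1)[OF triv_E] by (auto simp: \<sigma>_def)
  have off: "\<sigma> q = vzero E q" if "q \<notin> K" for q
  proof (cases "q \<in> ?U")
    case True
    then have q: "q \<in> V" using UV by blast
    show ?thesis
      using \<phi>\<sigma>[OF True] \<eta>(8)[OF that] triv_vzero[OF triv_E q] triv_eqI[OF triv_E q fib fibre_operations(3)] by simp
  qed (auto simp: \<sigma>_def)
  have "smooth_section A E UNIV \<sigma>"
  proof (rule smooth_section_local[OF fib])
    fix q
    show "\<exists>W V \<phi>. open W \<and> q \<in> W \<and> (V, \<phi>) \<in> trivs E \<and> W \<subseteq> V \<inter> UNIV \<and> smooth_fun A W (\<lambda>q. \<phi> q (\<sigma> q))"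
    proof (cases "q \<in> K")
      case True
      have "smooth_fun A ?U (\<lambda>q. s (\<psi> q))"
      proof (rule smooth_fun_chartI[OF chart_A U])
        show "smooth_on (\<psi> ` ?U) (\<lambda>x. s (\<psi> (inv_into D \<psi> x)))"
          unfolding chart_image_preimage[OF WD]
          by (rule smooth_on_cong[OF W(1) _ s]) (use WD chart_inv[OF chart_A] in auto)
      qed simp
      then have "smooth_fun A ?U (\<lambda>q. \<eta> q *\<^sub>R s (\<psi> q))"
        using \<eta>(1) by (intro smooth_fun_scaleR[OF U]) (auto intro: smooth_fun_subset)
      then have "smooth_fun A ?U (\<lambda>q. \<phi> q (\<sigma> q))"
        by (rule smooth_fun_cong[OF U, rotated]) (simp add: \<phi>\<sigma>)
      then show ?thesis using True \<eta>(7) U UV triv_E by blast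
    next
      case False
      obtain V' \<phi>' where t': "(V', \<phi>') \<in> trivs E" "q \<in> V'" by (rule triv_cover)
      have "smooth_fun A (- K \<inter> V') (\<lambda>q. \<phi>' q (\<sigma> q))"
        by (rule smooth_fun_cong[OF _ _ smooth_fun_const[of _ 0]])
           (use \<eta>(6) triv_open[OF t'(1)] off triv_vzero[OF t'(1)] in auto)
      then show ?thesis using False \<eta>(6) t' triv_open[OF t'(1)]
        by (intro exI[of _ "- K \<inter> V'"] exI[of _ V'] exI[of _ \<phi>']) auto
    qed
  qed
  then have "\<sigma> \<in> sections A E" by (simp add: sections_def)
  moreover have "rep \<sigma> x = s x" if "x \<in> W'" for x
  proof -
    have x: "x \<in> W" "x \<in> \<Omega>" using that \<eta>(4) W(2) by auto
    then have "\<kappa> x \<in> ?U" by (simp add: \<kappa>_inv)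
    then show ?thesis using \<phi>\<sigma>[of "\<kappa> x"] \<eta>(5)[OF that] x by (simp add: rep_eq \<kappa>_inv)
  qed
  moreover have "\<sigma> q = vzero E q \<or> (q \<in> D \<inter> V \<and> \<psi> q \<in> W \<and> (\<exists>r. \<phi> q (\<sigma> q) = r *\<^sub>R s (\<psi> q)))" for q
    using \<phi>\<sigma>[of q] UV by (cases "q \<in> ?U") (auto simp: \<sigma>_def)
  ultimately show ?thesis using that \<eta>(2-4) by blast
qed

lemma function_extension:
  fixes f :: "'e \<Rightarrow> real"
  assumes W: "open W" "W \<subseteq> \<Omega>" "x0 \<in> W" and f: "smooth_on W f"
  obtains F W' where "F \<in> Cinf A" "open W'" "x0 \<in> W'" "W' \<subseteq> W" "\<And>x. x \<in> W' \<Longrightarrow> F (\<kappa> x) = f x"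
  using smooth_extension[OF chart_A W(1) subset_trans[OF W(2) \<Omega>_sub] W(3) f, folded \<kappa>_def] by blast

lemma function_smooth: "f \<in> Cinf A \<Longrightarrow> smooth_on \<Omega> (\<lambda>x. f (\<kappa> x))"
  using smooth_on_subset[OF smooth_fun_chartD[OF _ chart_A, of UNIV f] ] \<Omega>_sub by (simp add: \<kappa>_def)

end

section \<open>Jets of sections\<close>

text \<open>\<open>smooth_on_derivative\<close> concerns one fixed direction at a time. A finite sum
  of tensors assembles these directions into a smooth operator-valued map.\<close>

lemma smooth_on_Blinfun_derivative:
  fixes f :: "'a::real_normed_vector \<Rightarrow> 'b::real_normed_vector"
  assumes fd: "fin_dim TYPE('a)" and S: "open S" and f: "smooth_on S f"
  shows "smooth_on S (\<lambda>x. Blinfun (frechet_derivative f (at x)))"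
proof -
  obtain B and \<beta> :: "'a \<Rightarrow> 'a \<Rightarrow> real" where B: "finite B" "\<And>b. bounded_linear (\<beta> b)"
    "\<And>x. x = (\<Sum>b\<in>B. \<beta> b x *\<^sub>R b)"
    using fin_dim_coordinates[OF fd] by metis
  have "smooth_on S (\<lambda>x. \<Sum>b\<in>B. tensor (\<beta> b) (frechet_derivative f (at x) b))"
    by (intro smooth_on_sum S smooth_on_bounded_linear[OF bounded_linear_tensor[OF B(2)]] smooth_on_derivative[OF f])
  moreover have "(\<Sum>b\<in>B. tensor (\<beta> b) (frechet_derivative f (at x) b)) = Blinfun (frechet_derivative f (at x))"
    if "x \<in> S" for x
    using blinfun_eq_tensor_sum[OF B, of "Blinfun (frechet_derivative f (at x))"]
    by (simp only: bounded_linear_Blinfun_apply[OF smooth_on_linear_derivative[OF f that]])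
  ultimately show ?thesis by (rule smooth_on_cong[OF S, rotated])
qed

lemma smooth_on_Pair:
  assumes S: "open S" and "smooth_on S f" "smooth_on S g"
  shows "smooth_on S (\<lambda>x. (f x, g x))"
proof -
  have "bounded_linear (\<lambda>a. (a, 0::'c))" "bounded_linear (\<lambda>b. (0::'b, b))"
    by (auto intro: bounded_linear_Pair bounded_linear_ident bounded_linear_zero)
  then have "smooth_on S (\<lambda>x. (f x, 0::'c) + (0::'b, g x))"
    using assms by (intro smooth_on_add S)
      (rule smooth_on_bounded_linear[where f=f] smooth_on_bounded_linear[where f=g]; assumption)+
  then show ?thesis by simp
qed

text \<open>Each term of the product rule contains \<open>d x\<close> or the derivative of
  \<open>d\<close> at \<open>x\<close>, and both are zero. Applied to the difference of two
  sections, this avoids a formula for derivatives in new coordinates.\<close>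

lemma linear_family_zero_derivative:
  fixes G :: "'a::real_normed_vector \<Rightarrow> 'b::real_normed_vector \<Rightarrow> 'c::real_normed_vector"
  assumes fd: "fin_dim TYPE('b)" and S: "open S" "x \<in> S" and lin: "\<And>y. y \<in> S \<Longrightarrow> linear (G y)"
    and G: "\<And>b. (\<lambda>y. G y b) differentiable (at x)"
    and d: "(d has_derivative (\<lambda>_. 0)) (at x)" "d x = 0"
  shows "((\<lambda>y. G y (d y)) has_derivative (\<lambda>_. 0)) (at x)"
proof -
  obtain B and \<beta> :: "'b \<Rightarrow> 'b \<Rightarrow> real" where B: "finite B" "\<And>b. bounded_linear (\<beta> b)"
    "\<And>x. x = (\<Sum>b\<in>B. \<beta> b x *\<^sub>R b)"
    using fin_dim_coordinates[OF fd] by metis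
  have \<beta>0: "\<beta> b 0 = 0" for b using linear_0[OF bounded_linear.linear[OF B(2)]] .
  have 1: "((\<lambda>y. \<beta> b (d y) *\<^sub>R G y b) has_derivative (\<lambda>v. 0)) (at x)" for b
  proof -
    have "((\<lambda>y. \<beta> b (d y)) has_derivative (\<lambda>v. \<beta> b 0)) (at x)"
      by (rule bounded_linear.has_derivative[OF B(2) d(1)])
    from has_derivative_scaleR[OF this G[of b, unfolded frechet_derivative_works]]
    show ?thesis by (simp add: d(2) \<beta>0)
  qed
  have "((\<lambda>y. \<Sum>b\<in>B. \<beta> b (d y) *\<^sub>R G y b) has_derivative (\<lambda>v. \<Sum>b\<in>B. 0)) (at x)"
    by (rule has_derivative_sum[OF 1])
  then have "((\<lambda>y. \<Sum>b\<in>B. \<beta> b (d y) *\<^sub>R G y b) has_derivative (\<lambda>v. 0)) (at x)" by simp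
  then show ?thesis
    by (rule has_derivative_transform_within_open[OF _ S])
       (rule linear_eq_coordinates[OF lin B(1,3), symmetric])
qed

context triv_chart
begin

text \<open>The difference of the two sections vanishes to first order, and this survives a change
  of chart and trivialisation. Hence equality of 1-jets, which \<open>same_1jet\<close> demands in
  all charts, can be tested in one.\<close>

lemma frechet_derivative_chart_independent:
  assumes c': "(D', \<psi>') \<in> A" "(V', \<phi>') \<in> trivs E" and q: "q \<in> D" "q \<in> V" "q \<in> D'" "q \<in> V'"
    and \<sigma>: "\<sigma> \<in> sections A E" and \<tau>: "\<tau> \<in> sections A E"
    and eq: "rep \<sigma> (\<psi> q) = rep \<tau> (\<psi> q)"
      "frechet_derivative (rep \<sigma>) (at (\<psi> q)) = frechet_derivative (rep \<tau>) (at (\<psi> q))"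
  shows "frechet_derivative (local_rep (D', \<psi>') \<phi>' \<sigma>) (at (\<psi>' q)) =
         frechet_derivative (local_rep (D', \<psi>') \<phi>' \<tau>) (at (\<psi>' q))"
proof -
  interpret o: triv_chart A E D' \<psi>' V' \<phi>' by unfold_locales (use c' in auto)
  define S where "S = \<psi>' ` ((D \<inter> V \<inter> V') \<inter> D')"
  have opn: "open (D \<inter> V \<inter> V')"
    using chart_domain_open[OF chart_A] triv_open[OF triv_E] triv_open[OF c'(2)] by auto
  have S: "open S" unfolding S_def by (rule open_chart_image[OF c'(1) opn])
  have xS: "\<psi>' q \<in> S" using q by (auto simp: S_def)
  have So: "S \<subseteq> o.\<Omega>" by (auto simp: S_def o.\<Omega>_def)
  define k where "k y = \<psi> (o.\<kappa> y)" for y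
  have \<kappa>S: "o.\<kappa> y \<in> D" "o.\<kappa> y \<in> V" "o.\<kappa> y \<in> V'" if "y \<in> S" for y
    using that by (auto simp: S_def o.\<kappa>_inv)
  have kS: "k y \<in> \<Omega>" "\<kappa> (k y) = o.\<kappa> y" if "y \<in> S" for y
    using \<kappa>S[OF that] by (auto simp: k_def \<kappa>_inv)
  have kq: "k (\<psi>' q) = \<psi> q" using q by (simp add: k_def o.\<kappa>_inv)
  have sk: "smooth_on S k"
    unfolding k_def o.\<kappa>_def
    by (rule smooth_on_subset[OF transition_smooth[OF c'(1) chart_A]]) (auto simp: S_def)
  \<comment> \<open>\<open>k\<close> changes the chart and \<open>G\<close> the trivialisation, so
    the new representative is \<open>G\<close> applied to the old one along
    \<open>k\<close>.\<close>
  define G where "G y u = \<phi>' (o.\<kappa> y) (inv_into (fibre E (o.\<kappa> y)) (\<phi> (o.\<kappa> y)) u)" for y u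
  have lin: "linear (G y)" if "y \<in> S" for y
    unfolding G_def using transition_linear[OF triv_E c'(2)] \<kappa>S[OF that] by blast
  have smG: "smooth_on S (\<lambda>y. G y u)" for u
    unfolding G_def o.\<kappa>_def
    by (rule smooth_on_subset[OF smooth_fun_chartD[OF transition_smooth_fun[OF triv_E c'(2)] c'(1)]])
       (auto simp: S_def)
  have rep: "o.rep \<upsilon> y = G y (rep \<upsilon> (k y))" if "\<upsilon> \<in> sections A E" "y \<in> S" for \<upsilon> y
    using kS[OF that(2)] \<kappa>S[OF that(2)] triv_inv(3)[OF triv_E _ section_fibre[OF that(1)]]
    by (simp add: o.rep_eq rep_eq G_def)
  have dk: "((\<lambda>y. rep \<upsilon> (k y)) has_derivative
      (\<lambda>v. frechet_derivative (rep \<upsilon>) (at (\<psi> q)) (frechet_derivative k (at (\<psi>' q)) v))) (at (\<psi>' q))"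
    if "\<upsilon> \<in> sections A E" for \<upsilon>
  proof -
    have "\<psi> q \<in> \<Omega>" using q \<kappa>_inv(5) by blast
    then show ?thesis
      using diff_chain_at[OF smooth_on_has_derivative[OF sk xS], of "rep \<upsilon>"] kq
        smooth_on_has_derivative[OF rep_smooth[OF that]] by (simp add: o_def)
  qed
  define d where "d y = rep \<sigma> (k y) - rep \<tau> (k y)" for y
  have dd: "(d has_derivative (\<lambda>_. 0)) (at (\<psi>' q))"
    using has_derivative_diff[OF dk[OF \<sigma>] dk[OF \<tau>]] by (simp add: d_def[abs_def] eq)
  have "((\<lambda>y. G y (d y)) has_derivative (\<lambda>_. 0)) (at (\<psi>' q))"
  proof (rule linear_family_zero_derivative[OF fin_dim_fibre S xS, where G=G and d=d])
    show "(\<lambda>y. G y b) differentiable (at (\<psi>' q))" for b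
      by (rule smooth_on_differentiable[OF smG xS])
    show "d (\<psi>' q) = 0" using kq eq by (simp add: d_def)
  qed (use lin dd in auto)
  then have "((\<lambda>y. o.rep \<sigma> y - o.rep \<tau> y) has_derivative (\<lambda>_. 0)) (at (\<psi>' q))"
    by (rule has_derivative_transform_within_open[OF _ S xS])
       (simp add: rep \<sigma> \<tau> d_def linear_diff[OF lin])
  moreover have "((\<lambda>y. o.rep \<sigma> y - o.rep \<tau> y) has_derivative
     (\<lambda>v. frechet_derivative (o.rep \<sigma>) (at (\<psi>' q)) v - frechet_derivative (o.rep \<tau>) (at (\<psi>' q)) v)) (at (\<psi>' q))"
    using xS So by (intro has_derivative_diff smooth_on_has_derivative[OF o.rep_smooth] \<sigma> \<tau>) auto
  ultimately have "(\<lambda>v. frechet_derivative (o.rep \<sigma>) (at (\<psi>' q)) v - frechet_derivative (o.rep \<tau>) (at (\<psi>' q)) v) = (\<lambda>_. 0)"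
    using has_derivative_unique by blast
  then have "frechet_derivative (o.rep \<sigma>) (at (\<psi>' q)) v = frechet_derivative (o.rep \<tau>) (at (\<psi>' q)) v" for v
    by (metis eq_iff_diff_eq_0)
  then show ?thesis unfolding o.rep_def by blast
qed

text \<open>The coordinates that \<open>J1_triv\<close> assigns to a jet, but as a function of a
  section instead of an equivalence class; \<open>J1_triv_j1\<close> identifies the two.\<close>

definition jet :: "'e \<Rightarrow> ('m \<Rightarrow> 'v) \<Rightarrow> 'f \<times> ('e \<Rightarrow>\<^sub>L 'f)" where
  "jet x \<sigma> = (rep \<sigma> x, Blinfun (frechet_derivative (rep \<sigma>) (at x)))"

lemma fst_jet [simp]: "fst (jet x \<sigma>) = rep \<sigma> x"
  by (simp add: jet_def)

lemma rep_has_derivative: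
  "\<sigma> \<in> sections A E \<Longrightarrow> x \<in> \<Omega> \<Longrightarrow> (rep \<sigma> has_derivative frechet_derivative (rep \<sigma>) (at x)) (at x)"
  by (rule smooth_on_has_derivative[OF rep_smooth])

lemma snd_jet:
  "\<sigma> \<in> sections A E \<Longrightarrow> x \<in> \<Omega> \<Longrightarrow> blinfun_apply (snd (jet x \<sigma>)) = frechet_derivative (rep \<sigma>) (at x)"
  unfolding jet_def snd_conv
  by (rule bounded_linear_Blinfun_apply[OF smooth_on_linear_derivative[OF rep_smooth]])

lemma jet_eq_iff:
  assumes "\<sigma> \<in> sections A E" "\<tau> \<in> sections A E" "x \<in> \<Omega>"
  shows "jet x \<sigma> = jet x \<tau> \<longleftrightarrow>
    rep \<sigma> x = rep \<tau> x \<and> frechet_derivative (rep \<sigma>) (at x) = frechet_derivative (rep \<tau>) (at x)"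
  using snd_jet[OF assms(1,3)] snd_jet[OF assms(2,3)]
  by (metis fst_jet jet_def prod.collapse)

lemma same_1jet_iff:
  assumes "\<sigma> \<in> sections A E" "\<tau> \<in> sections A E" "q \<in> D" "q \<in> V"
  shows "same_1jet A E q \<sigma> \<tau> \<longleftrightarrow> jet (\<psi> q) \<sigma> = jet (\<psi> q) \<tau>"
proof
  assume *: "same_1jet A E q \<sigma> \<tau>"
  then have "frechet_derivative (rep \<sigma>) (at (\<psi> q)) = frechet_derivative (rep \<tau>) (at (\<psi> q))"
    using assms(3,4) chart_A triv_E unfolding same_1jet_def rep_def by fastforce
  moreover have "\<sigma> q = \<tau> q" using * by (simp add: same_1jet_def)
  ultimately show "jet (\<psi> q) \<sigma> = jet (\<psi> q) \<tau>"
    using assms by (simp add: jet_def rep_eq \<kappa>_inv)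
next
  assume *: "jet (\<psi> q) \<sigma> = jet (\<psi> q) \<tau>"
  have x: "\<psi> q \<in> \<Omega>" using assms \<kappa>_inv by blast
  note eq = *[unfolded jet_eq_iff[OF assms(1,2) x]]
  have "\<sigma> q = \<tau> q" using eq rep_eq_iff[OF assms(1,2) x] assms(3) by (simp add: \<kappa>_inv)
  then show "same_1jet A E q \<sigma> \<tau>"
    unfolding same_1jet_def using frechet_derivative_chart_independent[OF _ _ assms(3,4) _ _ assms(1,2)] eq by auto
qed

lemma j1_eq_iff:
  assumes "\<sigma> \<in> sections A E" "\<tau> \<in> sections A E" "q \<in> D" "q \<in> V"
  shows "j1 A E \<sigma> q = j1 A E \<tau> q \<longleftrightarrow> jet (\<psi> q) \<sigma> = jet (\<psi> q) \<tau>"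
proof
  assume *: "j1 A E \<sigma> q = j1 A E \<tau> q"
  have "\<tau> \<in> j1 A E \<tau> q" using assms by (auto simp: j1_def same_1jet_def)
  then have "same_1jet A E q \<sigma> \<tau>" using * by (auto simp: j1_def)
  then show "jet (\<psi> q) \<sigma> = jet (\<psi> q) \<tau>" using same_1jet_iff[OF assms] by simp
next
  assume *: "jet (\<psi> q) \<sigma> = jet (\<psi> q) \<tau>"
  then have "same_1jet A E q \<sigma> \<upsilon> \<longleftrightarrow> same_1jet A E q \<tau> \<upsilon>" if "\<upsilon> \<in> sections A E" for \<upsilon>
    using same_1jet_iff[OF assms(1) that assms(3,4)] same_1jet_iff[OF assms(2) that assms(3,4)] by simp
  then show "j1 A E \<sigma> q = j1 A E \<tau> q" by (auto simp: j1_def)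
qed

text \<open>\<open>J1_triv\<close> picks some representative of the class, and all of them have the
  same jet in coordinates.\<close>

lemma J1_triv_j1:
  assumes "\<sigma> \<in> sections A E" "q \<in> D" "q \<in> V"
  shows "J1_triv (D, \<psi>) \<phi> q (j1 A E \<sigma> q) = jet (\<psi> q) \<sigma>"
proof -
  let ?\<tau> = "SOME \<tau>. \<tau> \<in> j1 A E \<sigma> q"
  have "\<sigma> \<in> j1 A E \<sigma> q" using assms by (auto simp: j1_def same_1jet_def)
  then have "?\<tau> \<in> j1 A E \<sigma> q" by (rule someI[of "\<lambda>\<tau>. \<tau> \<in> j1 A E \<sigma> q"])
  then have \<tau>: "?\<tau> \<in> sections A E" "same_1jet A E q \<sigma> ?\<tau>" by (auto simp: j1_def)
  have "J1_triv (D, \<psi>) \<phi> q (j1 A E \<sigma> q) = jet (\<psi> q) ?\<tau>"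
    by (simp add: J1_triv_def jet_def rep_def Let_def)
  then show ?thesis using \<tau>(2) same_1jet_iff[OF assms(1) \<tau>(1) assms(2,3)] by simp
qed

text \<open>The coefficients are constant; the derivatives of varying ones would enter the
  jet.\<close>

lemma jet_lincomb:
  assumes S: "\<And>i. i \<in> I \<Longrightarrow> S i \<in> sections A E" and x: "x \<in> \<Omega>"
  shows "jet x (lincomb I (\<lambda>i _. c i) S) = (\<Sum>i\<in>I. c i *\<^sub>R jet x (S i))"
proof -
  have L: "lincomb I (\<lambda>i _. c i) S \<in> sections A E"
    by (rule lincomb_section) (use S smooth_fun_const in auto)
  have rep: "rep (lincomb I (\<lambda>i _. c i) S) y = (\<Sum>i\<in>I. c i *\<^sub>R rep (S i) y)" if "y \<in> \<Omega>" for y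
    by (rule rep_lincomb[OF S that])
  have "((\<lambda>y. \<Sum>i\<in>I. c i *\<^sub>R rep (S i) y) has_derivative
      (\<lambda>v. \<Sum>i\<in>I. c i *\<^sub>R frechet_derivative (rep (S i)) (at x) v)) (at x)"
    by (intro has_derivative_sum has_derivative_scaleR_right rep_has_derivative S x)
  then have "(rep (lincomb I (\<lambda>i _. c i) S) has_derivative
      (\<lambda>v. \<Sum>i\<in>I. c i *\<^sub>R frechet_derivative (rep (S i)) (at x) v)) (at x)"
    by (rule has_derivative_transform_within_open[OF _ open_\<Omega> x]) (simp add: rep)
  then have der: "frechet_derivative (rep (lincomb I (\<lambda>i _. c i) S)) (at x) =
      (\<lambda>v. \<Sum>i\<in>I. c i *\<^sub>R frechet_derivative (rep (S i)) (at x) v)"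
    by (rule frechet_derivative_eqI)
  show ?thesis
  proof (rule prod_eqI)
    show "fst (jet x (lincomb I (\<lambda>i _. c i) S)) = fst (\<Sum>i\<in>I. c i *\<^sub>R jet x (S i))"
      by (simp add: fst_sum rep[OF x])
    show "snd (jet x (lincomb I (\<lambda>i _. c i) S)) = snd (\<Sum>i\<in>I. c i *\<^sub>R jet x (S i))"
    proof (rule blinfun_eqI)
      fix v
      have "blinfun_apply (snd (\<Sum>i\<in>I. c i *\<^sub>R jet x (S i))) v =
          (\<Sum>i\<in>I. c i *\<^sub>R blinfun_apply (snd (jet x (S i))) v)"
        by (simp add: snd_sum blinfun.sum_left blinfun.scaleR_left)
      then show "blinfun_apply (snd (jet x (lincomb I (\<lambda>i _. c i) S))) v = blinfun_apply (snd (\<Sum>i\<in>I. c i *\<^sub>R jet x (S i))) v"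
        by (simp add: snd_jet[OF L x] der snd_jet[OF S x])
    qed
  qed
qed

lemma jet_sec_add:
  assumes "\<sigma> \<in> sections A E" "\<tau> \<in> sections A E" "x \<in> \<Omega>"
  shows "jet x (sec_add E \<sigma> \<tau>) = jet x \<sigma> + jet x \<tau>"
proof -
  \<comment> \<open>A combination indexed by the two booleans reduces the sum to
    \<open>jet_lincomb\<close>.\<close>
  have "sec_add E \<sigma> \<tau> = lincomb UNIV (\<lambda>_ _. 1) (\<lambda>b. if b then \<sigma> else \<tau>)"
  proof
    fix q
    obtain V \<phi> where t: "(V, \<phi>) \<in> trivs E" "q \<in> V" by (rule triv_cover)
    have "\<phi> q (lincomb UNIV (\<lambda>_ _. 1) (\<lambda>b. if b then \<sigma> else \<tau>) q) = \<phi> q \<sigma>q + \<phi> q \<tau>q"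
      if "\<sigma>q = \<sigma> q" "\<tau>q = \<tau> q" for \<sigma>q \<tau>q
      using assms that by (subst triv_lincomb_sections[OF t]) (auto simp: UNIV_bool add.commute)
    then show "sec_add E \<sigma> \<tau> q = lincomb UNIV (\<lambda>_ _. 1) (\<lambda>b. if b then \<sigma> else \<tau>) q"
      using triv_vadd[OF t] assms section_fibre
      by (intro triv_eqI[OF t]) (simp_all add: sec_add_def)
  qed
  then show ?thesis
    using assms by (simp only:) (subst jet_lincomb; auto simp: UNIV_bool add.commute)
qed

lemma jet_sec_mult:
  assumes "\<sigma> \<in> sections A E" "x \<in> \<Omega>"
  shows "jet x (sec_mult E (\<lambda>_. c) \<sigma>) = c *\<^sub>R jet x \<sigma>"
proof -
  have "sec_mult E (\<lambda>_. c) \<sigma> = lincomb {()} (\<lambda>_ _. c) (\<lambda>_. \<sigma>)"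
  proof
    fix q
    obtain V \<phi> where t: "(V, \<phi>) \<in> trivs E" "q \<in> V" by (rule triv_cover)
    show "sec_mult E (\<lambda>_. c) \<sigma> q = lincomb {()} (\<lambda>_ _. c) (\<lambda>_. \<sigma>) q"
      using triv_vscale[OF t] triv_lincomb_sections[OF t, of "{()}" "\<lambda>_. \<sigma>" "\<lambda>_ _. c"] assms section_fibre
      by (intro triv_eqI[OF t]) (simp_all add: sec_mult_def)
  qed
  then show ?thesis
    using jet_lincomb[of "{()}" "\<lambda>_. \<sigma>" x "\<lambda>_. c"] assms by simp
qed

lemma jet_smooth: "\<sigma> \<in> sections A E \<Longrightarrow> smooth_on \<Omega> (\<lambda>x. jet x \<sigma>)"
  unfolding jet_def
  by (intro smooth_on_Pair open_\<Omega> smooth_on_Blinfun_derivative fin_dim_model rep_smooth)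

text \<open>An affine map in coordinates has the prescribed value and derivative.\<close>

lemma jet_surj:
  assumes x: "x \<in> \<Omega>"
  obtains \<sigma> where "\<sigma> \<in> sections A E" "jet x \<sigma> = p"
proof -
  obtain a L where p: "p = (a, L)" by (cases p)
  define s where "s y = a + blinfun_apply L (y - x)" for y
  have s: "smooth_on \<Omega> s"
    unfolding s_def
    by (intro smooth_on_add smooth_on_bounded_linear[OF blinfun.bounded_linear_right] smooth_on_diff open_\<Omega>) auto
  obtain \<sigma> W' where \<sigma>: "\<sigma> \<in> sections A E" "open W'" "x \<in> W'" "W' \<subseteq> \<Omega>" "\<And>x. x \<in> W' \<Longrightarrow> rep \<sigma> x = s x"
    by (rule section_extension[OF open_\<Omega> subset_refl x s], rule that) simp_all
  have "(s has_derivative blinfun_apply L) (at x)"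
    unfolding s_def
    by (auto intro!: derivative_eq_intros bounded_linear.has_derivative[OF blinfun.bounded_linear_right])
  then have "(rep \<sigma> has_derivative blinfun_apply L) (at x)"
    by (rule has_derivative_transform_within_open[OF _ \<sigma>(2,3)]) (simp add: \<sigma>(5))
  then have "jet x \<sigma> = p"
    unfolding p jet_def by (simp add: frechet_derivative_eqI blinfun_apply_inverse \<sigma>(3,5)) (simp add: s_def)
  then show ?thesis using \<sigma>(1) that by blast
qed

lemma J1_triv_mem: "(D \<inter> V, J1_triv (D, \<psi>) \<phi>) \<in> trivs (J1 A E)"
  using chart_A triv_E by (force simp: J1_def)

lemma jet_proj_j1: "\<sigma> \<in> sections A E \<Longrightarrow> jet_proj q (j1 A E \<sigma> q) = \<sigma> q"
  unfolding jet_proj_def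
  by (rule the_equality) (auto simp: j1_def same_1jet_def)

text \<open>Jets that agree in one chart agree in the other, so the change of coordinates is well
  defined and injective; it is linear because \<open>jet\<close> is linear in both charts. The
  argument rests on jets alone, since for \<open>J1 A t\<close> in place of \<open>E\<close> the
  target \<open>J1 A (J1 A t)\<close> is not known to be a vector bundle.\<close>

lemma jet_coord_iso:
  assumes q: "q \<in> D" "q \<in> V"
  obtains T where "linear T" "inj T"
    "\<And>\<sigma>. \<sigma> \<in> sections A E \<Longrightarrow> coord (J1 A E) q (j1 A E \<sigma> q) = T (jet (\<psi> q) \<sigma>)"
proof -
  have "\<exists>\<phi>m. \<exists>U \<phi>. (U, \<phi>) \<in> trivs (J1 A E) \<and> q \<in> U \<and> \<phi>m = \<phi> q"
    using J1_triv_mem q by blast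
  from someI_ex[OF this] obtain D' \<psi>' V' \<phi>' where c':
    "(D', \<psi>') \<in> A" "(V', \<phi>') \<in> trivs E" "q \<in> D'" "q \<in> V'" "coord (J1 A E) q = J1_triv (D', \<psi>') \<phi>' q"
    unfolding coord_def by (auto simp: J1_def)
  interpret o: triv_chart A E D' \<psi>' V' \<phi>' by unfold_locales (use c' in auto)
  have x: "\<psi> q \<in> \<Omega>" "\<psi>' q \<in> o.\<Omega>" using \<kappa>_inv q o.\<kappa>_inv c' by auto
  define sel where "sel p = (SOME \<sigma>. \<sigma> \<in> sections A E \<and> jet (\<psi> q) \<sigma> = p)" for p
  have "\<exists>\<sigma>. \<sigma> \<in> sections A E \<and> jet (\<psi> q) \<sigma> = p" for p
    by (rule jet_surj[OF x(1), of p]) blast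
  from someI_ex[OF this] have "sel p \<in> sections A E \<and> jet (\<psi> q) (sel p) = p" for p
    unfolding sel_def .
  then have sel: "sel p \<in> sections A E" "jet (\<psi> q) (sel p) = p" for p by auto
  have iff: "o.jet (\<psi>' q) \<sigma> = o.jet (\<psi>' q) \<tau> \<longleftrightarrow> jet (\<psi> q) \<sigma> = jet (\<psi> q) \<tau>"
    if "\<sigma> \<in> sections A E" "\<tau> \<in> sections A E" for \<sigma> \<tau>
    using j1_eq_iff[OF that q] o.j1_eq_iff[OF that c'(3,4)] by simp
  define T where "T p = o.jet (\<psi>' q) (sel p)" for p
  have T: "T (jet (\<psi> q) \<sigma>) = o.jet (\<psi>' q) \<sigma>" if "\<sigma> \<in> sections A E" for \<sigma>
    unfolding T_def using iff[OF sel(1) that] sel(2) by simp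
  show ?thesis
  proof (rule that[of T])
    show "linear T"
    proof (rule linearI)
      show "T (p + p') = T p + T p'" for p p'
        using T[of "sec_add E (sel p) (sel p')"] sel x sec_add_section
        by (simp add: jet_sec_add o.jet_sec_add) (simp add: T_def)
      show "T (c *\<^sub>R p) = c *\<^sub>R T p" for c p
      proof -
        have "(\<lambda>_. c) \<in> Cinf A" using smooth_fun_const by simp
        from T[OF sec_mult_section[OF this sel(1)[of p]]] sel x show ?thesis
          by (simp add: jet_sec_mult o.jet_sec_mult) (simp add: T_def)
      qed
    qed
    show "inj T" by (rule injI) (metis T_def iff sel)
    show "coord (J1 A E) q (j1 A E \<sigma> q) = T (jet (\<psi> q) \<sigma>)" if "\<sigma> \<in> sections A E" for \<sigma>
      using T[OF that] o.J1_triv_j1[OF that c'(3,4)] c'(5) by simp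
  qed
qed

end

text \<open>In the trivialisation of \<open>J1 A E\<close> that a chart induces, the section becomes
  the smooth map \<open>jet\<close>, and \<open>smooth_section_local\<close> asks for one
  trivialisation per point.\<close>

lemma (in vbundle) j1_section:
  assumes vb: "vector_bundle A (J1 A E)" and W: "W \<in> sections A E"
  shows "j1 A E W \<in> sections A (J1 A E)"
proof -
  interpret J: vbundle A "J1 A E" by unfold_locales (rule vb)
  have "smooth_section A (J1 A E) UNIV (j1 A E W)"
  proof (rule J.smooth_section_local)
    show "j1 A E W q \<in> fibre (J1 A E) q" for q using W by (simp add: J1_def)
    fix q
    obtain D \<psi> where c: "(D, \<psi>) \<in> A" "q \<in> D" by (rule chart_cover)
    obtain V \<phi> where t: "(V, \<phi>) \<in> trivs E" "q \<in> V" by (rule triv_cover)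
    interpret tc: triv_chart A E D \<psi> V \<phi> by unfold_locales (use c t in auto)
    have opn: "open (D \<inter> V)" using chart_domain_open[OF c(1)] triv_open[OF t(1)] by auto
    have "smooth_fun A (D \<inter> V) (\<lambda>q. J1_triv (D, \<psi>) \<phi> q (j1 A E W q))"
    proof (rule smooth_fun_chartI[OF c(1) opn])
      show "smooth_on (\<psi> ` (D \<inter> V)) (\<lambda>x. J1_triv (D, \<psi>) \<phi> (inv_into D \<psi> x) (j1 A E W (inv_into D \<psi> x)))"
        by (rule smooth_on_cong[OF tc.open_\<Omega>[unfolded tc.\<Omega>_def] _ tc.jet_smooth[OF W, unfolded tc.\<Omega>_def]])
           (auto simp: tc.J1_triv_j1[OF W] chart_inv[OF c(1)])
    qed simp
    then show "\<exists>W' V \<phi>. open W' \<and> q \<in> W' \<and> (V, \<phi>) \<in> trivs (J1 A E) \<and> W' \<subseteq> V \<inter> UNIV \<and>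
        smooth_fun A W' (\<lambda>q. \<phi> q (j1 A E W q))"
      using opn c(2) t(2) tc.J1_triv_mem by blast
  qed
  then show ?thesis by (simp add: sections_def)
qed

section \<open>Brackets of jets\<close>

locale lie_chart = triv_chart A E D \<psi> V \<phi>
  for A :: "('m::{t2_space,second_countable_topology}, 'e::real_inner) chart set"
    and E :: "('m, 'v, 'f::real_normed_vector) vbundle" and D \<psi> V \<phi> +
  fixes \<rho> :: "'m \<Rightarrow> 'v \<Rightarrow> ('m \<Rightarrow> real) \<Rightarrow> real" and br :: "('m \<Rightarrow> 'v) \<Rightarrow> ('m \<Rightarrow> 'v) \<Rightarrow> 'm \<Rightarrow> 'v"
  assumes lie: "lie_algebroid A E \<rho> br"
begin

lemma anchor_tangent: "v \<in> fibre E q \<Longrightarrow> tangent_vector A q (\<rho> q v)"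
  using lie by (simp add: lie_algebroid_def)

lemma anchor_add:
  "v \<in> fibre E q \<Longrightarrow> w \<in> fibre E q \<Longrightarrow> f \<in> Cinf A \<Longrightarrow> \<rho> q (vadd E q v w) f = \<rho> q v f + \<rho> q w f"
  using lie by (simp add: lie_algebroid_def)

lemma anchor_scale:
  "v \<in> fibre E q \<Longrightarrow> f \<in> Cinf A \<Longrightarrow> \<rho> q (vscale E q c v) f = c * \<rho> q v f"
  using lie by (simp add: lie_algebroid_def)

definition anc :: "('m \<Rightarrow> 'v) \<Rightarrow> ('m \<Rightarrow> real) \<Rightarrow> 'm \<Rightarrow> real" where
  "anc X f = (\<lambda>q. \<rho> q (X q) f)"

lemma anc_smooth: "X \<in> sections A E \<Longrightarrow> f \<in> Cinf A \<Longrightarrow> anc X f \<in> Cinf A"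
  using lie unfolding lie_algebroid_def anc_def by blast

lemma br_section: "X \<in> sections A E \<Longrightarrow> Y \<in> sections A E \<Longrightarrow> br X Y \<in> sections A E"
  using lie unfolding lie_algebroid_def by blast

lemma br_add:
  "X \<in> sections A E \<Longrightarrow> Y \<in> sections A E \<Longrightarrow> Z \<in> sections A E \<Longrightarrow>
    br X (sec_add E Y Z) = sec_add E (br X Y) (br X Z)"
  using lie unfolding lie_algebroid_def by blast

lemma br_scale:
  "X \<in> sections A E \<Longrightarrow> Y \<in> sections A E \<Longrightarrow> br X (sec_mult E (\<lambda>_. c) Y) = sec_mult E (\<lambda>_. c) (br X Y)"
  using lie unfolding lie_algebroid_def by blast

lemma br_antisym:
  "X \<in> sections A E \<Longrightarrow> Y \<in> sections A E \<Longrightarrow> br Y X = sec_mult E (\<lambda>_. -1) (br X Y)"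
  using lie unfolding lie_algebroid_def by blast

lemma br_leibniz:
  "X \<in> sections A E \<Longrightarrow> Y \<in> sections A E \<Longrightarrow> f \<in> Cinf A \<Longrightarrow>
    br X (sec_mult E f Y) = sec_add E (sec_mult E f (br X Y)) (sec_mult E (anc X f) Y)"
  using lie unfolding lie_algebroid_def anc_def by blast

lemma function_differentiable:
  "f \<in> Cinf A \<Longrightarrow> x \<in> \<Omega> \<Longrightarrow> ((\<lambda>y. f (\<kappa> y)) has_derivative frechet_derivative (\<lambda>y. f (\<kappa> y)) (at x)) (at x)"
  by (rule smooth_on_has_derivative[OF function_smooth])

text \<open>\<open>tangent_vector\<close> provides a chart of its own; the derivative of the
  transition map \<open>k\<close> moves its direction to the present chart.\<close>

lemma anchor_direction:
  assumes x: "x \<in> \<Omega>" and v: "v \<in> fibre E (\<kappa> x)"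
  obtains \<tau> where "\<And>f. f \<in> Cinf A \<Longrightarrow> \<rho> (\<kappa> x) v f = frechet_derivative (\<lambda>y. f (\<kappa> y)) (at x) \<tau>"
proof -
  let ?q = "\<kappa> x"
  from anchor_tangent[OF v, unfolded tangent_vector_def] obtain c where "c \<in> A" and
    c: "case c of (S, \<psi>') \<Rightarrow> ?q \<in> S \<and>
      (\<exists>u. \<forall>f\<in>Cinf A. \<rho> ?q v f = frechet_derivative (f \<circ> inv_into S \<psi>') (at (\<psi>' ?q)) u)"
    by (rule bexE)
  moreover obtain D' \<psi>' where "c = (D', \<psi>')" by (cases c)
  ultimately have c': "(D', \<psi>') \<in> A" "?q \<in> D'"
    and "\<exists>u. \<forall>f\<in>Cinf A. \<rho> ?q v f = frechet_derivative (f \<circ> inv_into D' \<psi>') (at (\<psi>' ?q)) u"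
    by (simp_all only: prod.case)
  then obtain u where
    u: "\<forall>f\<in>Cinf A. \<rho> ?q v f = frechet_derivative (f \<circ> inv_into D' \<psi>') (at (\<psi>' ?q)) u"
    by (elim exE)
  have q: "?q \<in> D" "?q \<in> V" "\<psi> ?q = x" using x by (simp_all add: \<kappa>_inv)
  define S where "S = \<psi>' ` (D \<inter> V \<inter> D')"
  have S: "open S" unfolding S_def
    by (rule open_chart_image[OF c'(1)]) (use chart_domain_open[OF chart_A] triv_open[OF triv_E] in auto)
  have xS: "\<psi>' ?q \<in> S" using q c' by (auto simp: S_def)
  define k where "k y = \<psi> (inv_into D' \<psi>' y)" for y
  have k: "smooth_on S k" unfolding k_def
    by (rule smooth_on_subset[OF transition_smooth[OF c'(1) chart_A]]) (auto simp: S_def)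
  have kq: "k (\<psi>' ?q) = x" using q c' chart_inv(1)[OF c'(1)] by (simp add: k_def)
  have "\<rho> ?q v f = frechet_derivative (\<lambda>y. f (\<kappa> y)) (at x) (frechet_derivative k (at (\<psi>' ?q)) u)"
    if f: "f \<in> Cinf A" for f
  proof -
    have "((\<lambda>y. f (\<kappa> (k y))) has_derivative
       (\<lambda>v. frechet_derivative (\<lambda>y. f (\<kappa> y)) (at x) (frechet_derivative k (at (\<psi>' ?q)) v))) (at (\<psi>' ?q))"
      using diff_chain_at[OF smooth_on_has_derivative[OF k xS], of "\<lambda>y. f (\<kappa> y)"]
        function_differentiable[OF f x] kq by (simp add: o_def)
    then have "((f \<circ> inv_into D' \<psi>') has_derivative
       (\<lambda>v. frechet_derivative (\<lambda>y. f (\<kappa> y)) (at x) (frechet_derivative k (at (\<psi>' ?q)) v))) (at (\<psi>' ?q))"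
      by (rule has_derivative_transform_within_open[OF _ S xS])
         (auto simp: k_def S_def \<kappa>_inv chart_inv(1)[OF c'(1)])
    then show ?thesis using u f by (simp add: frechet_derivative_eqI)
  qed
  then show ?thesis using that by blast
qed

lemma anc_const:
  assumes "X \<in> sections A E" "x \<in> \<Omega>" shows "anc X (\<lambda>_. c) (\<kappa> x) = 0"
proof -
  obtain \<tau> where \<tau>: "\<And>f. f \<in> Cinf A \<Longrightarrow> \<rho> (\<kappa> x) (X (\<kappa> x)) f = frechet_derivative (\<lambda>y. f (\<kappa> y)) (at x) \<tau>"
    using anchor_direction[OF assms(2) section_fibre[OF assms(1)]] by blast
  have "(\<lambda>_. c) \<in> Cinf A" using smooth_fun_const by simp
  from \<tau>[OF this] show ?thesis by (simp add: anc_def)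
qed

lemma vscale_zero:
  assumes "v \<in> fibre E q" shows "vscale E q 0 v = vzero E q"
proof -
  obtain V \<phi> where t: "(V, \<phi>) \<in> trivs E" "q \<in> V" by (rule triv_cover)
  show ?thesis
    by (rule triv_eqI[OF t]) (simp_all add: triv_vscale[OF t assms] triv_vzero[OF t])
qed

lemma anc_lincomb:
  assumes I: "finite I" and S: "\<And>i. i \<in> I \<Longrightarrow> S i \<in> sections A E" and h: "h \<in> Cinf A"
  shows "anc (lincomb I f S) h q = (\<Sum>i\<in>I. f i q * anc (S i) h q)"
  using I S
proof (induction I)
  case empty
  have "\<rho> q (vscale E q 0 (vzero E q)) h = 0" using anchor_scale[OF fibre_operations(3) h, of q 0] by simp
  then show ?case by (simp add: anc_def lincomb_empty vscale_zero)
next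
  case (insert a I)
  have "lincomb (insert a I) f S = sec_add E (sec_mult E (f a) (S a)) (lincomb I f S)"
    by (rule lincomb_insert[OF insert.hyps insert.prems])
  then have "anc (lincomb (insert a I) f S) h q = f a q * anc (S a) h q + anc (lincomb I f S) h q"
    using insert.prems
    by (simp only: anc_def sec_add_def sec_mult_def anchor_add[OF fibre_operations(2) lincomb_fibre h]
          anchor_scale[OF section_fibre h] insertI1)
  then show ?case using insert by simp
qed

text \<open>A cutoff makes the two sections equal globally. By the Leibniz rule it adds to either
  bracket its derivative along \<open>T\<close> times the value of the section at the point, and
  these values agree.\<close>

lemma br_local:
  assumes T: "T \<in> sections A E" and X: "X \<in> sections A E" and Y: "Y \<in> sections A E"
    and W: "open W" "W \<subseteq> \<Omega>" "x \<in> W" and eq: "\<And>y. y \<in> W \<Longrightarrow> X (\<kappa> y) = Y (\<kappa> y)"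
  shows "br T X (\<kappa> x) = br T Y (\<kappa> x)"
proof -
  have x: "x \<in> \<Omega>" using W by blast
  obtain \<eta> W' K where \<eta>: "\<eta> \<in> Cinf A" "open W'" "x \<in> W'" "W' \<subseteq> W"
    "\<And>x. x \<in> W' \<Longrightarrow> \<eta> (\<kappa> x) = 1" "closed K" "K \<subseteq> D \<inter> \<psi> -` W" "\<And>q. q \<notin> K \<Longrightarrow> \<eta> q = 0"
    using bump_function[OF chart_A W(1) subset_trans[OF W(2) \<Omega>_sub] W(3), folded \<kappa>_def] by blast
  have "sec_mult E \<eta> X = sec_mult E \<eta> Y"
  proof
    fix q
    show "sec_mult E \<eta> X q = sec_mult E \<eta> Y q"
    proof (cases "q \<in> K")
      case True
      then have "q \<in> D" "\<psi> q \<in> W" using \<eta>(7) by auto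
      then have "X q = Y q" using eq[of "\<psi> q"] by (simp add: \<kappa>_inv)
      then show ?thesis by (simp add: sec_mult_def)
    next
      case False
      then show ?thesis using \<eta>(8) X Y by (simp add: sec_mult_def vscale_zero section_fibre)
    qed
  qed
  then have "rep (br T (sec_mult E \<eta> X)) x = rep (br T (sec_mult E \<eta> Y)) x" by simp
  moreover have "rep (br T (sec_mult E \<eta> Z)) x = rep (br T Z) x + anc T \<eta> (\<kappa> x) *\<^sub>R rep Z x"
    if Z: "Z \<in> sections A E" for Z
    using br_leibniz[OF T Z \<eta>(1)] \<eta>(5)[OF \<eta>(3)]
      rep_add[OF sec_mult_section[OF \<eta>(1) br_section[OF T Z]] sec_mult_section[OF anc_smooth[OF T \<eta>(1)] Z] x]
      rep_mult[OF br_section[OF T Z] br_section[OF T Z] x, of \<eta>] rep_mult[OF Z Z x, of "anc T \<eta>"] by simp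
  moreover have "rep X x = rep Y x" using eq[OF W(3)] by (simp add: rep_eq)
  ultimately have "rep (br T X) x = rep (br T Y) x" using X Y by simp
  then show ?thesis using rep_eq_iff[OF br_section[OF T X] br_section[OF T Y] x] by simp
qed

lemma br_lincomb:
  assumes T: "T \<in> sections A E" and I: "finite I" and f: "\<And>i. i \<in> I \<Longrightarrow> f i \<in> Cinf A"
    and S: "\<And>i. i \<in> I \<Longrightarrow> S i \<in> sections A E" and x: "x \<in> \<Omega>"
  shows "rep (br T (lincomb I f S)) x =
    (\<Sum>i\<in>I. f i (\<kappa> x) *\<^sub>R rep (br T (S i)) x + anc T (f i) (\<kappa> x) *\<^sub>R rep (S i) x)"
  using I f S
proof (induction I)
  case empty
  \<comment> \<open>The zero section is 0 times \<open>T\<close>, so \<open>br_scale\<close> applies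
    to it.\<close>
  have "lincomb {} f S = sec_mult E (\<lambda>_. 0) T"
    using vscale_zero[OF section_fibre[OF T]] by (auto simp: lincomb_empty sec_mult_def)
  then have "br T (lincomb {} f S) = sec_mult E (\<lambda>_. 0) (br T T)" using br_scale[OF T T] by simp
  then show ?case using rep_mult[OF br_section[OF T T] br_section[OF T T] x] by simp
next
  case (insert a I)
  then have fa: "f a \<in> Cinf A" and Sa: "S a \<in> sections A E" and L: "lincomb I f S \<in> sections A E"
    using lincomb_section[of I f S] by auto
  note bS = br_section[OF T Sa]
  have "lincomb (insert a I) f S = sec_add E (sec_mult E (f a) (S a)) (lincomb I f S)"
    by (rule lincomb_insert[OF insert.hyps insert.prems(2)])
  then have "br T (lincomb (insert a I) f S) = sec_add E (br T (sec_mult E (f a) (S a))) (br T (lincomb I f S))"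
    using br_add[OF T sec_mult_section[OF fa Sa] L] by simp
  then have "rep (br T (lincomb (insert a I) f S)) x =
      rep (br T (sec_mult E (f a) (S a))) x + rep (br T (lincomb I f S)) x"
    using rep_add[OF br_section[OF T sec_mult_section[OF fa Sa]] br_section[OF T L] x] by simp
  also have "rep (br T (sec_mult E (f a) (S a))) x =
      f a (\<kappa> x) *\<^sub>R rep (br T (S a)) x + anc T (f a) (\<kappa> x) *\<^sub>R rep (S a) x"
    unfolding br_leibniz[OF T Sa fa]
    using rep_add[OF sec_mult_section[OF fa bS] sec_mult_section[OF anc_smooth[OF T fa] Sa] x]
      rep_mult[OF bS bS x] rep_mult[OF Sa Sa x] by simp
  finally show ?case using insert by simp
qed

lemma function_extension_family:
  fixes f :: "'i \<Rightarrow> 'e \<Rightarrow> real"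
  assumes I: "finite I" and W: "open W" "W \<subseteq> \<Omega>" "x0 \<in> W" and f: "\<And>i. i \<in> I \<Longrightarrow> smooth_on W (f i)"
  obtains F W' where "\<And>i. i \<in> I \<Longrightarrow> F i \<in> Cinf A" "open W'" "x0 \<in> W'" "W' \<subseteq> W"
    "\<And>i x. i \<in> I \<Longrightarrow> x \<in> W' \<Longrightarrow> F i (\<kappa> x) = f i x"
proof -
  have "\<exists>F W'. (\<forall>i\<in>I. F i \<in> Cinf A) \<and> open W' \<and> x0 \<in> W' \<and> W' \<subseteq> W \<and> (\<forall>i\<in>I. \<forall>x\<in>W'. F i (\<kappa> x) = f i x)"
    using I f
  proof (induction I)
    case empty
    then show ?case using W by auto
  next
    case (insert a I)
    then obtain F W' where F: "\<forall>i\<in>I. F i \<in> Cinf A" "open W'" "x0 \<in> W'" "W' \<subseteq> W"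
      "\<forall>i\<in>I. \<forall>x\<in>W'. F i (\<kappa> x) = f i x" by auto
    obtain G W'' where G: "G \<in> Cinf A" "open W''" "x0 \<in> W''" "W'' \<subseteq> W" "\<And>x. x \<in> W'' \<Longrightarrow> G (\<kappa> x) = f a x"
      using function_extension[OF W, of "f a"] insert.prems by blast
    show ?case
      using F G insert.hyps by (intro exI[of _ "F(a := G)"] exI[of _ "W' \<inter> W''"]) auto
  qed
  then show ?thesis using that by blast
qed

lemma section_extension_family:
  assumes I: "finite I" and W: "open W" "W \<subseteq> \<Omega>" "x0 \<in> W" and s: "\<And>i. i \<in> I \<Longrightarrow> smooth_on W (s i)"
  obtains S W' where "\<And>i. i \<in> I \<Longrightarrow> S i \<in> sections A E" "open W'" "x0 \<in> W'" "W' \<subseteq> W"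
    "\<And>i x. i \<in> I \<Longrightarrow> x \<in> W' \<Longrightarrow> rep (S i) x = s i x"
proof -
  have "\<exists>S W'. (\<forall>i\<in>I. S i \<in> sections A E) \<and> open W' \<and> x0 \<in> W' \<and> W' \<subseteq> W \<and> (\<forall>i\<in>I. \<forall>x\<in>W'. rep (S i) x = s i x)"
    using I s
  proof (induction I)
    case empty
    then show ?case using W by auto
  next
    case (insert a I)
    then obtain F W' where F: "\<forall>i\<in>I. F i \<in> sections A E" "open W'" "x0 \<in> W'" "W' \<subseteq> W"
      "\<forall>i\<in>I. \<forall>x\<in>W'. rep (F i) x = s i x" by auto
    have "smooth_on W (s a)" using insert.prems by simp
    from section_extension[OF W this]
    obtain G W'' where G: "G \<in> sections A E" "open W''" "x0 \<in> W''" "W'' \<subseteq> W" "\<forall>x\<in>W''. rep G x = s a x"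
      by (metis (no_types, lifting))
    show ?case
      using F G insert.hyps by (intro exI[of _ "F(a := G)"] exI[of _ "W' \<inter> W''"]) auto
  qed
  then show ?thesis using that by blast
qed

text \<open>In coordinates \<open>anc T h\<close> is the sum of the components of the anchor times
  the partial derivatives of \<open>h\<close>. The latter vanish at \<open>x0\<close>, so only the
  value of the anchor there enters, not its variation.\<close>

lemma anc_derivative:
  assumes T: "T \<in> sections A E" and x0: "x0 \<in> \<Omega>"
    and \<tau>: "\<And>f. f \<in> Cinf A \<Longrightarrow> \<rho> (\<kappa> x0) (T (\<kappa> x0)) f = frechet_derivative (\<lambda>y. f (\<kappa> y)) (at x0) \<tau>"
    and h: "h \<in> Cinf A" "frechet_derivative (\<lambda>y. h (\<kappa> y)) (at x0) = (\<lambda>_. 0)"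
  shows "((\<lambda>x. anc T h (\<kappa> x)) has_derivative
    (\<lambda>w. frechet_derivative (\<lambda>y. frechet_derivative (\<lambda>y. h (\<kappa> y)) (at y) w) (at x0) \<tau>)) (at x0)"
proof -
  obtain B and \<beta> :: "'e \<Rightarrow> 'e \<Rightarrow> real" where B: "finite B" "\<And>b. bounded_linear (\<beta> b)"
    "\<And>x. x = (\<Sum>b\<in>B. \<beta> b x *\<^sub>R b)"
    using fin_dim_coordinates[OF fin_dim_model] by metis
  have sm\<beta>: "\<And>b. b \<in> B \<Longrightarrow> smooth_on \<Omega> (\<beta> b)" by (rule smooth_on_linear[OF B(2) open_\<Omega>])
  \<comment> \<open>The anchor acts on global functions only. Coordinate functions extended to the
    manifold give its components as \<open>anc T (Y b)\<close>, which depend smoothly on the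
    point.\<close>
  obtain Y W where Y: "\<And>b. b \<in> B \<Longrightarrow> Y b \<in> Cinf A" and W: "open W" "x0 \<in> W" "W \<subseteq> \<Omega>"
    and YW: "\<And>b x. b \<in> B \<Longrightarrow> x \<in> W \<Longrightarrow> Y b (\<kappa> x) = \<beta> b x"
    by (rule function_extension_family[OF B(1) open_\<Omega> subset_refl x0 sm\<beta>], assumption, rule that) simp_all
  let ?h = "\<lambda>y. h (\<kappa> y)"
  let ?D = "\<lambda>x w. frechet_derivative ?h (at x) w"
  have smh: "smooth_on \<Omega> ?h" by (rule function_smooth[OF h(1)])
  have dY: "frechet_derivative (\<lambda>y. Y b (\<kappa> y)) (at x) = \<beta> b" if "b \<in> B" "x \<in> W" for b x
  proof -
    have "(\<beta> b has_derivative \<beta> b) (at x)" by (rule bounded_linear_imp_has_derivative[OF B(2)])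
    then have "((\<lambda>y. Y b (\<kappa> y)) has_derivative \<beta> b) (at x)"
      by (rule has_derivative_transform_within_open[OF _ W(1) that(2)]) (simp add: YW that)
    then show ?thesis by (rule frechet_derivative_eqI)
  qed
  have anc_eq: "anc T h (\<kappa> x) = (\<Sum>b\<in>B. anc T (Y b) (\<kappa> x) * ?D x b)" if x: "x \<in> W" for x
  proof -
    have x\<Omega>: "x \<in> \<Omega>" using x W by blast
    obtain t where t: "\<And>f. f \<in> Cinf A \<Longrightarrow> \<rho> (\<kappa> x) (T (\<kappa> x)) f = frechet_derivative (\<lambda>y. f (\<kappa> y)) (at x) t"
      using anchor_direction[OF x\<Omega> section_fibre[OF T]] by blast
    have "anc T h (\<kappa> x) = ?D x t" using t[OF h(1)] by (simp add: anc_def)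
    also have "\<dots> = (\<Sum>b\<in>B. \<beta> b t *\<^sub>R ?D x b)"
      by (rule linear_eq_coordinates[OF bounded_linear.linear[OF smooth_on_linear_derivative[OF smh x\<Omega>]] B(1,3)])
    also have "\<dots> = (\<Sum>b\<in>B. anc T (Y b) (\<kappa> x) * ?D x b)"
      by (intro sum.cong) (simp_all add: anc_def t[OF Y] dY x)
    finally show ?thesis .
  qed
  have ancY: "anc T (Y b) (\<kappa> x0) = \<beta> b \<tau>" if "b \<in> B" for b
    using \<tau>[OF Y[OF that]] dY[OF that W(2)] by (simp add: anc_def)
  have smD: "smooth_on \<Omega> (\<lambda>x. ?D x w)" for w by (rule smooth_on_derivative[OF smh])
  have der: "((\<lambda>x. anc T (Y b) (\<kappa> x) * ?D x b) has_derivative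
      (\<lambda>w. \<beta> b \<tau> *\<^sub>R frechet_derivative (\<lambda>y. ?D y w) (at x0) b)) (at x0)" if b: "b \<in> B" for b
  proof -
    have "((\<lambda>x. anc T (Y b) (\<kappa> x) * ?D x b) has_derivative
       (\<lambda>w. anc T (Y b) (\<kappa> x0) * frechet_derivative (\<lambda>y. ?D y b) (at x0) w +
            frechet_derivative (\<lambda>x. anc T (Y b) (\<kappa> x)) (at x0) w * ?D x0 b)) (at x0)"
      by (intro has_derivative_mult function_differentiable anc_smooth T Y b x0 smooth_on_has_derivative[OF smD])
    moreover have "frechet_derivative (\<lambda>y. ?D y b) (at x0) w = frechet_derivative (\<lambda>y. ?D y w) (at x0) b" for w
      by (rule second_derivative_symmetric_real[OF smh open_\<Omega> x0])
    ultimately show ?thesis using h(2) ancY[OF b] by simp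
  qed
  have "((\<lambda>x. \<Sum>b\<in>B. anc T (Y b) (\<kappa> x) * ?D x b) has_derivative
      (\<lambda>w. \<Sum>b\<in>B. \<beta> b \<tau> *\<^sub>R frechet_derivative (\<lambda>y. ?D y w) (at x0) b)) (at x0)"
    by (rule has_derivative_sum[OF der])
  moreover have "(\<Sum>b\<in>B. \<beta> b \<tau> *\<^sub>R frechet_derivative (\<lambda>y. ?D y w) (at x0) b) = frechet_derivative (\<lambda>y. ?D y w) (at x0) \<tau>" for w
    by (rule linear_eq_coordinates[OF bounded_linear.linear[OF smooth_on_linear_derivative[OF smD x0]] B(1,3), symmetric])
  ultimately have "((\<lambda>x. \<Sum>b\<in>B. anc T (Y b) (\<kappa> x) * ?D x b) has_derivative
      (\<lambda>w. frechet_derivative (\<lambda>y. ?D y w) (at x0) \<tau>)) (at x0)" by simp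
  then show ?thesis
    by (rule has_derivative_transform_within_open[OF _ W(1,2)]) (simp add: anc_eq)
qed

text \<open>Near \<open>x0\<close> the section \<open>X\<close> is a combination of the sections
  \<open>s b\<close>, constant in coordinates, with coefficients \<open>v b\<close> that vanish to
  first order. In the Leibniz expansion the terms \<open>v b\<close> times \<open>br T (s b)\<close>
  contribute nothing to the 1-jet, and \<open>anc_derivative\<close> evaluates those with
  \<open>anc T (v b)\<close>.\<close>

lemma br_vanishing_jet:
  assumes T: "T \<in> sections A E" and X: "X \<in> sections A E" and x0: "x0 \<in> \<Omega>" and j0: "jet x0 X = 0"
    and \<tau>: "\<And>f. f \<in> Cinf A \<Longrightarrow> \<rho> (\<kappa> x0) (T (\<kappa> x0)) f = frechet_derivative (\<lambda>y. f (\<kappa> y)) (at x0) \<tau>"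
  shows "rep (br T X) x0 = 0"
    and "frechet_derivative (rep (br T X)) (at x0) w =
      frechet_derivative (\<lambda>y. frechet_derivative (rep X) (at y) w) (at x0) \<tau>"
proof -
  obtain B and \<beta> :: "'f \<Rightarrow> 'f \<Rightarrow> real" where B: "finite B" "\<And>b. bounded_linear (\<beta> b)"
    "\<And>x. x = (\<Sum>b\<in>B. \<beta> b x *\<^sub>R b)"
    using fin_dim_coordinates[OF fin_dim_fibre] by metis
  have smX: "smooth_on \<Omega> (rep X)" by (rule rep_smooth[OF X])
  have X0: "rep X x0 = 0" "frechet_derivative (rep X) (at x0) = (\<lambda>_. 0)"
    using j0 fst_jet[of x0 X] snd_jet[OF X x0] by (simp_all add: fun_eq_iff)
  obtain v W where v: "\<And>b. b \<in> B \<Longrightarrow> v b \<in> Cinf A" and W: "open W" "x0 \<in> W" "W \<subseteq> \<Omega>"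
    and vW: "\<And>b x. b \<in> B \<Longrightarrow> x \<in> W \<Longrightarrow> v b (\<kappa> x) = \<beta> b (rep X x)"
    by (rule function_extension_family[OF B(1) open_\<Omega> subset_refl x0 smooth_on_bounded_linear[OF B(2) open_\<Omega> smX]],
        rule that) simp_all
  obtain s W' where s: "\<And>b. b \<in> B \<Longrightarrow> s b \<in> sections A E" and W': "open W'" "x0 \<in> W'" "W' \<subseteq> W"
    and sW: "\<And>b x. b \<in> B \<Longrightarrow> x \<in> W' \<Longrightarrow> rep (s b) x = b"
    by (rule section_extension_family[OF B(1) W(1,3,2), of "\<lambda>b _. b"], simp, rule that) simp_all
  have W'\<Omega>: "W' \<subseteq> \<Omega>" using W' W by blast
  have L: "lincomb B v s \<in> sections A E" by (rule lincomb_section[OF v s])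
  have "rep X x = rep (lincomb B v s) x" if "x \<in> W'" for x
  proof -
    have x: "x \<in> \<Omega>" "x \<in> W" using that W'\<Omega> W' by auto
    have "rep X x = (\<Sum>b\<in>B. \<beta> b (rep X x) *\<^sub>R b)" by (rule B(3))
    also have "\<dots> = (\<Sum>b\<in>B. v b (\<kappa> x) *\<^sub>R rep (s b) x)"
      using that x by (intro sum.cong) (simp_all add: vW sW)
    also have "\<dots> = rep (lincomb B v s) x" by (rule rep_lincomb[OF s x(1), symmetric])
    finally show ?thesis .
  qed
  then have XL: "X (\<kappa> x) = lincomb B v s (\<kappa> x)" if "x \<in> W'" for x
    using rep_eq_iff[OF X L, of x] W'\<Omega> that by auto
  have rbr: "rep (br T X) x = (\<Sum>b\<in>B. v b (\<kappa> x) *\<^sub>R rep (br T (s b)) x + anc T (v b) (\<kappa> x) *\<^sub>R b)" if x: "x \<in> W'" for x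
  proof -
    have "rep (br T X) x = rep (br T (lincomb B v s)) x"
      using br_local[OF T X L W'(1) W'\<Omega> x XL] by (simp add: rep_eq)
    also have "\<dots> = (\<Sum>b\<in>B. v b (\<kappa> x) *\<^sub>R rep (br T (s b)) x + anc T (v b) (\<kappa> x) *\<^sub>R rep (s b) x)"
      by (rule br_lincomb[OF T B(1) v s]) (use x W'\<Omega> in auto)
    finally show ?thesis using sW[OF _ x] by simp
  qed
  have dv: "frechet_derivative (\<lambda>y. v b (\<kappa> y)) (at x) = (\<lambda>w. \<beta> b (frechet_derivative (rep X) (at x) w))"
    if "b \<in> B" "x \<in> W" for b x
  proof -
    have "frechet_derivative (\<lambda>y. v b (\<kappa> y)) (at x) = frechet_derivative (\<lambda>y. \<beta> b (rep X y)) (at x)"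
      by (rule frechet_derivative_cong_open[OF W(1) that(2)]) (simp add: vW that)
    also have "\<dots> = (\<lambda>w. \<beta> b (frechet_derivative (rep X) (at x) w))"
      by (rule frechet_derivative_bounded_linear[OF B(2) smooth_on_differentiable[OF smX]]) (use that W in auto)
    finally show ?thesis .
  qed
  have \<beta>0: "\<beta> b 0 = 0" for b using linear_0[OF bounded_linear.linear[OF B(2)]] .
  have v0: "v b (\<kappa> x0) = 0" "frechet_derivative (\<lambda>y. v b (\<kappa> y)) (at x0) = (\<lambda>_. 0)" if "b \<in> B" for b
    using vW[OF that W(2)] dv[OF that W(2)] X0 \<beta>0 by simp_all
  have "anc T (v b) (\<kappa> x0) = 0" if "b \<in> B" for b
    using \<tau>[OF v[OF that]] v0(2)[OF that] by (simp add: anc_def)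
  then show "rep (br T X) x0 = 0" using rbr[OF W'(2)] v0(1) by simp
  let ?D = "\<lambda>w. frechet_derivative (\<lambda>y. frechet_derivative (rep X) (at y) w) (at x0) \<tau>"
  have smD: "smooth_on \<Omega> (\<lambda>y. frechet_derivative (rep X) (at y) w)" for w
    by (rule smooth_on_derivative[OF smX])
  have d2v: "frechet_derivative (\<lambda>y. frechet_derivative (\<lambda>y. v b (\<kappa> y)) (at y) w) (at x0) \<tau> = \<beta> b (?D w)"
    if "b \<in> B" for b w
  proof -
    have "frechet_derivative (\<lambda>y. frechet_derivative (\<lambda>y. v b (\<kappa> y)) (at y) w) (at x0) =
       frechet_derivative (\<lambda>y. \<beta> b (frechet_derivative (rep X) (at y) w)) (at x0)"
      by (rule frechet_derivative_cong_open[OF W(1,2)]) (simp add: dv that)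
    also have "\<dots> = (\<lambda>u. \<beta> b (frechet_derivative (\<lambda>y. frechet_derivative (rep X) (at y) w) (at x0) u))"
      by (rule frechet_derivative_bounded_linear[OF B(2) smooth_on_differentiable[OF smD x0]])
    finally show ?thesis by simp
  qed
  have summand: "((\<lambda>x. v b (\<kappa> x) *\<^sub>R rep (br T (s b)) x + anc T (v b) (\<kappa> x) *\<^sub>R b) has_derivative
      (\<lambda>w. \<beta> b (?D w) *\<^sub>R b)) (at x0)" if b: "b \<in> B" for b
  proof -
    have 1: "((\<lambda>x. v b (\<kappa> x) *\<^sub>R rep (br T (s b)) x) has_derivative
        (\<lambda>w. v b (\<kappa> x0) *\<^sub>R frechet_derivative (rep (br T (s b))) (at x0) w +
             frechet_derivative (\<lambda>y. v b (\<kappa> y)) (at x0) w *\<^sub>R rep (br T (s b)) x0)) (at x0)"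
      by (rule has_derivative_scaleR[OF function_differentiable[OF v[OF b] x0]
            rep_has_derivative[OF br_section[OF T s[OF b]] x0]])
    have 2: "((\<lambda>x. anc T (v b) (\<kappa> x) *\<^sub>R b) has_derivative (\<lambda>w. \<beta> b (?D w) *\<^sub>R b)) (at x0)"
      using has_derivative_scaleR_left[OF anc_derivative[OF T x0 \<tau> v[OF b] v0(2)[OF b]], of b]
      by (simp add: d2v[OF b])
    show ?thesis using has_derivative_add[OF 1 2] by (simp add: v0[OF b])
  qed
  have "((\<lambda>x. \<Sum>b\<in>B. v b (\<kappa> x) *\<^sub>R rep (br T (s b)) x + anc T (v b) (\<kappa> x) *\<^sub>R b) has_derivative
      (\<lambda>w. \<Sum>b\<in>B. \<beta> b (?D w) *\<^sub>R b)) (at x0)"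
    by (rule has_derivative_sum[OF summand])
  then have "((\<lambda>x. \<Sum>b\<in>B. v b (\<kappa> x) *\<^sub>R rep (br T (s b)) x + anc T (v b) (\<kappa> x) *\<^sub>R b) has_derivative ?D) (at x0)"
    by (simp only: B(3)[symmetric])
  then have "(rep (br T X) has_derivative ?D) (at x0)"
    by (rule has_derivative_transform_within_open[OF _ W'(1,2)]) (simp add: rbr)
  then show "frechet_derivative (rep (br T X)) (at x0) w = ?D w" by (simp add: frechet_derivative_eqI)
qed

text \<open>Hence \<open>[J\<^sup>1T, \<Sum>i. f\<^sub>i J\<^sup>1S\<^sub>i] = \<Sum>i. f\<^sub>i J\<^sup>1[T, S\<^sub>i] + (#T f\<^sub>i) J\<^sup>1S\<^sub>i\<close> does not depend on the
  representation of the section \<open>\<Sum>i. f\<^sub>i J\<^sup>1S\<^sub>i\<close> of \<open>J\<^sup>1E\<close>. This replaces the bracket of \<open>J\<^sup>1E\<close>,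
  which is never constructed.\<close>

lemma jet_bracket_well_defined:
  assumes T: "T \<in> sections A E" and I: "finite I" and f: "\<And>i. i \<in> I \<Longrightarrow> f i \<in> Cinf A"
    and S: "\<And>i. i \<in> I \<Longrightarrow> S i \<in> sections A E" and W: "open W" "x0 \<in> W" "W \<subseteq> \<Omega>"
    and zero: "\<And>x. x \<in> W \<Longrightarrow> (\<Sum>i\<in>I. f i (\<kappa> x) *\<^sub>R jet x (S i)) = 0"
  shows "(\<Sum>i\<in>I. f i (\<kappa> x0) *\<^sub>R jet x0 (br T (S i)) + anc T (f i) (\<kappa> x0) *\<^sub>R jet x0 (S i)) = 0"
proof -
  have x0: "x0 \<in> \<Omega>" using W by blast
  obtain \<tau> where \<tau>: "\<And>f. f \<in> Cinf A \<Longrightarrow> \<rho> (\<kappa> x0) (T (\<kappa> x0)) f = frechet_derivative (\<lambda>y. f (\<kappa> y)) (at x0) \<tau>"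
    using anchor_direction[OF x0 section_fibre[OF T]] by blast
  \<comment> \<open>With coefficients frozen at \<open>x0\<close> this is a genuine section, and its
    1-jet at \<open>x0\<close> is zero by assumption.\<close>
  define X where "X = lincomb I (\<lambda>i _. f i (\<kappa> x0)) S"
  have c: "(\<lambda>_. f i (\<kappa> x0)) \<in> Cinf A" for i using smooth_fun_const by simp
  have X: "X \<in> sections A E" unfolding X_def by (rule lincomb_section[OF c S])
  have j0: "jet x0 X = 0" unfolding X_def using jet_lincomb[where I=I and S=S, OF S x0] zero[OF W(2)] by simp
  have Q: "rep (br T X) x0 = 0"
    "frechet_derivative (rep (br T X)) (at x0) w =
      frechet_derivative (\<lambda>y. frechet_derivative (rep X) (at y) w) (at x0) \<tau>" for w
    by (rule br_vanishing_jet[OF T X x0 j0 \<tau>], assumption)+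
  have brS: "br T (S i) \<in> sections A E" if "i \<in> I" for i by (rule br_section[OF T S[OF that]])
  have jX: "jet x0 (br T X) = (\<Sum>i\<in>I. f i (\<kappa> x0) *\<^sub>R jet x0 (br T (S i)))"
  proof -
    have eq: "rep (br T X) y = rep (lincomb I (\<lambda>i _. f i (\<kappa> x0)) (\<lambda>i. br T (S i))) y" if "y \<in> \<Omega>" for y
    proof -
      have "rep (br T X) y = (\<Sum>i\<in>I. f i (\<kappa> x0) *\<^sub>R rep (br T (S i)) y + anc T (\<lambda>_. f i (\<kappa> x0)) (\<kappa> y) *\<^sub>R rep (S i) y)"
        unfolding X_def by (rule br_lincomb[OF T I c S that])
      also have "\<dots> = (\<Sum>i\<in>I. f i (\<kappa> x0) *\<^sub>R rep (br T (S i)) y)" by (simp add: anc_const[OF T that])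
      also have "\<dots> = rep (lincomb I (\<lambda>i _. f i (\<kappa> x0)) (\<lambda>i. br T (S i))) y"
        by (rule rep_lincomb[OF brS that, symmetric])
      finally show ?thesis .
    qed
    have "jet x0 (br T X) = jet x0 (lincomb I (\<lambda>i _. f i (\<kappa> x0)) (\<lambda>i. br T (S i)))"
    proof -
      have "frechet_derivative (rep (br T X)) (at x0) =
          frechet_derivative (rep (lincomb I (\<lambda>i _. f i (\<kappa> x0)) (\<lambda>i. br T (S i)))) (at x0)"
        by (rule frechet_derivative_cong_open[OF open_\<Omega> x0 eq])
      then show ?thesis by (simp only: jet_def eq[OF x0])
    qed
    then show ?thesis using jet_lincomb[where I=I and S="\<lambda>i. br T (S i)", OF brS x0] by simp
  qed
  have f\<tau>: "anc T (f i) (\<kappa> x0) = frechet_derivative (\<lambda>y. f i (\<kappa> y)) (at x0) \<tau>" if "i \<in> I" for i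
    using \<tau>[OF f[OF that]] by (simp add: anc_def)
  \<comment> \<open>A relation valid near \<open>x0\<close> is differentiated along the anchor. It
    is used for the representatives themselves and for their derivatives in a direction
    \<open>w\<close>.\<close>
  have product_rule: "(\<Sum>i\<in>I. f i (\<kappa> x0) *\<^sub>R frechet_derivative (p i) (at x0) \<tau>) +
      (\<Sum>i\<in>I. anc T (f i) (\<kappa> x0) *\<^sub>R p i x0) = 0"
    if p: "\<And>i. i \<in> I \<Longrightarrow> p i differentiable (at x0)"
      and z: "\<And>x. x \<in> W \<Longrightarrow> (\<Sum>i\<in>I. f i (\<kappa> x) *\<^sub>R p i x) = 0" for p :: "_ \<Rightarrow> 'e \<Rightarrow> 'f"
  proof -
    have "((\<lambda>x. \<Sum>i\<in>I. f i (\<kappa> x) *\<^sub>R p i x) has_derivative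
       (\<lambda>w. \<Sum>i\<in>I. f i (\<kappa> x0) *\<^sub>R frechet_derivative (p i) (at x0) w +
            frechet_derivative (\<lambda>y. f i (\<kappa> y)) (at x0) w *\<^sub>R p i x0)) (at x0)"
      by (rule has_derivative_sum, rule has_derivative_scaleR)
         (use function_differentiable[OF f x0] p in \<open>auto simp: frechet_derivative_works\<close>)
    moreover have "((\<lambda>x. \<Sum>i\<in>I. f i (\<kappa> x) *\<^sub>R p i x) has_derivative (\<lambda>w. 0)) (at x0)"
      by (rule has_derivative_transform_within_open[OF has_derivative_const[of 0] W(1,2)]) (simp add: z)
    ultimately have "(\<lambda>w. \<Sum>i\<in>I. f i (\<kappa> x0) *\<^sub>R frechet_derivative (p i) (at x0) w +
            frechet_derivative (\<lambda>y. f i (\<kappa> y)) (at x0) w *\<^sub>R p i x0) = (\<lambda>w. 0)"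
      by (rule has_derivative_unique)
    from fun_cong[OF this, of \<tau>] show ?thesis by (simp add: sum.distrib f\<tau>)
  qed
  have zero1: "(\<Sum>i\<in>I. f i (\<kappa> x) *\<^sub>R rep (S i) x) = 0" if "x \<in> W" for x
    using arg_cong[OF zero[OF that], of fst] by (simp add: fst_sum)
  have zero2: "(\<Sum>i\<in>I. f i (\<kappa> x) *\<^sub>R frechet_derivative (rep (S i)) (at x) w) = 0" if "x \<in> W" for x w
  proof -
    have "x \<in> \<Omega>" using that W by blast
    then have "(\<Sum>i\<in>I. f i (\<kappa> x) *\<^sub>R frechet_derivative (rep (S i)) (at x) w) =
       blinfun_apply (snd (\<Sum>i\<in>I. f i (\<kappa> x) *\<^sub>R jet x (S i))) w"
      by (simp add: snd_sum blinfun.sum_left blinfun.scaleR_left snd_jet[OF S])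
    then show ?thesis by (simp add: zero[OF that])
  qed
  have der1: "rep (S i) differentiable (at x0)" if "i \<in> I" for i
    by (rule smooth_on_differentiable[OF rep_smooth[OF S[OF that]] x0])
  have der2: "(\<lambda>y. frechet_derivative (rep (S i)) (at y) w) differentiable (at x0)" if "i \<in> I" for i w
    by (rule smooth_on_differentiable[OF smooth_on_derivative[OF rep_smooth[OF S[OF that]]] x0])
  have fst0: "(\<Sum>i\<in>I. anc T (f i) (\<kappa> x0) *\<^sub>R rep (S i) x0) = 0"
    using product_rule[OF der1 zero1] zero2[OF W(2), of \<tau>] by simp
  have DX: "frechet_derivative (\<lambda>y. frechet_derivative (rep X) (at y) w) (at x0) \<tau> =
      (\<Sum>i\<in>I. f i (\<kappa> x0) *\<^sub>R frechet_derivative (\<lambda>y. frechet_derivative (rep (S i)) (at y) w) (at x0) \<tau>)" for w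
  proof -
    have "frechet_derivative (rep X) (at y) w = (\<Sum>i\<in>I. f i (\<kappa> x0) *\<^sub>R frechet_derivative (rep (S i)) (at y) w)"
      if y: "y \<in> \<Omega>" for y
      using arg_cong[OF jet_lincomb[where I=I and S=S and c="\<lambda>i. f i (\<kappa> x0)", OF S y], of "\<lambda>p. blinfun_apply (snd p) w"]
      by (simp add: snd_jet[OF X y] snd_sum blinfun.sum_left blinfun.scaleR_left snd_jet[OF S y] flip: X_def)
    moreover have "((\<lambda>y. \<Sum>i\<in>I. f i (\<kappa> x0) *\<^sub>R frechet_derivative (rep (S i)) (at y) w) has_derivative
      (\<lambda>u. \<Sum>i\<in>I. f i (\<kappa> x0) *\<^sub>R frechet_derivative (\<lambda>y. frechet_derivative (rep (S i)) (at y) w) (at x0) u)) (at x0)"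
      using der2 by (intro has_derivative_sum has_derivative_scaleR_right) (simp add: frechet_derivative_works)
    ultimately have "((\<lambda>y. frechet_derivative (rep X) (at y) w) has_derivative
      (\<lambda>u. \<Sum>i\<in>I. f i (\<kappa> x0) *\<^sub>R frechet_derivative (\<lambda>y. frechet_derivative (rep (S i)) (at y) w) (at x0) u)) (at x0)"
      by (elim has_derivative_transform_within_open[OF _ open_\<Omega> x0]) simp
    then show ?thesis by (simp add: frechet_derivative_eqI)
  qed
  \<comment> \<open>By \<open>br_vanishing_jet\<close> the derivative of the bracket is the first
    sum in \<open>product_rule\<close>, and the anchor terms are the second.\<close>
  have snd0: "frechet_derivative (rep (br T X)) (at x0) w +
      (\<Sum>i\<in>I. anc T (f i) (\<kappa> x0) *\<^sub>R frechet_derivative (rep (S i)) (at x0) w) = 0" for w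
    unfolding Q(2) DX by (rule product_rule[of "\<lambda>i y. frechet_derivative (rep (S i)) (at y) w", OF der2 zero2])
  have "(\<Sum>i\<in>I. f i (\<kappa> x0) *\<^sub>R jet x0 (br T (S i)) + anc T (f i) (\<kappa> x0) *\<^sub>R jet x0 (S i)) =
      jet x0 (br T X) + (\<Sum>i\<in>I. anc T (f i) (\<kappa> x0) *\<^sub>R jet x0 (S i))"
    by (simp add: sum.distrib jX)
  also have "\<dots> = 0"
  proof (rule prod_eqI)
    show "fst (jet x0 (br T X) + (\<Sum>i\<in>I. anc T (f i) (\<kappa> x0) *\<^sub>R jet x0 (S i))) = fst 0"
      using Q(1) fst0 by (simp add: fst_sum)
    show "snd (jet x0 (br T X) + (\<Sum>i\<in>I. anc T (f i) (\<kappa> x0) *\<^sub>R jet x0 (S i))) = snd 0"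
    proof (rule blinfun_eqI)
      fix w
      show "blinfun_apply (snd (jet x0 (br T X) + (\<Sum>i\<in>I. anc T (f i) (\<kappa> x0) *\<^sub>R jet x0 (S i)))) w = blinfun_apply (snd 0) w"
        using snd0[of w]
        by (simp add: snd_sum blinfun.add_left blinfun.sum_left blinfun.scaleR_left snd_jet[OF S x0] snd_jet[OF br_section[OF T X] x0])
    qed
  qed
  finally show ?thesis .
qed

end

section \<open>The prolongation in coordinates\<close>

text \<open>The 2-jets inside the 1-jets of sections \<open>(u, U)\<close> of \<open>J\<^sup>1\<close>: the derivative of \<open>u\<close> is \<open>U\<close>
  and the derivative of \<open>U\<close> is symmetric.\<close>

definition holonomic :: "(('f::real_normed_vector \<times> ('e::real_normed_vector \<Rightarrow>\<^sub>L 'f)) \<times> ('e \<Rightarrow>\<^sub>L ('f \<times> ('e \<Rightarrow>\<^sub>L 'f)))) set"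
  where "holonomic = {p. (\<forall>v. fst (blinfun_apply (snd p) v) = blinfun_apply (snd (fst p)) v) \<and>
    (\<forall>v w. blinfun_apply (snd (blinfun_apply (snd p) v)) w = blinfun_apply (snd (blinfun_apply (snd p) w)) v)}"

lemma subspace_holonomic: "subspace holonomic"
  unfolding subspace_def holonomic_def
  by (simp add: blinfun.add_left blinfun.scaleR_left blinfun.zero_left)

text \<open>The rank \<open>k\<close> is an explicit argument: frames are constructed point by
  point, but \<open>subbundle\<close> demands a common rank.\<close>

definition local_frame ::
  "('m::{t2_space,second_countable_topology}, 'e::real_inner) chart set
     \<Rightarrow> ('m, 'v, 'f::real_normed_vector) vbundle \<Rightarrow> ('m \<Rightarrow> 'v set) \<Rightarrow> 'm set \<Rightarrow> nat \<Rightarrow> (nat \<Rightarrow> 'm \<Rightarrow> 'v) \<Rightarrow> bool"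
  where "local_frame A E S U k e \<longleftrightarrow> open U \<and> (\<forall>i<k. smooth_section A E U (e i)) \<and>
    (\<forall>q\<in>U. indep_family {..<k} (\<lambda>i. coord E q (e i q)) \<and>
       span ((\<lambda>i. coord E q (e i q)) ` {..<k}) = coord E q ` S q)"

lemma subbundle_iff:
  "subbundle A E S \<longleftrightarrow> (\<forall>m. S m \<subseteq> fibre E m) \<and> (\<exists>k. \<forall>m. \<exists>U e. m \<in> U \<and> local_frame A E S U k e)"
  unfolding subbundle_def local_frame_def indep_family_def
  by (simp only: conj_assoc conj_left_commute)

text \<open>One chart serves both bundles: \<open>J\<close> uses the trivialisation of
  \<open>J1 A t\<close> induced by that of \<open>t\<close>. Thus \<open>J.rep\<close> describes
  sections of \<open>J1 A t\<close>, and \<open>J.jet\<close> gives coordinates on the fibres of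
  \<open>J1 A (J1 A t)\<close>.\<close>

locale jet_chart =
  t: triv_chart A t D \<psi> V \<phi> + J: lie_chart A "J1 A t" D \<psi> "D \<inter> V" "J1_triv (D, \<psi>) \<phi>" \<rho>' jbr
  for A :: "('m::{t2_space,second_countable_topology}, 'e::real_inner) chart set"
    and t :: "('m, 'v, 'f::real_normed_vector) vbundle" and D \<psi> V \<phi>
    and \<rho>' :: "'m \<Rightarrow> ('m \<Rightarrow> 'v) set \<Rightarrow> ('m \<Rightarrow> real) \<Rightarrow> real"
    and jbr :: "('m \<Rightarrow> ('m \<Rightarrow> 'v) set) \<Rightarrow> ('m \<Rightarrow> ('m \<Rightarrow> 'v) set) \<Rightarrow> 'm \<Rightarrow> ('m \<Rightarrow> 'v) set" +
  fixes br :: "('m \<Rightarrow> 'v) \<Rightarrow> ('m \<Rightarrow> 'v) \<Rightarrow> 'm \<Rightarrow> 'v"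
    and g :: "'m \<Rightarrow> ('m \<Rightarrow> 'v) set set"
  assumes g: "subalgebroid A (J1 A t) jbr g"
    and br_t: "X \<in> sections A t \<Longrightarrow> Y \<in> sections A t \<Longrightarrow> br X Y \<in> sections A t"
    and jbr_j1: "X \<in> sections A t \<Longrightarrow> Y \<in> sections A t \<Longrightarrow> jbr (j1 A t X) (j1 A t Y) = j1 A t (br X Y)"
begin

lemma J_\<Omega>: "J.\<Omega> = t.\<Omega>"
  by (simp add: J.\<Omega>_def t.\<Omega>_def)

lemma j1_section: "W \<in> sections A t \<Longrightarrow> j1 A t W \<in> sections A (J1 A t)"
  by (rule t.j1_section[OF J.vector_bundle])

lemma J_rep_j1:
  assumes "W \<in> sections A t" "x \<in> J.\<Omega>"
  shows "J.rep (j1 A t W) x = t.jet x W"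
proof -
  have "J.\<kappa> x \<in> D" "J.\<kappa> x \<in> V" "\<psi> (J.\<kappa> x) = x" using J.\<kappa>_inv(1-3)[OF assms(2)] by auto
  then show ?thesis by (simp add: J.rep_eq t.J1_triv_j1[OF assms(1)])
qed

text \<open>The value of the prolongation is the pair of \<open>W\<close> and its derivative, so
  differentiating it repeats that derivative in the first component and gives the symmetric second
  derivative in the other.\<close>

lemma J_jet_j1_holonomic:
  assumes W: "W \<in> sections A t" and x: "x \<in> J.\<Omega>"
  shows "J.jet x (j1 A t W) \<in> holonomic"
proof -
  have x': "x \<in> t.\<Omega>" using x by (simp add: J_\<Omega>)
  let ?L = "frechet_derivative (\<lambda>y. t.jet y W) (at x)"
  have sm: "smooth_on t.\<Omega> (\<lambda>y. t.jet y W)" by (rule t.jet_smooth[OF W])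
  note dif = smooth_on_differentiable[OF sm x']
  have "frechet_derivative (J.rep (j1 A t W)) (at x) = ?L"
    by (rule frechet_derivative_cong_open[OF J.open_\<Omega> x]) (simp add: J_rep_j1 W)
  then have L: "blinfun_apply (snd (J.jet x (j1 A t W))) = ?L"
    using J.snd_jet[OF j1_section[OF W] x] by simp
  have "frechet_derivative (\<lambda>y. fst (t.jet y W)) (at x) = (\<lambda>v. fst (?L v))"
    by (rule frechet_derivative_bounded_linear[OF bounded_linear_fst dif])
  then have 1: "fst (?L v) = frechet_derivative (t.rep W) (at x) v" for v by (simp add: fun_eq_iff)
  have 2: "blinfun_apply (snd (?L v)) w = frechet_derivative (\<lambda>y. frechet_derivative (t.rep W) (at y) w) (at x) v" for v w
  proof -
    have bl: "bounded_linear (\<lambda>p. blinfun_apply (snd p) w)"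
      by (rule bounded_linear_compose[OF blinfun.bounded_linear_left bounded_linear_snd])
    have "frechet_derivative (\<lambda>y. blinfun_apply (snd (t.jet y W)) w) (at x) = (\<lambda>v. blinfun_apply (snd (?L v)) w)"
      by (rule frechet_derivative_bounded_linear[OF bl dif])
    moreover have "frechet_derivative (\<lambda>y. blinfun_apply (snd (t.jet y W)) w) (at x) =
        frechet_derivative (\<lambda>y. frechet_derivative (t.rep W) (at y) w) (at x)"
      by (rule frechet_derivative_cong_open[OF t.open_\<Omega> x']) (simp add: t.snd_jet[OF W])
    ultimately show ?thesis by (simp add: fun_eq_iff)
  qed
  show ?thesis
    unfolding holonomic_def
    using second_derivative_symmetric[OF t.fin_dim_fibre t.rep_smooth[OF W] t.open_\<Omega> x']
    by (simp add: L 1 2 J_rep_j1[OF W x] t.snd_jet[OF W x'])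
qed

text \<open>A quadratic Taylor polynomial with the prescribed coefficients realises the
  2-jet.\<close>

lemma holonomic_surj:
  assumes x: "x \<in> J.\<Omega>" and p: "p \<in> holonomic"
  obtains W where "W \<in> sections A t" "J.jet x (j1 A t W) = p"
proof -
  obtain a L\<^sub>1 L where paL: "p = ((a, L\<^sub>1), L)" by (metis surj_pair)
  have L1: "fst (blinfun_apply L v) = blinfun_apply L\<^sub>1 v" for v using p by (simp add: holonomic_def paL)
  have sym: "blinfun_apply (snd (blinfun_apply L v)) w = blinfun_apply (snd (blinfun_apply L w)) v" for v w
    using p unfolding holonomic_def paL by simp
  \<comment> \<open>Differentiating the quadratic part gives two terms that agree by
    \<open>sym\<close>; the factor 1/2 compensates for this.\<close>
  define s where "s y = a + blinfun_apply L\<^sub>1 (y - x) + (1/2) *\<^sub>R blinfun_apply (snd (blinfun_apply L (y - x))) (y - x)" for y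
  have x': "x \<in> t.\<Omega>" using x by (simp add: J_\<Omega>)
  have smd: "smooth_on t.\<Omega> (\<lambda>y. y - x)" by (intro smooth_on_diff t.open_\<Omega> smooth_on_ident smooth_on_const)
  have sms: "smooth_on t.\<Omega> s"
    unfolding s_def
    by (intro smooth_on_add t.open_\<Omega> smooth_on_const smooth_on_scaleR smd
         smooth_on_bounded_linear[OF blinfun.bounded_linear_right _ smd]
         smooth_on_bilinear[OF bounded_bilinear_blinfun_apply]
         smooth_on_bounded_linear[OF bounded_linear_compose[OF bounded_linear_snd blinfun.bounded_linear_right] _ smd])
  obtain W W' where W: "W \<in> sections A t" "open W'" "x \<in> W'" "W' \<subseteq> t.\<Omega>" "\<And>y. y \<in> W' \<Longrightarrow> t.rep W y = s y"
    by (rule t.section_extension[OF t.open_\<Omega> subset_refl x' sms], rule that) simp_all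
  have ds: "(s has_derivative (\<lambda>v. blinfun_apply (L\<^sub>1 + snd (blinfun_apply L (y - x))) v)) (at y)" for y
  proof -
    have d1: "((\<lambda>y. y - x) has_derivative (\<lambda>v. v)) (at y)" by (auto intro!: derivative_eq_intros)
    have bl: "bounded_linear (\<lambda>u. snd (blinfun_apply L u))"
      by (rule bounded_linear_compose[OF bounded_linear_snd blinfun.bounded_linear_right])
    have "(s has_derivative (\<lambda>v. 0 + blinfun_apply L\<^sub>1 v + (1/2) *\<^sub>R
       (blinfun_apply (snd (blinfun_apply L (y - x))) v + blinfun_apply (snd (blinfun_apply L v)) (y - x)))) (at y)"
      unfolding s_def
      by (intro has_derivative_add has_derivative_const has_derivative_scaleR_right
           bounded_linear.has_derivative[OF blinfun.bounded_linear_right d1]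
           bounded_bilinear.FDERIV[OF bounded_bilinear_blinfun_apply bounded_linear.has_derivative[OF bl d1] d1])
    then show ?thesis
      using sym by (simp add: blinfun.add_left scaleR_half_double)
  qed
  have jetW: "t.jet y W = (s y, L\<^sub>1 + snd (blinfun_apply L (y - x)))" if y: "y \<in> W'" for y
  proof -
    have "(t.rep W has_derivative (\<lambda>v. blinfun_apply (L\<^sub>1 + snd (blinfun_apply L (y - x))) v)) (at y)"
      by (rule has_derivative_transform_within_open[OF ds W(2) y]) (simp add: W(5))
    then show ?thesis by (simp add: t.jet_def W(5)[OF y] frechet_derivative_eqI blinfun_apply_inverse)
  qed
  have "((\<lambda>y. (s y, L\<^sub>1 + snd (blinfun_apply L (y - x)))) has_derivative
      (\<lambda>v. (blinfun_apply (L\<^sub>1 + snd (blinfun_apply L (x - x))) v, 0 + snd (blinfun_apply L v)))) (at x)"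
    by (intro has_derivative_Pair ds has_derivative_add has_derivative_const
         bounded_linear.has_derivative[OF bounded_linear_compose[OF bounded_linear_snd blinfun.bounded_linear_right]])
       (auto intro!: derivative_eq_intros)
  moreover have "(blinfun_apply (L\<^sub>1 + snd (blinfun_apply L (x - x))) v, 0 + snd (blinfun_apply L v)) = blinfun_apply L v" for v
    by (simp add: blinfun.zero_right L1[symmetric] prod_eq_iff)
  ultimately have "((\<lambda>y. (s y, L\<^sub>1 + snd (blinfun_apply L (y - x)))) has_derivative blinfun_apply L) (at x)"
    by simp
  then have "(J.rep (j1 A t W) has_derivative blinfun_apply L) (at x)"
    by (rule has_derivative_transform_within_open[OF _ W(2,3)])
       (use W(4) in \<open>auto simp: jetW J_rep_j1[OF W(1)] J_\<Omega>\<close>)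
  then have "snd (J.jet x (j1 A t W)) = L"
    by (simp add: J.jet_def frechet_derivative_eqI blinfun_apply_inverse)
  moreover have "fst (J.jet x (j1 A t W)) = (a, L\<^sub>1)"
    by (simp add: J_rep_j1[OF W(1) x] jetW[OF W(3)] blinfun.zero_right) (simp add: s_def blinfun.zero_right)
  ultimately show ?thesis using that[OF W(1)] paL by (metis prod.collapse)
qed

text \<open>The fibre of \<open>J\<^sup>1g\<close> in coordinates; that of \<open>J\<^sup>2t\<close> is \<open>holonomic\<close>.\<close>

definition G :: "'e \<Rightarrow> (('f \<times> ('e \<Rightarrow>\<^sub>L 'f)) \<times> ('e \<Rightarrow>\<^sub>L ('f \<times> ('e \<Rightarrow>\<^sub>L 'f)))) set" where
  "G x = J.jet x ` sub_sections A (J1 A t) g"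

lemma sub_sectionsD: "\<sigma> \<in> sub_sections A (J1 A t) g \<Longrightarrow> \<sigma> \<in> sections A (J1 A t)"
  by (simp add: sub_sections_def)

text \<open>The two conditions in \<open>prolongation\<close> come with different representatives, a
  section of \<open>g\<close> and the prolongation of some \<open>W\<close>. They need only share
  the jet at \<open>q\<close>, so the former can be kept and the latter is replaced by a condition
  on coordinates.\<close>

lemma prolongation_iff:
  assumes q: "q \<in> D" "q \<in> V"
  shows "\<theta> \<in> prolongation A t g q \<longleftrightarrow>
    (\<exists>\<sigma>\<in>sub_sections A (J1 A t) g. \<theta> = j1 A (J1 A t) \<sigma> q \<and> J.jet (\<psi> q) \<sigma> \<in> holonomic)"
proof -
  have x: "\<psi> q \<in> J.\<Omega>" using J.\<kappa>_inv(5) q by blast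
  have "j1 A (J1 A t) \<sigma> q \<in> J2_emb A t q \<longleftrightarrow> J.jet (\<psi> q) \<sigma> \<in> holonomic"
    if "\<sigma> \<in> sections A (J1 A t)" for \<sigma>
  proof
    assume "j1 A (J1 A t) \<sigma> q \<in> J2_emb A t q"
    then obtain W where W: "W \<in> sections A t" "j1 A (J1 A t) \<sigma> q = j1 A (J1 A t) (j1 A t W) q"
      by (auto simp: J2_emb_def)
    then show "J.jet (\<psi> q) \<sigma> \<in> holonomic"
      using J.j1_eq_iff[OF that j1_section[OF W(1)]] q J_jet_j1_holonomic[OF W(1) x] by auto
  next
    assume "J.jet (\<psi> q) \<sigma> \<in> holonomic"
    then obtain W where W: "W \<in> sections A t" "J.jet (\<psi> q) (j1 A t W) = J.jet (\<psi> q) \<sigma>"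
      by (rule holonomic_surj[OF x])
    then have "j1 A (J1 A t) \<sigma> q = j1 A (J1 A t) (j1 A t W) q"
      using J.j1_eq_iff[OF that j1_section[OF W(1)]] q by auto
    then show "j1 A (J1 A t) \<sigma> q \<in> J2_emb A t q" using W(1) by (auto simp: J2_emb_def)
  qed
  then show ?thesis unfolding prolongation_def J1_sub_def using sub_sectionsD by blast
qed

lemma Theta_iff:
  assumes q: "q \<in> D" "q \<in> V"
  shows "v \<in> Theta_reduction A t g q \<longleftrightarrow>
    v \<in> fibre (J1 A t) q \<and> J1_triv (D, \<psi>) \<phi> q v \<in> fst ` (G (\<psi> q) \<inter> holonomic)"
proof -
  have rep: "J1_triv (D, \<psi>) \<phi> q (\<sigma> q) = fst (J.jet (\<psi> q) \<sigma>)" for \<sigma>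
    using q by (simp add: J.rep_eq J.\<kappa>_inv)
  show ?thesis
  proof
    assume "v \<in> Theta_reduction A t g q"
    then obtain \<sigma> where \<sigma>: "\<sigma> \<in> sub_sections A (J1 A t) g" "J.jet (\<psi> q) \<sigma> \<in> holonomic"
      "v = jet_proj q (j1 A (J1 A t) \<sigma> q)"
      unfolding Theta_reduction_def using prolongation_iff[OF q] by auto
    then have v: "v = \<sigma> q" using J.jet_proj_j1[OF sub_sectionsD] by simp
    have "J1_triv (D, \<psi>) \<phi> q v \<in> fst ` (G (\<psi> q) \<inter> holonomic)"
      unfolding v rep using \<sigma> by (intro imageI) (auto simp: G_def)
    then show "v \<in> fibre (J1 A t) q \<and> J1_triv (D, \<psi>) \<phi> q v \<in> fst ` (G (\<psi> q) \<inter> holonomic)"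
      using v J.section_fibre[OF sub_sectionsD[OF \<sigma>(1)]] by simp
  next
    assume v: "v \<in> fibre (J1 A t) q \<and> J1_triv (D, \<psi>) \<phi> q v \<in> fst ` (G (\<psi> q) \<inter> holonomic)"
    then obtain \<sigma> where \<sigma>: "\<sigma> \<in> sub_sections A (J1 A t) g" "J.jet (\<psi> q) \<sigma> \<in> holonomic"
      "J1_triv (D, \<psi>) \<phi> q v = fst (J.jet (\<psi> q) \<sigma>)" by (auto simp: G_def)
    have "v = \<sigma> q"
      by (rule J.triv_eqI[OF J.triv_E, of q]) (use q v \<sigma>(3) rep J.section_fibre[OF sub_sectionsD[OF \<sigma>(1)]] in auto)
    then have "v = jet_proj q (j1 A (J1 A t) \<sigma> q)" using J.jet_proj_j1[OF sub_sectionsD[OF \<sigma>(1)]] by simp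
    then show "v \<in> Theta_reduction A t g q"
      unfolding Theta_reduction_def using prolongation_iff[OF q] \<sigma> by blast
  qed
qed

lemma g_fibre: "g q \<subseteq> fibre (J1 A t) q"
  using g by (simp add: subalgebroid_def subbundle_def)

lemma subspace_coord_g: "subspace (coord (J1 A t) q ` g q)"
proof -
  obtain k U e where "q \<in> U" "local_frame A (J1 A t) g U k e"
    using g unfolding subalgebroid_def subbundle_iff by blast
  then have "coord (J1 A t) q ` g q = span ((\<lambda>i. coord (J1 A t) q (e i q)) ` {..<k})"
    by (simp add: local_frame_def)
  then show ?thesis by (simp only: subspace_span)
qed

lemma mem_g_iff:
  assumes "v \<in> fibre (J1 A t) q" shows "v \<in> g q \<longleftrightarrow> coord (J1 A t) q v \<in> coord (J1 A t) q ` g q"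
proof
  assume "coord (J1 A t) q v \<in> coord (J1 A t) q ` g q"
  then obtain w where w: "w \<in> g q" "coord (J1 A t) q v = coord (J1 A t) q w" by auto
  obtain V \<phi> where "(V, \<phi>) \<in> trivs (J1 A t)" "q \<in> V" "coord (J1 A t) q = \<phi> q" by (rule J.coord_is_triv)
  note c = this
  have "v = w"
    by (rule J.triv_eqI[OF c(1,2) assms]) (use w g_fibre c(3) in auto)
  then show "v \<in> g q" using w by simp
qed auto

lemma lincomb_g:
  assumes "\<And>i. i \<in> I \<Longrightarrow> f i \<in> Cinf A" "\<And>i. i \<in> I \<Longrightarrow> S i \<in> sub_sections A (J1 A t) g"
  shows "J.lincomb I f S \<in> sub_sections A (J1 A t) g"
proof -
  have "J.lincomb I f S q \<in> g q" for q
  proof -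
    have "(\<Sum>i\<in>I. f i q *\<^sub>R coord (J1 A t) q (S i q)) \<in> coord (J1 A t) q ` g q"
      using assms(2) by (intro subspace_sum subspace_scale subspace_coord_g) (auto simp: sub_sections_def)
    then show ?thesis
      unfolding mem_g_iff[OF J.lincomb_fibre] by (simp add: J.lincomb_def J.coord_inv)
  qed
  then show ?thesis using J.lincomb_section[of I f S] assms by (auto simp: sub_sections_def)
qed

lemma G_lincomb:
  assumes "\<And>i. i \<in> I \<Longrightarrow> S i \<in> sub_sections A (J1 A t) g" "x \<in> J.\<Omega>"
  shows "(\<Sum>i\<in>I. c i *\<^sub>R J.jet x (S i)) \<in> G x"
proof -
  have "J.lincomb I (\<lambda>i _. c i) S \<in> sub_sections A (J1 A t) g"
    by (rule lincomb_g) (use assms t.smooth_fun_const in auto)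
  then have "J.jet x (J.lincomb I (\<lambda>i _. c i) S) \<in> G x" unfolding G_def by (rule imageI)
  moreover have "J.jet x (J.lincomb I (\<lambda>i _. c i) S) = (\<Sum>i\<in>I. c i *\<^sub>R J.jet x (S i))"
    by (rule J.jet_lincomb) (use assms sub_sectionsD in auto)
  ultimately show ?thesis by simp
qed

lemma jbr_g:
  "X \<in> sub_sections A (J1 A t) g \<Longrightarrow> Y \<in> sub_sections A (J1 A t) g \<Longrightarrow> jbr X Y \<in> sub_sections A (J1 A t) g"
  using g by (simp add: subalgebroid_def)

section \<open>Local frames of \<open>J\<^sup>1g\<close> and \<open>J\<^sup>2t\<close>\<close>

lemma fin_dim_jets: "fin_dim TYPE(('f \<times> ('e \<Rightarrow>\<^sub>L 'f)) \<times> ('e \<Rightarrow>\<^sub>L ('f \<times> ('e \<Rightarrow>\<^sub>L 'f))))"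
  by (intro fin_dim_prod fin_dim_blinfun t.fin_dim_model t.fin_dim_fibre)

text \<open>\<open>subbundle\<close> phrases its frame by \<open>coord\<close>, which need not vary
  smoothly. The isomorphisms \<open>T\<close> move independence and spans to the trivialisation of
  the chart, where the frame is smooth.\<close>

lemma g_local_frame:
  assumes x0: "x0 \<in> J.\<Omega>"
  obtains k s W where "open W" "x0 \<in> W" "W \<subseteq> J.\<Omega>" "\<And>i. i < k \<Longrightarrow> smooth_on W (s i)"
    "\<And>x. x \<in> W \<Longrightarrow> indep_family {..<k::nat} (\<lambda>i. s i x)"
    "\<And>x. x \<in> W \<Longrightarrow> span ((\<lambda>i. s i x) ` {..<k}) = J1_triv (D, \<psi>) \<phi> (J.\<kappa> x) ` g (J.\<kappa> x)"
proof -
  let ?E = "J1 A t"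
  obtain k U e where "J.\<kappa> x0 \<in> U" and e: "local_frame A ?E g U k e"
    using g unfolding subalgebroid_def subbundle_iff by blast
  then have U: "open U" "J.\<kappa> x0 \<in> U" by (simp_all add: local_frame_def)
  define W where "W = \<psi> ` (U \<inter> (D \<inter> V) \<inter> D)"
  have q: "J.\<kappa> x \<in> D" "J.\<kappa> x \<in> V" "\<psi> (J.\<kappa> x) = x" if "x \<in> J.\<Omega>" for x
    using J.\<kappa>_inv(1-3)[OF that] by auto
  have W\<Omega>: "W \<subseteq> J.\<Omega>" by (auto simp: W_def J.\<Omega>_def)
  have \<kappa>U: "J.\<kappa> x \<in> U" if "x \<in> W" for x
    using that by (auto simp: W_def J.\<kappa>_inv(4))
  have "open (U \<inter> (D \<inter> V))" using U(1) J.triv_open[OF J.triv_E] by auto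
  then have opn: "open W" unfolding W_def by (rule t.open_chart_image[OF t.chart_A])
  have x0W: "x0 \<in> W"
    unfolding W_def using q[OF x0] U(2) by (intro image_eqI[of _ _ "J.\<kappa> x0"]) auto
  define s where "s i = J.rep (e i)" for i
  have sm: "smooth_on W (s i)" if "i < k" for i
    unfolding s_def W_def by (rule J.rep_smooth_on) (use e that in \<open>simp add: local_frame_def\<close>)
  have fr: "indep_family {..<k} (\<lambda>i. s i x) \<and>
      span ((\<lambda>i. s i x) ` {..<k}) = J1_triv (D, \<psi>) \<phi> (J.\<kappa> x) ` g (J.\<kappa> x)" if x: "x \<in> W" for x
  proof -
    let ?q = "J.\<kappa> x"
    have qDV: "?q \<in> D \<inter> V" using q x W\<Omega> by auto
    obtain T where T: "linear T" "inj T"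
      "\<And>v. v \<in> fibre ?E ?q \<Longrightarrow> coord ?E ?q v = T (J1_triv (D, \<psi>) \<phi> ?q v)"
      by (rule J.coord_linear_iso[OF J.triv_E qDV], rule that) simp_all
    have eT: "coord ?E ?q (e i ?q) = T (s i x)" if "i < k" for i
    proof -
      have "e i ?q \<in> fibre ?E ?q"
        using e that \<kappa>U[OF x] by (simp add: local_frame_def smooth_section_def)
      then show ?thesis by (simp add: T(3) s_def J.rep_eq)
    qed
    have "indep_family {..<k} (\<lambda>i. coord ?E ?q (e i ?q))"
      and sp: "span ((\<lambda>i. coord ?E ?q (e i ?q)) ` {..<k}) = coord ?E ?q ` g ?q"
      using e \<kappa>U[OF x] by (simp_all add: local_frame_def)
    then have "indep_family {..<k} (\<lambda>i. T (s i x))"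
      using indep_family_cong[of "{..<k}" "\<lambda>i. coord ?E ?q (e i ?q)" "\<lambda>i. T (s i x)"] eT by simp
    then have ind: "indep_family {..<k} (\<lambda>i. s i x)"
      using indep_family_image[OF T(1,2)] by blast
    have "(\<lambda>i. coord ?E ?q (e i ?q)) ` {..<k} = T ` ((\<lambda>i. s i x) ` {..<k})"
      unfolding image_image by (rule image_cong) (simp_all add: eT)
    then have "T ` span ((\<lambda>i. s i x) ` {..<k}) = coord ?E ?q ` g ?q"
      using sp linear_span_image[OF T(1)] by metis
    also have "\<dots> = T ` (J1_triv (D, \<psi>) \<phi> ?q ` g ?q)"
      unfolding image_image by (rule image_cong) (use T(3) g_fibre in auto)
    finally have "span ((\<lambda>i. s i x) ` {..<k}) = J1_triv (D, \<psi>) \<phi> ?q ` g ?q"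
      by (simp only: inj_image_eq_iff[OF T(2)])
    with ind show ?thesis ..
  qed
  show ?thesis by (rule that[OF opn x0W W\<Omega> sm]) (use fr in auto)
qed

text \<open>The jets of \<open>s\<^sub>i\<close> and of \<open>\<beta>\<^sub>b(y - x) s\<^sub>i\<close> at \<open>x\<close>, where \<open>s\<^sub>i\<close> runs over a frame.\<close>

definition frame_jet :: "('e \<Rightarrow> 'e \<Rightarrow> real) \<Rightarrow> (nat \<Rightarrow> 'e \<Rightarrow> 'f \<times> ('e \<Rightarrow>\<^sub>L 'f)) \<Rightarrow> nat \<times> 'e option \<Rightarrow> 'e \<Rightarrow>
    ('f \<times> ('e \<Rightarrow>\<^sub>L 'f)) \<times> ('e \<Rightarrow>\<^sub>L ('f \<times> ('e \<Rightarrow>\<^sub>L 'f)))" where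
  "frame_jet \<beta> s r x = (case r of (i, None) \<Rightarrow> (s i x, Blinfun (frechet_derivative (s i) (at x)))
     | (i, Some b) \<Rightarrow> (0, tensor (\<beta> b) (s i x)))"

lemma sum_frame_index:
  fixes h :: "nat \<times> 'b option \<Rightarrow> 'c::comm_monoid_add"
  assumes "finite B"
  shows "(\<Sum>r\<in>{..<k::nat} \<times> insert None (Some ` B). h r) =
    (\<Sum>i<k. h (i, None) + (\<Sum>b\<in>B. h (i, Some b)))"
  using assms by (subst sum.cartesian_product[symmetric, of "\<lambda>i j. h (i, j)", simplified])
    (simp add: sum.reindex)

text \<open>The factor \<open>c\<close> is 1 or an affine coordinate that vanishes at
  \<open>x0\<close>. \<open>section_extension\<close> cuts the product with \<open>s i\<close> off,
  and its last clause keeps the global section in \<open>g\<close>.\<close>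

lemma frame_jet_sections:
  fixes \<beta> :: "'e \<Rightarrow> 'e \<Rightarrow> real"
  assumes B: "finite B" "\<And>b. bounded_linear (\<beta> b)"
    and W: "open W" "x0 \<in> W" "W \<subseteq> J.\<Omega>" and sm: "\<And>i. i < k \<Longrightarrow> smooth_on W (s i)"
    and sp: "\<And>x. x \<in> W \<Longrightarrow> span ((\<lambda>i. s i x) ` {..<k}) = J1_triv (D, \<psi>) \<phi> (J.\<kappa> x) ` g (J.\<kappa> x)"
    and r: "r \<in> {..<k} \<times> insert None (Some ` B)"
  shows "\<exists>S. S \<in> sub_sections A (J1 A t) g \<and> J.jet x0 S = frame_jet \<beta> s r x0"
proof -
  obtain i o' where r': "r = (i, o')" "i < k" "o' = None \<or> (\<exists>b\<in>B. o' = Some b)" using r by (cases r) auto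
  define c where "c y = (case o' of None \<Rightarrow> 1 | Some b \<Rightarrow> \<beta> b (y - x0))" for y
  have smc: "smooth_on W c"
    by (cases o') (auto simp: c_def[abs_def] intro!: smooth_on_bounded_linear[OF B(2) W(1)] smooth_on_diff W(1))
  define \<sigma> where "\<sigma> y = c y *\<^sub>R s i y" for y
  have sm\<sigma>: "smooth_on W \<sigma>" unfolding \<sigma>_def by (rule smooth_on_scaleR[OF W(1) smc sm[OF r'(2)]])
  obtain S W' where S: "S \<in> sections A (J1 A t)" "open W'" "x0 \<in> W'" "W' \<subseteq> W" "\<And>x. x \<in> W' \<Longrightarrow> J.rep S x = \<sigma> x"
    and Sq: "\<And>q. S q = vzero (J1 A t) q \<or> (q \<in> D \<inter> (D \<inter> V) \<and> \<psi> q \<in> W \<and> (\<exists>r. J1_triv (D, \<psi>) \<phi> q (S q) = r *\<^sub>R \<sigma> (\<psi> q)))"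
    by (rule J.section_extension[OF W(1,3,2) sm\<sigma>], rule that) assumption+
  have "S q \<in> g q" for q
  proof (cases "S q = vzero (J1 A t) q")
    case True
    have "coord (J1 A t) q (vzero (J1 A t) q) = 0" by (simp add: vzero_def J.coord_inv)
    then show ?thesis
      unfolding True mem_g_iff[OF J.fibre_operations(3)] using subspace_0[OF subspace_coord_g, of q] by simp
  next
    case False
    then obtain c' where q: "q \<in> D" "q \<in> V" "\<psi> q \<in> W" "J1_triv (D, \<psi>) \<phi> q (S q) = c' *\<^sub>R \<sigma> (\<psi> q)" using Sq by blast
    have "c' *\<^sub>R \<sigma> (\<psi> q) \<in> span ((\<lambda>i. s i (\<psi> q)) ` {..<k})"
      unfolding \<sigma>_def using r'(2) by (intro span_scale span_base) auto
    then have "J1_triv (D, \<psi>) \<phi> q (S q) \<in> J1_triv (D, \<psi>) \<phi> q ` g q"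
      using sp[OF q(3)] q by (simp add: J.\<kappa>_inv(4))
    then obtain v where v: "v \<in> g q" "J1_triv (D, \<psi>) \<phi> q (S q) = J1_triv (D, \<psi>) \<phi> q v" by auto
    have "S q = v"
      by (rule J.triv_eqI[OF J.triv_E, of q]) (use q v g_fibre J.section_fibre[OF S(1)] in auto)
    then show ?thesis using v by simp
  qed
  then have Sg: "S \<in> sub_sections A (J1 A t) g" using S(1) by (simp add: sub_sections_def)
  have dS: "frechet_derivative (J.rep S) (at x0) = frechet_derivative \<sigma> (at x0)"
    by (rule frechet_derivative_cong_open[OF S(2,3,5)])
  have "J.jet x0 S = frame_jet \<beta> s r x0"
  proof (cases o')
    case None
    then have "\<sigma> = s i" by (simp add: \<sigma>_def c_def fun_eq_iff)
    then show ?thesis using dS S(5)[OF S(3)] None by (simp add: J.jet_def frame_jet_def r'(1))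
  next
    case (Some b)
    have dc: "(c has_derivative \<beta> b) (at x0)"
      unfolding c_def[abs_def] Some option.case
      by (rule bounded_linear.has_derivative[OF B(2), of "\<lambda>y. y - x0" "\<lambda>v. v" "at x0" b])
         (auto intro!: derivative_eq_intros)
    have c0: "c x0 = 0" using linear_0[OF bounded_linear.linear[OF B(2)], of b] by (simp add: c_def Some)
    have "(\<sigma> has_derivative (\<lambda>w. c x0 *\<^sub>R frechet_derivative (s i) (at x0) w + \<beta> b w *\<^sub>R s i x0)) (at x0)"
      unfolding \<sigma>_def by (rule has_derivative_scaleR[OF dc smooth_on_has_derivative[OF sm[OF r'(2)] W(2)]])
    then have "frechet_derivative \<sigma> (at x0) = (\<lambda>w. \<beta> b w *\<^sub>R s i x0)"
      by (simp add: c0 frechet_derivative_eqI)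
    then show ?thesis
      using dS S(5)[OF S(3)] Some by (simp add: J.jet_def frame_jet_def r'(1) tensor_def \<sigma>_def c0)
  qed
  then show ?thesis using Sg by blast
qed

text \<open>The first components involve the indices \<open>(i, None)\<close> only, so their
  coefficients vanish. The rest is evaluated at a basis vector \<open>b\<close>, where the dual
  basis leaves a single tensor for each \<open>i\<close>.\<close>

lemma frame_jet_independent:
  fixes \<beta> :: "'e \<Rightarrow> 'e \<Rightarrow> real"
  assumes B: "finite B" "\<And>b. bounded_linear (\<beta> b)"
    "\<And>b c. b \<in> B \<Longrightarrow> c \<in> B \<Longrightarrow> \<beta> b c = (if b = c then 1 else 0)"
    and ind: "indep_family {..<k} (\<lambda>i. s i x)"
  shows "indep_family ({..<k} \<times> insert None (Some ` B)) (\<lambda>r. frame_jet \<beta> s r x)"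
proof (rule indep_familyI)
  fix u r
  assume 0: "(\<Sum>r\<in>{..<k} \<times> insert None (Some ` B). u r *\<^sub>R frame_jet \<beta> s r x) = 0"
    and r: "r \<in> {..<k} \<times> insert None (Some ` B)"
  note 0 = 0[unfolded sum_frame_index[OF B(1)]]
  have "(\<Sum>i<k. u (i, None) *\<^sub>R s i x) = 0"
    using arg_cong[OF 0, of fst] by (simp add: fst_sum frame_jet_def)
  then have N: "u (i, None) = 0" if "i < k" for i
    using indep_familyD[OF ind, of "\<lambda>i. u (i, None)" i] that by simp
  have Sb: "u (i, Some b) = 0" if "i < k" "b \<in> B" for i b
  proof -
    have "(\<Sum>i<k. \<Sum>c\<in>B. u (i, Some c) *\<^sub>R tensor (\<beta> c) (s i x)) = 0"
      using arg_cong[OF 0, of snd] N by (simp add: snd_sum frame_jet_def)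
    from arg_cong[OF this, of "\<lambda>L. blinfun_apply L b"]
    have "(\<Sum>i<k. \<Sum>c\<in>B. u (i, Some c) *\<^sub>R \<beta> c b *\<^sub>R s i x) = 0"
      by (simp add: blinfun.sum_left blinfun.scaleR_left B(2))
    moreover have "(\<Sum>c\<in>B. u (i, Some c) *\<^sub>R \<beta> c b *\<^sub>R s i x) = u (i, Some b) *\<^sub>R s i x" for i
    proof -
      have "(\<Sum>c\<in>B. u (i, Some c) *\<^sub>R \<beta> c b *\<^sub>R s i x) = (\<Sum>c\<in>B. if b = c then u (i, Some b) *\<^sub>R s i x else 0)"
        using B(3) that(2) by (intro sum.cong) auto
      then show ?thesis using B(1) that(2) by simp
    qed
    ultimately have "(\<Sum>i<k. u (i, Some b) *\<^sub>R s i x) = 0" by simp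
    then show ?thesis using indep_familyD[OF ind, of "\<lambda>i. u (i, Some b)" i] that by simp
  qed
  show "u r = 0" using r N Sb by auto
qed (use B in auto)

text \<open>By the product rule the coefficient at \<open>(i, None)\<close> is \<open>c i x\<close>,
  and the one at \<open>(i, Some b)\<close> is the derivative of \<open>c i\<close> in the direction
  \<open>b\<close>.\<close>

lemma jet_in_frame_span:
  fixes \<beta> :: "'e \<Rightarrow> 'e \<Rightarrow> real"
  assumes B: "finite B" "\<And>b. bounded_linear (\<beta> b)" "\<And>x. x = (\<Sum>b\<in>B. \<beta> b x *\<^sub>R b)"
    and W: "open W" "x \<in> W" "W \<subseteq> J.\<Omega>" and sm: "\<And>i. i < k \<Longrightarrow> smooth_on W (s i)"
    and \<sigma>: "\<sigma> \<in> sections A (J1 A t)" and c: "\<And>i. i < k \<Longrightarrow> smooth_on W (c i)"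
    and eq: "\<And>y. y \<in> W \<Longrightarrow> J.rep \<sigma> y = (\<Sum>i<k. c i y *\<^sub>R s i y)"
  shows "J.jet x \<sigma> \<in> span ((\<lambda>r. frame_jet \<beta> s r x) ` ({..<k} \<times> insert None (Some ` B)))"
proof -
  have x\<Omega>: "x \<in> J.\<Omega>" using W by blast
  let ?dc = "\<lambda>i. frechet_derivative (c i) (at x)" and ?ds = "\<lambda>i. frechet_derivative (s i) (at x)"
  have "((\<lambda>y. \<Sum>i<k. c i y *\<^sub>R s i y) has_derivative (\<lambda>w. \<Sum>i<k. c i x *\<^sub>R ?ds i w + ?dc i w *\<^sub>R s i x)) (at x)"
    by (rule has_derivative_sum, rule has_derivative_scaleR)
       (use smooth_on_has_derivative[OF sm W(2)] smooth_on_has_derivative[OF c W(2)] in auto)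
  then have "(J.rep \<sigma> has_derivative (\<lambda>w. \<Sum>i<k. c i x *\<^sub>R ?ds i w + ?dc i w *\<^sub>R s i x)) (at x)"
    by (rule has_derivative_transform_within_open[OF _ W(1,2)]) (simp add: eq)
  then have d\<sigma>: "frechet_derivative (J.rep \<sigma>) (at x) = (\<lambda>w. \<Sum>i<k. c i x *\<^sub>R ?ds i w + ?dc i w *\<^sub>R s i x)"
    by (rule frechet_derivative_eqI)
  define u where "u r = (case r of (i, None) \<Rightarrow> c i x | (i, Some b) \<Rightarrow> ?dc i b)" for r
  have "J.jet x \<sigma> = (\<Sum>r\<in>{..<k} \<times> insert None (Some ` B). u r *\<^sub>R frame_jet \<beta> s r x)"
  proof (rule prod_eqI)
    show "fst (J.jet x \<sigma>) = fst (\<Sum>r\<in>{..<k} \<times> insert None (Some ` B). u r *\<^sub>R frame_jet \<beta> s r x)"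
      unfolding sum_frame_index[OF B(1)] by (simp add: fst_sum frame_jet_def u_def eq[OF W(2)])
    show "snd (J.jet x \<sigma>) = snd (\<Sum>r\<in>{..<k} \<times> insert None (Some ` B). u r *\<^sub>R frame_jet \<beta> s r x)"
    proof (rule blinfun_eqI)
      fix w
      have ds: "blinfun_apply (Blinfun (?ds i)) w = ?ds i w" if "i < k" for i
        by (simp add: bounded_linear_Blinfun_apply smooth_on_linear_derivative[OF sm[OF that] W(2)])
      have dc: "?dc i w *\<^sub>R s i x = (\<Sum>b\<in>B. ?dc i b *\<^sub>R \<beta> b w *\<^sub>R s i x)" if "i < k" for i
        using linear_eq_coordinates[OF bounded_linear.linear[OF smooth_on_linear_derivative[OF c[OF that] W(2)]] B(1,3), of w]
        by (simp add: scaleR_sum_left mult.commute)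
      have "blinfun_apply (snd (\<Sum>r\<in>{..<k} \<times> insert None (Some ` B). u r *\<^sub>R frame_jet \<beta> s r x)) w =
         (\<Sum>i<k. c i x *\<^sub>R blinfun_apply (Blinfun (?ds i)) w + (\<Sum>b\<in>B. ?dc i b *\<^sub>R \<beta> b w *\<^sub>R s i x))"
        unfolding sum_frame_index[OF B(1)]
        by (simp add: snd_sum frame_jet_def u_def blinfun.sum_left blinfun.add_left blinfun.scaleR_left B(2))
      also have "\<dots> = (\<Sum>i<k. c i x *\<^sub>R ?ds i w + ?dc i w *\<^sub>R s i x)"
        by (intro sum.cong refl) (simp add: ds dc)
      finally show "blinfun_apply (snd (J.jet x \<sigma>)) w =
          blinfun_apply (snd (\<Sum>r\<in>{..<k} \<times> insert None (Some ` B). u r *\<^sub>R frame_jet \<beta> s r x)) w"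
        by (simp add: J.snd_jet[OF \<sigma> x\<Omega>] d\<sigma>)
    qed
  qed
  then show ?thesis by (simp only:) (intro span_sum span_scale span_base imageI)
qed

text \<open>Two families are compared. The members of \<open>frame_jet\<close> at a varying point
  span at least \<open>G x\<close>, but are not jets of fixed sections. The jets of the fixed
  \<open>S r\<close> lie in \<open>G x\<close>, but are known to agree with \<open>frame_jet\<close>
  at \<open>x0\<close> only. There are equally many of both, and the second stay independent near
  \<open>x0\<close>, so counting dimensions makes all three spaces equal.\<close>

lemma G_frame:
  assumes x0: "x0 \<in> J.\<Omega>"
  obtains R :: "(nat \<times> 'e option) set" and S W where "finite R" "\<And>r. r \<in> R \<Longrightarrow> S r \<in> sub_sections A (J1 A t) g"
    "open W" "x0 \<in> W" "W \<subseteq> J.\<Omega>" "\<And>x. x \<in> W \<Longrightarrow> indep_family R (\<lambda>r. J.jet x (S r))"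
    "\<And>x. x \<in> W \<Longrightarrow> span ((\<lambda>r. J.jet x (S r)) ` R) = G x"
proof -
  obtain k s W where W: "open W" "x0 \<in> W" "W \<subseteq> J.\<Omega>" and sm: "\<And>i. i < k \<Longrightarrow> smooth_on W (s i)"
    and ind: "\<And>x. x \<in> W \<Longrightarrow> indep_family {..<k::nat} (\<lambda>i. s i x)"
    and sp: "\<And>x. x \<in> W \<Longrightarrow> span ((\<lambda>i. s i x) ` {..<k}) = J1_triv (D, \<psi>) \<phi> (J.\<kappa> x) ` g (J.\<kappa> x)"
    by (rule g_local_frame[OF x0], rule that) simp_all
  obtain B and \<beta> :: "'e \<Rightarrow> 'e \<Rightarrow> real" where B: "finite B" "\<And>b. bounded_linear (\<beta> b)"
    "\<And>x. x = (\<Sum>b\<in>B. \<beta> b x *\<^sub>R b)" "\<And>b c. b \<in> B \<Longrightarrow> c \<in> B \<Longrightarrow> \<beta> b c = (if b = c then 1 else 0)"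
    by (rule fin_dim_coordinates[OF t.fin_dim_model], rule that) assumption+
  define R where "R = {..<k} \<times> insert None (Some ` B)"
  have finR: "finite R" using B by (simp add: R_def)
  have "\<forall>r\<in>R. \<exists>S. S \<in> sub_sections A (J1 A t) g \<and> J.jet x0 S = frame_jet \<beta> s r x0"
    by (intro ballI frame_jet_sections[OF B(1,2) W sm sp]) (simp_all add: R_def)
  from bchoice[OF this] obtain S where
    "\<forall>r\<in>R. S r \<in> sub_sections A (J1 A t) g \<and> J.jet x0 (S r) = frame_jet \<beta> s r x0"
    by (elim exE)
  then have S: "\<And>r. r \<in> R \<Longrightarrow> S r \<in> sub_sections A (J1 A t) g" "\<And>r. r \<in> R \<Longrightarrow> J.jet x0 (S r) = frame_jet \<beta> s r x0"
    by simp_all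
  have "indep_family R (\<lambda>r. frame_jet \<beta> s r x0)"
    unfolding R_def by (rule frame_jet_independent[OF B(1,2)]) (simp_all add: B(4) ind W(2))
  then have ind0: "indep_family R (\<lambda>r. J.jet x0 (S r))"
    using indep_family_cong[of R "\<lambda>r. J.jet x0 (S r)" "\<lambda>r. frame_jet \<beta> s r x0"] S(2) by simp
  obtain W1 where W1: "open W1" "x0 \<in> W1" "W1 \<subseteq> J.\<Omega>" "\<And>x. x \<in> W1 \<Longrightarrow> indep_family R (\<lambda>r. J.jet x (S r))"
    by (rule smooth_frame[OF fin_dim_jets J.open_\<Omega> x0 finR J.jet_smooth[OF sub_sectionsD[OF S(1)]] ind0],
        assumption, rule that) assumption+
  have smI: "smooth_on W (s i)" if "i \<in> {..<k}" for i using sm that by simp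
  obtain W2 where W2: "open W2" "x0 \<in> W2" "W2 \<subseteq> W" and coeffs: "smooth_coeffs W2 {..<k} s"
    by (rule smooth_frame[OF J.fin_dim_fibre W(1,2) finite_lessThan smI ind[OF W(2)]], assumption, rule that) assumption+
  have "G x \<subseteq> span ((\<lambda>r. frame_jet \<beta> s r x) ` R)" if x: "x \<in> W2" for x
  proof
    fix p assume "p \<in> G x"
    then obtain \<sigma> where \<sigma>: "\<sigma> \<in> sub_sections A (J1 A t) g" "p = J.jet x \<sigma>" by (auto simp: G_def)
    have W2\<Omega>: "W2 \<subseteq> J.\<Omega>" using W2 W by blast
    have in_span: "J.rep \<sigma> y \<in> span ((\<lambda>i. s i y) ` {..<k})" if "y \<in> W2" for y
    proof -
      have y: "y \<in> W" using that W2 by blast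
      have "\<sigma> (J.\<kappa> y) \<in> g (J.\<kappa> y)" using \<sigma>(1) by (simp add: sub_sections_def)
      then show ?thesis unfolding sp[OF y] J.rep_eq by blast
    qed
    obtain c where "\<And>i. i \<in> {..<k} \<Longrightarrow> smooth_on W2 (c i)" "\<And>x. x \<in> W2 \<Longrightarrow> J.rep \<sigma> x = (\<Sum>i\<in>{..<k}. c i x *\<^sub>R s i x)"
      by (rule smooth_coeffsE[OF coeffs W2(1) subset_refl
            smooth_on_subset[OF J.rep_smooth[OF sub_sectionsD[OF \<sigma>(1)]] W2\<Omega>] in_span], assumption, rule that) assumption+
    then show "p \<in> span ((\<lambda>r. frame_jet \<beta> s r x) ` R)"
      unfolding \<sigma>(2) R_def
      by (intro jet_in_frame_span[where c=c, OF B(1,2,3) W2(1) x W2\<Omega> smooth_on_subset[OF sm W2(3)] sub_sectionsD[OF \<sigma>(1)]]) auto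
  qed
  note upper = this
  have span_G: "span ((\<lambda>r. J.jet x (S r)) ` R) = G x" if x: "x \<in> W1 \<inter> W2" for x
  proof -
    have x\<Omega>: "x \<in> J.\<Omega>" using x W1(3) by blast
    have lower: "span ((\<lambda>r. J.jet x (S r)) ` R) \<subseteq> G x"
      unfolding span_image_family[OF finR] using G_lincomb[of R S x] S(1) x\<Omega> by blast
    have "dim (span ((\<lambda>r. frame_jet \<beta> s r x) ` R)) \<le> card ((\<lambda>r. frame_jet \<beta> s r x) ` R)"
      by (rule dim_le_card[OF subset_refl]) (use finR in simp)
    also have "\<dots> \<le> card R" by (rule card_image_le[OF finR])
    also have "\<dots> = dim (span ((\<lambda>r. J.jet x (S r)) ` R))" using indep_family_dim[OF W1(4)] x by simp
    finally have "span ((\<lambda>r. J.jet x (S r)) ` R) = span ((\<lambda>r. frame_jet \<beta> s r x) ` R)"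
      using lower upper[of x] x by (intro subspace_eq_if_dim_eq[OF fin_dim_jets]) auto
    then show ?thesis using lower upper[of x] x by blast
  qed
  show ?thesis
    by (rule that[of R S "W1 \<inter> W2"]) (use finR S(1) W1 W2 span_G in auto)
qed

text \<open>A basis of the constant space is realised at \<open>x0\<close> by prolongations, not by
  sections constant in coordinates, because the bracket \<open>jbr\<close> is known on
  prolongations. The neighbourhood is left open, as independence near \<open>x0\<close> comes from
  \<open>smooth_frame\<close> afterwards.\<close>

lemma holonomic_frame:
  assumes x0: "x0 \<in> J.\<Omega>"
  obtains H :: "(('f \<times> ('e \<Rightarrow>\<^sub>L 'f)) \<times> ('e \<Rightarrow>\<^sub>L ('f \<times> ('e \<Rightarrow>\<^sub>L 'f)))) set" and P where
    "finite H" "\<And>h. h \<in> H \<Longrightarrow> P h \<in> sections A t" "indep_family H (\<lambda>h. J.jet x0 (j1 A t (P h)))"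
    "\<And>W. open W \<Longrightarrow> x0 \<in> W \<Longrightarrow> W \<subseteq> J.\<Omega> \<Longrightarrow> (\<And>x. x \<in> W \<Longrightarrow> indep_family H (\<lambda>h. J.jet x (j1 A t (P h)))) \<Longrightarrow>
       (\<And>x. x \<in> W \<Longrightarrow> span ((\<lambda>h. J.jet x (j1 A t (P h))) ` H) = holonomic)"
proof -
  obtain H :: "(('f \<times> ('e \<Rightarrow>\<^sub>L 'f)) \<times> ('e \<Rightarrow>\<^sub>L ('f \<times> ('e \<Rightarrow>\<^sub>L 'f)))) set"
    where H: "finite H" "independent H" "span H = holonomic"
    using finite_spanning_basis[OF fin_dim_jets subspace_holonomic] by blast
  have "\<forall>h\<in>H. \<exists>W. W \<in> sections A t \<and> J.jet x0 (j1 A t W) = h"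
  proof
    fix h assume "h \<in> H"
    then have "h \<in> holonomic" using H(3) span_superset by blast
    then show "\<exists>W. W \<in> sections A t \<and> J.jet x0 (j1 A t W) = h" by (rule holonomic_surj[OF x0]) blast
  qed
  from bchoice[OF this] obtain P where
    P: "\<And>h. h \<in> H \<Longrightarrow> P h \<in> sections A t" "\<And>h. h \<in> H \<Longrightarrow> J.jet x0 (j1 A t (P h)) = h" by blast
  show ?thesis
  proof (rule that[OF H(1) P(1)])
    have "indep_family H (\<lambda>h. h)" using H(2) by (simp add: indep_family_def)
    then show "indep_family H (\<lambda>h. J.jet x0 (j1 A t (P h)))"
      using indep_family_cong[of H "\<lambda>h. J.jet x0 (j1 A t (P h))" "\<lambda>h. h"] P(2) by simp
    fix W x assume W: "open W" "x0 \<in> W" "W \<subseteq> J.\<Omega>"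
      and ind: "\<And>x. x \<in> W \<Longrightarrow> indep_family H (\<lambda>h. J.jet x (j1 A t (P h)))" and x: "x \<in> W"
    have "dim (holonomic :: (('f \<times> ('e \<Rightarrow>\<^sub>L 'f)) \<times> ('e \<Rightarrow>\<^sub>L ('f \<times> ('e \<Rightarrow>\<^sub>L 'f)))) set) = card H"
      using H dim_span_eq_card_independent by metis
    moreover have "span ((\<lambda>h. J.jet x (j1 A t (P h))) ` H) \<subseteq> holonomic"
      using J_jet_j1_holonomic[OF P(1)] x W(3) by (intro span_minimal subspace_holonomic) auto
    ultimately show "span ((\<lambda>h. J.jet x (j1 A t (P h))) ` H) = holonomic"
      using indep_family_dim[OF ind[OF x]]
      by (intro subspace_eq_if_dim_eq[OF fin_dim_jets] subspace_span subspace_holonomic) auto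
  qed simp
qed

end

section \<open>The \<open>\<Theta>\<close>-reduction\<close>

lemma smooth_coeffs_subset:
  assumes "smooth_coeffs U I w" "W \<subseteq> U"
  shows "smooth_coeffs W I w"
  unfolding smooth_coeffs_def
proof (intro allI impI)
  fix V s assume V: "open V" "V \<subseteq> W" "smooth_on V s" and sp: "\<forall>x\<in>V. s x \<in> span ((\<lambda>i. w i x) ` I)"
  obtain c where "\<And>i. i \<in> I \<Longrightarrow> smooth_on V (c i)" "\<And>x. x \<in> V \<Longrightarrow> s x = (\<Sum>i\<in>I. c i x *\<^sub>R w i x)"
    by (rule smooth_coeffsE[OF assms(1) V(1) subset_trans[OF V(2) assms(2)] V(3) bspec[OF sp]],
        assumption, rule that) assumption+
  then show "\<exists>c. (\<forall>i\<in>I. smooth_on V (c i)) \<and> (\<forall>x\<in>V. s x = (\<Sum>i\<in>I. c i x *\<^sub>R w i x))"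
    by (intro exI conjI ballI)
qed

text \<open>The difference of the two representations is a vanishing combination over the disjoint
  sum of the index sets. The sign is put into the sections, so that the anchor acts on the given
  coefficients.\<close>

lemma (in lie_chart) jet_bracket_eq:
  assumes T: "T \<in> sections A E" and I: "finite I" "finite K"
    and f: "\<And>i. i \<in> I \<Longrightarrow> f i \<in> Cinf A" and S: "\<And>i. i \<in> I \<Longrightarrow> S i \<in> sections A E"
    and h: "\<And>k. k \<in> K \<Longrightarrow> h k \<in> Cinf A" and Q: "\<And>k. k \<in> K \<Longrightarrow> Q k \<in> sections A E"
    and W: "open W" "x0 \<in> W" "W \<subseteq> \<Omega>"
    and eq: "\<And>x. x \<in> W \<Longrightarrow> (\<Sum>i\<in>I. f i (\<kappa> x) *\<^sub>R jet x (S i)) = (\<Sum>k\<in>K. h k (\<kappa> x) *\<^sub>R jet x (Q k))"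
  shows "(\<Sum>i\<in>I. f i (\<kappa> x0) *\<^sub>R jet x0 (br T (S i)) + anc T (f i) (\<kappa> x0) *\<^sub>R jet x0 (S i)) =
    (\<Sum>k\<in>K. h k (\<kappa> x0) *\<^sub>R jet x0 (br T (Q k)) + anc T (h k) (\<kappa> x0) *\<^sub>R jet x0 (Q k))"
proof -
  have c: "(\<lambda>_. - 1) \<in> Cinf A" using smooth_fun_const by simp
  define F where "F = case_sum f h"
  define X where "X = case_sum S (\<lambda>k. sec_mult E (\<lambda>_. - 1) (Q k))"
  have F: "F i \<in> Cinf A" if "i \<in> I <+> K" for i using that f h by (auto simp: F_def)
  have X: "X i \<in> sections A E" if "i \<in> I <+> K" for i
    using that S sec_mult_section[OF c Q] by (auto simp: X_def)
  have x0: "x0 \<in> \<Omega>" using W by blast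
  have split: "(\<Sum>i\<in>I <+> K. p i) = (\<Sum>i\<in>I. p (Inl i)) + (\<Sum>k\<in>K. p (Inr k))" for p :: "_ \<Rightarrow> 'f \<times> ('e \<Rightarrow>\<^sub>L 'f)"
    using sum.Plus[OF I, of p] by (simp add: o_def)
  have "(\<Sum>i\<in>I <+> K. F i (\<kappa> x) *\<^sub>R jet x (X i)) = 0" if x: "x \<in> W" for x
  proof -
    have "x \<in> \<Omega>" using x W by blast
    then show ?thesis
      unfolding split using eq[OF x] by (simp add: F_def X_def jet_sec_mult[OF Q] sum_negf)
  qed
  from jet_bracket_well_defined[OF T finite_Plus[OF I] F X W this]
  have "(\<Sum>i\<in>I <+> K. F i (\<kappa> x0) *\<^sub>R jet x0 (br T (X i)) + anc T (F i) (\<kappa> x0) *\<^sub>R jet x0 (X i)) = 0" .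
  moreover have "jet x0 (br T (sec_mult E (\<lambda>_. - 1) (Q k))) = - jet x0 (br T (Q k))" if "k \<in> K" for k
    using br_scale[OF T Q[OF that]] jet_sec_mult[OF br_section[OF T Q[OF that]] x0] by simp
  moreover have "jet x0 (sec_mult E (\<lambda>_. - 1) (Q k)) = - jet x0 (Q k)" if "k \<in> K" for k
    using jet_sec_mult[OF Q[OF that] x0] by simp
  ultimately show ?thesis
    unfolding split by (simp add: F_def X_def sum.distrib sum_negf sum_subtractf algebra_simps)
qed

context jet_chart
begin

section \<open>Ranks of the prolongation and of its projection in coordinates\<close>

lemma subspace_K:
  assumes "x \<in> J.\<Omega>" shows "subspace (G x \<inter> holonomic)"
proof -
  obtain R :: "(nat \<times> 'e option) set" and S W where "x \<in> W" "\<And>x. x \<in> W \<Longrightarrow> span ((\<lambda>r. J.jet x (S r)) ` R) = G x"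
    by (rule G_frame[OF assms], rule that) assumption+
  then have "subspace (G x)" using subspace_span by metis
  then show ?thesis using subspace_holonomic by (rule subspace_inter)
qed

text \<open>Carries the rank of the prolongation from \<open>coord\<close>, in which
  \<open>constant_rank\<close> is phrased, to the coordinates in which the frames are built.\<close>

lemma dim_K:
  assumes "x \<in> J.\<Omega>"
  shows "dim (G x \<inter> holonomic) = dim (coord (J1 A (J1 A t)) (J.\<kappa> x) ` prolongation A t g (J.\<kappa> x))"
proof -
  let ?q = "J.\<kappa> x"
  have q: "?q \<in> D" "?q \<in> V" "?q \<in> D \<inter> V" "\<psi> ?q = x" using J.\<kappa>_inv(1-3)[OF assms] by auto
  obtain T where T: "linear T" "inj T"
    "\<And>\<sigma>. \<sigma> \<in> sections A (J1 A t) \<Longrightarrow> coord (J1 A (J1 A t)) ?q (j1 A (J1 A t) \<sigma> ?q) = T (J.jet (\<psi> ?q) \<sigma>)"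
    by (rule J.jet_coord_iso[OF q(1,3)], rule that) assumption+
  have "coord (J1 A (J1 A t)) ?q ` prolongation A t g ?q = T ` (G x \<inter> holonomic)"
  proof (intro subset_antisym subsetI)
    fix y assume "y \<in> coord (J1 A (J1 A t)) ?q ` prolongation A t g ?q"
    then obtain \<sigma> where "\<sigma> \<in> sub_sections A (J1 A t) g" "J.jet x \<sigma> \<in> holonomic"
      "y = coord (J1 A (J1 A t)) ?q (j1 A (J1 A t) \<sigma> ?q)"
      using prolongation_iff[OF q(1,2)] q(4) by auto
    then show "y \<in> T ` (G x \<inter> holonomic)" using T(3)[OF sub_sectionsD] q(4) by (auto simp: G_def)
  next
    fix y assume "y \<in> T ` (G x \<inter> holonomic)"
    then obtain \<sigma> where \<sigma>: "\<sigma> \<in> sub_sections A (J1 A t) g" "J.jet x \<sigma> \<in> holonomic" "y = T (J.jet x \<sigma>)"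
      by (auto simp: G_def)
    then have "j1 A (J1 A t) \<sigma> ?q \<in> prolongation A t g ?q"
      using prolongation_iff[OF q(1,2)] q(4) by auto
    moreover have "y = coord (J1 A (J1 A t)) ?q (j1 A (J1 A t) \<sigma> ?q)"
      using T(3)[OF sub_sectionsD[OF \<sigma>(1)]] \<sigma>(3) q(4) by simp
    ultimately show "y \<in> coord (J1 A (J1 A t)) ?q ` prolongation A t g ?q" by (rule image_eqI[rotated])
  qed
  then show ?thesis using dim_image_inj_linear[OF fin_dim_jets T(1,2) subspace_K[OF assms]] by simp
qed

lemma Theta_triv_image:
  assumes "x \<in> J.\<Omega>"
  shows "J1_triv (D, \<psi>) \<phi> (J.\<kappa> x) ` Theta_reduction A t g (J.\<kappa> x) = fst ` (G x \<inter> holonomic)"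
proof -
  let ?q = "J.\<kappa> x"
  have q: "?q \<in> D" "?q \<in> V" "?q \<in> D \<inter> V" "\<psi> ?q = x" using J.\<kappa>_inv(1-3)[OF assms] by auto
  show ?thesis
  proof (intro subset_antisym subsetI)
    fix y assume "y \<in> J1_triv (D, \<psi>) \<phi> ?q ` Theta_reduction A t g ?q"
    then show "y \<in> fst ` (G x \<inter> holonomic)" using Theta_iff[OF q(1,2)] q(4) by auto
  next
    fix y assume y: "y \<in> fst ` (G x \<inter> holonomic)"
    let ?v = "inv_into (fibre (J1 A t) ?q) (J1_triv (D, \<psi>) \<phi> ?q) y"
    have "?v \<in> Theta_reduction A t g ?q"
      using Theta_iff[OF q(1,2), of ?v] J.triv_inv(1,2)[OF J.triv_E q(3), of y] y q(4) by simp
    moreover have "y = J1_triv (D, \<psi>) \<phi> ?q ?v" using J.triv_inv(1)[OF J.triv_E q(3)] by simp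
    ultimately show "y \<in> J1_triv (D, \<psi>) \<phi> ?q ` Theta_reduction A t g ?q" by (rule image_eqI[rotated])
  qed
qed

lemma Theta_fibre: "Theta_reduction A t g q \<subseteq> fibre (J1 A t) q"
proof
  fix v assume "v \<in> Theta_reduction A t g q"
  then obtain \<sigma> where "\<sigma> \<in> sub_sections A (J1 A t) g" "v = jet_proj q (j1 A (J1 A t) \<sigma> q)"
    by (auto simp: Theta_reduction_def prolongation_def J1_sub_def)
  then show "v \<in> fibre (J1 A t) q"
    using J.jet_proj_j1[OF sub_sectionsD] J.section_fibre[OF sub_sectionsD] by simp
qed

lemma Theta_coord_image:
  assumes x: "x \<in> J.\<Omega>"
    and T: "\<And>v. v \<in> fibre (J1 A t) (J.\<kappa> x) \<Longrightarrow> coord (J1 A t) (J.\<kappa> x) v = T (J1_triv (D, \<psi>) \<phi> (J.\<kappa> x) v)"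
  shows "coord (J1 A t) (J.\<kappa> x) ` Theta_reduction A t g (J.\<kappa> x) = T ` fst ` (G x \<inter> holonomic)"
  unfolding Theta_triv_image[OF x, symmetric] image_image
  by (rule image_cong) (use T Theta_fibre in auto)

text \<open>The same transfer for the image of the projection \<open>p\<close>, which is
  \<open>fst\<close> in coordinates.\<close>

lemma dim_fst_K:
  assumes "x \<in> J.\<Omega>"
  shows "dim (fst ` (G x \<inter> holonomic)) = dim (coord (J1 A t) (J.\<kappa> x) ` Theta_reduction A t g (J.\<kappa> x))"
proof -
  have q: "J.\<kappa> x \<in> D \<inter> V" using J.\<kappa>_inv(3)[OF assms] .
  obtain T where T: "linear T" "inj T"
    "\<And>v. v \<in> fibre (J1 A t) (J.\<kappa> x) \<Longrightarrow> coord (J1 A t) (J.\<kappa> x) v = T (J1_triv (D, \<psi>) \<phi> (J.\<kappa> x) v)"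
    by (rule J.coord_linear_iso[OF J.triv_E q], rule that) assumption+
  have "subspace (fst ` (G x \<inter> holonomic))"
    by (rule linear_subspace_image[OF bounded_linear.linear[OF bounded_linear_fst] subspace_K[OF assms]])
  moreover have "coord (J1 A t) (J.\<kappa> x) ` Theta_reduction A t g (J.\<kappa> x) = T ` fst ` (G x \<inter> holonomic)"
    by (rule Theta_coord_image[OF assms]) (rule T(3))
  ultimately show ?thesis using dim_image_inj_linear[OF J.fin_dim_fibre T(1,2)] by simp
qed

text \<open>Over \<open>W\<close>, the jets of \<open>S\<close> and of \<open>j1 A t P\<close> are frames of \<open>J\<^sup>1g\<close> and \<open>J\<^sup>2t\<close>, and \<open>b\<close> lifts a frame
  of the \<open>\<Theta>\<close>-reduction to the prolongation.\<close>

definition adapted :: "'e set \<Rightarrow> (nat \<times> 'e option) set \<Rightarrow> (nat \<times> 'e option \<Rightarrow> 'm \<Rightarrow> ('m \<Rightarrow> 'v) set) \<Rightarrow>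
    'h set \<Rightarrow> ('h \<Rightarrow> 'm \<Rightarrow> 'v) \<Rightarrow> (nat \<times> 'e option) set \<Rightarrow>
    (nat \<times> 'e option \<Rightarrow> 'e \<Rightarrow> ('f \<times> ('e \<Rightarrow>\<^sub>L 'f)) \<times> ('e \<Rightarrow>\<^sub>L ('f \<times> ('e \<Rightarrow>\<^sub>L 'f)))) \<Rightarrow> bool" where
  "adapted W R S H P B b \<longleftrightarrow> open W \<and> W \<subseteq> J.\<Omega> \<and>
    finite R \<and> (\<forall>r\<in>R. S r \<in> sub_sections A (J1 A t) g) \<and> smooth_coeffs W R (\<lambda>r x. J.jet x (S r)) \<and>
    (\<forall>x\<in>W. span ((\<lambda>r. J.jet x (S r)) ` R) = G x) \<and>
    finite H \<and> (\<forall>h\<in>H. P h \<in> sections A t) \<and> smooth_coeffs W H (\<lambda>h x. J.jet x (j1 A t (P h))) \<and>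
    (\<forall>x\<in>W. span ((\<lambda>h. J.jet x (j1 A t (P h))) ` H) = holonomic) \<and>
    finite B \<and> (\<forall>j\<in>B. smooth_on W (b j)) \<and> (\<forall>j\<in>B. \<forall>x\<in>W. b j x \<in> G x \<inter> holonomic) \<and>
    smooth_coeffs W B (\<lambda>j x. fst (b j x)) \<and>
    (\<forall>x\<in>W. indep_family B (\<lambda>j. fst (b j x)) \<and> span ((\<lambda>j. fst (b j x)) ` B) = fst ` (G x \<inter> holonomic))"

lemma adapted_exists:
  assumes x0: "x0 \<in> J.\<Omega>"
    and rank1: "\<And>q. dim (coord (J1 A (J1 A t)) q ` prolongation A t g q) = k"
    and rank0: "\<And>q. dim (coord (J1 A t) q ` Theta_reduction A t g q) = d"
  shows "\<exists>W R S H P B b. x0 \<in> W \<and> card B = d \<and>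
    adapted W R S (H :: (('f \<times> ('e \<Rightarrow>\<^sub>L 'f)) \<times> ('e \<Rightarrow>\<^sub>L ('f \<times> ('e \<Rightarrow>\<^sub>L 'f)))) set) P B b"
proof -
  obtain R :: "(nat \<times> 'e option) set" and S W1 where R: "finite R" "\<And>r. r \<in> R \<Longrightarrow> S r \<in> sub_sections A (J1 A t) g"
    "open W1" "x0 \<in> W1" "W1 \<subseteq> J.\<Omega>" "\<And>x. x \<in> W1 \<Longrightarrow> indep_family R (\<lambda>r. J.jet x (S r))"
    "\<And>x. x \<in> W1 \<Longrightarrow> span ((\<lambda>r. J.jet x (S r)) ` R) = G x"
    by (rule G_frame[OF x0], rule that) assumption+
  have smR: "smooth_on W1 (\<lambda>x. J.jet x (S r))" if "r \<in> R" for r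
    by (rule smooth_on_subset[OF J.jet_smooth[OF sub_sectionsD[OF R(2)[OF that]]] R(5)])
  obtain W2 where W2: "open W2" "x0 \<in> W2" "W2 \<subseteq> W1" "smooth_coeffs W2 R (\<lambda>r x. J.jet x (S r))"
    by (rule smooth_frame[OF fin_dim_jets R(3,4,1) smR R(6)[OF R(4)]], assumption, rule that) assumption+
  obtain H :: "(('f \<times> ('e \<Rightarrow>\<^sub>L 'f)) \<times> ('e \<Rightarrow>\<^sub>L ('f \<times> ('e \<Rightarrow>\<^sub>L 'f)))) set" and P where
    H: "finite H" "\<And>h. h \<in> H \<Longrightarrow> P h \<in> sections A t" "indep_family H (\<lambda>h. J.jet x0 (j1 A t (P h)))"
    and H4: "\<And>W x. open W \<Longrightarrow> x0 \<in> W \<Longrightarrow> W \<subseteq> J.\<Omega> \<Longrightarrow> (\<And>x. x \<in> W \<Longrightarrow> indep_family H (\<lambda>h. J.jet x (j1 A t (P h)))) \<Longrightarrow>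
       x \<in> W \<Longrightarrow> span ((\<lambda>h. J.jet x (j1 A t (P h))) ` H) = holonomic"
    using holonomic_frame[OF x0] by blast
  have smH: "smooth_on J.\<Omega> (\<lambda>x. J.jet x (j1 A t (P h)))" if "h \<in> H" for h
    by (rule J.jet_smooth[OF j1_section[OF H(2)[OF that]]])
  obtain W3 where W3: "open W3" "x0 \<in> W3" "W3 \<subseteq> J.\<Omega>" "\<And>x. x \<in> W3 \<Longrightarrow> indep_family H (\<lambda>h. J.jet x (j1 A t (P h)))"
    "smooth_coeffs W3 H (\<lambda>h x. J.jet x (j1 A t (P h)))"
    by (rule smooth_frame[OF fin_dim_jets J.open_\<Omega> x0 H(1) smH H(3)], assumption, rule that) assumption+
  have spH: "span ((\<lambda>h. J.jet x (j1 A t (P h))) ` H) = holonomic" if "x \<in> W3" for x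
    by (rule H4[OF W3(1-4) that])
  have rankK: "dim (span ((\<lambda>r. J.jet x (S r)) ` R) \<inter> holonomic) = k" if "x \<in> W1" for x
    using dim_K[of x] rank1 R(5) that by (simp add: R(7) subset_iff)
  obtain W4 and B0 :: "(nat \<times> 'e option) set" and b where b: "open W4" "x0 \<in> W4" "W4 \<subseteq> W1" "finite B0" "\<And>j. j \<in> B0 \<Longrightarrow> smooth_on W4 (b j)"
    "\<And>x. x \<in> W4 \<Longrightarrow> span ((\<lambda>j. b j x) ` B0) = span ((\<lambda>r. J.jet x (S r)) ` R) \<inter> holonomic"
    by (rule kernel_frame[OF fin_dim_jets R(3,4,1) smR R(6)[OF R(4)] subspace_holonomic rankK],
        assumption, assumption, rule that) assumption+
  have bK: "span ((\<lambda>j. b j x) ` B0) = G x \<inter> holonomic" if "x \<in> W4" for x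
    using b(6)[OF that] R(7)[of x] b(3) that by auto
  have fst_span: "span ((\<lambda>j. fst (b j x)) ` B0) = fst ` (G x \<inter> holonomic)" if "x \<in> W4" for x
    using linear_span_image[OF bounded_linear.linear[OF bounded_linear_fst], of "(\<lambda>j. b j x) ` B0"]
    by (simp add: image_image bK[OF that])
  have smb: "smooth_on W4 (\<lambda>x. fst (b j x))" if "j \<in> B0" for j
    by (rule smooth_on_bounded_linear[OF bounded_linear_fst b(1) b(5)[OF that]])
  have rankT: "dim (span ((\<lambda>j. fst (b j x)) ` B0)) = d" if "x \<in> W4" for x
    unfolding fst_span[OF that] using dim_fst_K[of x] rank0 that b(3) R(5) by (simp add: subset_iff)
  \<comment> \<open>Of the frame \<open>B0\<close> of the prolongation only members with independent
    projections are kept. The remaining \<open>b j\<close> then define a smooth right inverse of the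
    projection.\<close>
  obtain W5 B where B: "open W5" "x0 \<in> W5" "W5 \<subseteq> W4" "B \<subseteq> B0" "card B = d"
    "\<And>x. x \<in> W5 \<Longrightarrow> indep_family B (\<lambda>j. fst (b j x))"
    "\<And>x. x \<in> W5 \<Longrightarrow> span ((\<lambda>j. fst (b j x)) ` B) = span ((\<lambda>j. fst (b j x)) ` B0)"
    "smooth_coeffs W5 B (\<lambda>j x. fst (b j x))"
    by (rule constant_rank_frame[OF J.fin_dim_fibre b(1,2,4) smb rankT], assumption, assumption, rule that) assumption+
  let ?W = "W2 \<inter> W3 \<inter> W5"
  have sub: "?W \<subseteq> W1" "?W \<subseteq> W4" "?W \<subseteq> J.\<Omega>" using B(3) b(3) R(5) by auto
  have "adapted ?W R S H P B b"
    unfolding adapted_def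
  proof (intro conjI ballI)
    show "smooth_coeffs ?W R (\<lambda>r x. J.jet x (S r))" by (rule smooth_coeffs_subset[OF W2(4)]) auto
    show "smooth_coeffs ?W H (\<lambda>h x. J.jet x (j1 A t (P h)))" by (rule smooth_coeffs_subset[OF W3(5)]) auto
    show "smooth_coeffs ?W B (\<lambda>j x. fst (b j x))" by (rule smooth_coeffs_subset[OF B(8)]) auto
    show "smooth_on ?W (b j)" if "j \<in> B" for j
      by (rule smooth_on_subset[OF b(5) sub(2)]) (use that B(4) in auto)
    show "b j x \<in> G x \<inter> holonomic" if "j \<in> B" "x \<in> ?W" for j x
    proof -
      have "b j x \<in> span ((\<lambda>j. b j x) ` B0)" using that B(4) by (intro span_base imageI) auto
      then show ?thesis using bK[of x] that(2) sub(2) by auto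
    qed
    show "finite B" using B(4) b(4) finite_subset by blast
    show "span ((\<lambda>j. fst (b j x)) ` B) = fst ` (G x \<inter> holonomic)" if "x \<in> ?W" for x
      using B(7)[of x] fst_span[of x] that sub(2) by auto
    show "open ?W" using W2(1) W3(1) B(1) by (intro open_Int)
    show "S r \<in> sub_sections A (J1 A t) g" if "r \<in> R" for r by (rule R(2)[OF that])
    show "span ((\<lambda>r. J.jet x (S r)) ` R) = G x" if "x \<in> ?W" for x by (rule R(7)) (use that sub(1) in blast)
    show "P h \<in> sections A t" if "h \<in> H" for h by (rule H(2)[OF that])
    show "span ((\<lambda>h. J.jet x (j1 A t (P h))) ` H) = holonomic" if "x \<in> ?W" for x by (rule spH) (use that in blast)
    show "indep_family B (\<lambda>j. fst (b j x))" if "x \<in> ?W" for x by (rule B(6)) (use that in blast)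
  qed (fact sub(3) R(1) H(1))+
  then have "x0 \<in> ?W \<and> card B = d \<and> adapted ?W R S H P B b" using W2(2) W3(2) B(2,5) by simp
  then show ?thesis by (intro exI)
qed

text \<open>The projections of the \<open>b j\<close>, read back through the trivialisation, are the
  frame.\<close>

lemma Theta_frame:
  assumes ad: "adapted W R S H P B b" and x0: "x0 \<in> W" and card: "card B = d"
  shows "\<exists>U e. J.\<kappa> x0 \<in> U \<and> local_frame A (J1 A t) (Theta_reduction A t g) U d e"
proof -
  let ?E = "J1 A t" and ?\<Phi> = "J1_triv (D, \<psi>) \<phi>"
  have W: "open W" "W \<subseteq> J.\<Omega>" and finB: "finite B" and sm: "\<And>j. j \<in> B \<Longrightarrow> smooth_on W (b j)"
    and ind: "\<And>x. x \<in> W \<Longrightarrow> indep_family B (\<lambda>j. fst (b j x))"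
    and sp: "\<And>x. x \<in> W \<Longrightarrow> span ((\<lambda>j. fst (b j x)) ` B) = fst ` (G x \<inter> holonomic)"
    using ad by (simp_all add: adapted_def)
  \<comment> \<open>\<open>local_frame\<close> numbers its sections from 0, whereas \<open>B\<close>
    consists of the pairs left over from the elimination.\<close>
  obtain \<pi> where "bij_betw \<pi> {0..<card B} B" using ex_bij_betw_nat_finite[OF finB] by blast
  then have \<pi>: "inj_on \<pi> {..<d}" "\<pi> ` {..<d} = B" by (simp_all add: bij_betw_def card lessThan_atLeast0)
  define U where "U = D \<inter> (D \<inter> V) \<inter> \<psi> -` W"
  have U: "open U" unfolding U_def by (rule J.open_chart_neighbourhood[OF W(1)])
  have qx0: "J.\<kappa> x0 \<in> U" using x0 W(2) J.\<kappa>_inv(1-3)[of x0] by (auto simp: U_def)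
  define e where "e i q = inv_into (fibre ?E q) (?\<Phi> q) (fst (b (\<pi> i) (\<psi> q)))" for i q
  have q: "q \<in> D" "q \<in> D \<inter> V" "\<psi> q \<in> W" "J.\<kappa> (\<psi> q) = q" if "q \<in> U" for q
    using that by (auto simp: U_def J.\<kappa>_inv(4))
  have efib: "e i q \<in> fibre ?E q" and eval: "?\<Phi> q (e i q) = fst (b (\<pi> i) (\<psi> q))" if "q \<in> U" for i q
    unfolding e_def using J.triv_inv(1,2)[OF J.triv_E q(2)[OF that]] by auto
  have "smooth_section A ?E U (e i)" if i: "i < d" for i
  proof (rule J.smooth_section_local[OF efib])
    fix q' assume q': "q' \<in> U"
    have smb: "smooth_on W (\<lambda>x. fst (b (\<pi> i) x))"
      by (rule smooth_on_bounded_linear[OF bounded_linear_fst W(1) sm]) (use \<pi>(2) i in auto)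
    have "smooth_fun A U (\<lambda>q. fst (b (\<pi> i) (\<psi> q)))"
    proof (rule t.smooth_fun_chartI[OF t.chart_A U])
      show "U \<subseteq> D" by (auto simp: U_def)
      have "open (\<psi> ` U)" using t.open_chart_image[OF t.chart_A U] \<open>U \<subseteq> D\<close> by (simp add: Int_absorb2)
      moreover have "\<psi> ` U \<subseteq> W" by (auto simp: U_def)
      ultimately show "smooth_on (\<psi> ` U) (\<lambda>x. fst (b (\<pi> i) (\<psi> (inv_into D \<psi> x))))"
        by (intro smooth_on_cong[OF _ _ smooth_on_subset[OF smb]])
           (use t.chart_inv[OF t.chart_A] \<open>U \<subseteq> D\<close> in auto)
    qed
    then have "smooth_fun A U (\<lambda>q. ?\<Phi> q (e i q))"
      by (rule t.smooth_fun_cong[OF U, rotated]) (simp add: eval)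
    then show "\<exists>W V \<phi>. open W \<and> q' \<in> W \<and> (V, \<phi>) \<in> trivs ?E \<and> W \<subseteq> V \<inter> U \<and> smooth_fun A W (\<lambda>q. \<phi> q (e i q))"
      using U q' q(2) J.triv_E by (intro exI[of _ U] exI[of _ "D \<inter> V"] exI[of _ ?\<Phi>]) auto
  qed
  moreover have "indep_family {..<d} (\<lambda>i. coord ?E p (e i p)) \<and>
      span ((\<lambda>i. coord ?E p (e i p)) ` {..<d}) = coord ?E p ` Theta_reduction A t g p" if p: "p \<in> U" for p
  proof -
    obtain T where T: "linear T" "inj T" "\<And>v. v \<in> fibre ?E p \<Longrightarrow> coord ?E p v = T (?\<Phi> p v)"
      by (rule J.coord_linear_iso[OF J.triv_E q(2)[OF p]], rule that) assumption+
    have x: "\<psi> p \<in> W" "\<psi> p \<in> J.\<Omega>" using q[OF p] W(2) by auto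
    have eT: "coord ?E p (e i p) = T (fst (b (\<pi> i) (\<psi> p)))" for i using T(3)[OF efib[OF p]] eval[OF p] by simp
    have img: "(\<lambda>i. fst (b (\<pi> i) (\<psi> p))) ` {..<d} = (\<lambda>j. fst (b j (\<psi> p))) ` B"
      unfolding \<pi>(2)[symmetric] image_image ..
    have "inj_on (\<lambda>i. fst (b (\<pi> i) (\<psi> p))) {..<d}"
      using ind[OF x(1)] \<pi> comp_inj_on[of \<pi> "{..<d}" "\<lambda>j. fst (b j (\<psi> p))"]
      by (simp add: indep_family_def o_def)
    then have "indep_family {..<d} (\<lambda>i. fst (b (\<pi> i) (\<psi> p)))"
      using ind[OF x(1)] img by (simp add: indep_family_def)
    then have "indep_family {..<d} (\<lambda>i. coord ?E p (e i p))"
      by (simp add: eT indep_family_image[OF T(1,2) finite_lessThan])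
    moreover have "(\<lambda>i. coord ?E p (e i p)) ` {..<d} = T ` ((\<lambda>j. fst (b j (\<psi> p))) ` B)"
      by (simp add: eT img[symmetric] image_image)
    then have "span ((\<lambda>i. coord ?E p (e i p)) ` {..<d}) = T ` fst ` (G (\<psi> p) \<inter> holonomic)"
      using linear_span_image[OF T(1)] sp[OF x(1)] by simp
    moreover have "coord ?E p ` Theta_reduction A t g p = T ` fst ` (G (\<psi> p) \<inter> holonomic)"
      using Theta_coord_image[OF x(2), of T] T(3) q(4)[OF p] by simp
    ultimately show ?thesis by simp
  qed
  ultimately have "local_frame A ?E (Theta_reduction A t g) U d e" using U by (simp add: local_frame_def)
  then show ?thesis using qx0 by blast
qed

text \<open>The lift lies in \<open>G x\<close> and in \<open>holonomic\<close>, so it has smooth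
  coefficients in the frames of both. These are replaced by global functions with the same values
  near \<open>x0\<close>, because the axioms of \<open>lie_algebroid\<close> speak of global
  functions.\<close>

lemma Theta_section_lift:
  assumes ad: "adapted W R S H P B b" and x0: "x0 \<in> W"
    and X: "X \<in> sub_sections A (J1 A t) (Theta_reduction A t g)"
  obtains F K W' where "\<And>r. r \<in> R \<Longrightarrow> F r \<in> Cinf A" "\<And>h. h \<in> H \<Longrightarrow> K h \<in> Cinf A"
    "open W'" "x0 \<in> W'" "W' \<subseteq> W"
    "\<And>x. x \<in> W' \<Longrightarrow> J.rep X x = (\<Sum>r\<in>R. F r (J.\<kappa> x) *\<^sub>R J.rep (S r) x)"
    "\<And>x. x \<in> W' \<Longrightarrow> (\<Sum>r\<in>R. F r (J.\<kappa> x) *\<^sub>R J.jet x (S r)) = (\<Sum>h\<in>H. K h (J.\<kappa> x) *\<^sub>R J.jet x (j1 A t (P h)))"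
proof -
  have W: "open W" "W \<subseteq> J.\<Omega>" and fin: "finite B" "finite R" "finite H" and sm: "\<And>j. j \<in> B \<Longrightarrow> smooth_on W (b j)"
    and bK: "\<And>j x. j \<in> B \<Longrightarrow> x \<in> W \<Longrightarrow> b j x \<in> G x \<inter> holonomic"
    and spB: "\<And>x. x \<in> W \<Longrightarrow> span ((\<lambda>j. fst (b j x)) ` B) = fst ` (G x \<inter> holonomic)"
    and spR: "\<And>x. x \<in> W \<Longrightarrow> span ((\<lambda>r. J.jet x (S r)) ` R) = G x"
    and spH: "\<And>x. x \<in> W \<Longrightarrow> span ((\<lambda>h. J.jet x (j1 A t (P h))) ` H) = holonomic"
    and coB: "smooth_coeffs W B (\<lambda>j x. fst (b j x))"
    and coR: "smooth_coeffs W R (\<lambda>r x. J.jet x (S r))"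
    and coH: "smooth_coeffs W H (\<lambda>h x. J.jet x (j1 A t (P h)))"
    using ad unfolding adapted_def by simp_all
  have XS: "X \<in> sections A (J1 A t)" using X by (simp add: sub_sections_def)
  have X1: "J.rep X x \<in> span ((\<lambda>j. fst (b j x)) ` B)" if "x \<in> W" for x
  proof -
    have x: "x \<in> J.\<Omega>" using that W by blast
    have "X (J.\<kappa> x) \<in> Theta_reduction A t g (J.\<kappa> x)" using X by (simp add: sub_sections_def)
    then show ?thesis unfolding spB[OF that] Theta_triv_image[OF x, symmetric] J.rep_eq by (rule imageI)
  qed
  obtain c where c: "\<And>j. j \<in> B \<Longrightarrow> smooth_on W (c j)" "\<And>x. x \<in> W \<Longrightarrow> J.rep X x = (\<Sum>j\<in>B. c j x *\<^sub>R fst (b j x))"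
    by (rule smooth_coeffsE[OF coB W(1) subset_refl smooth_on_subset[OF J.rep_smooth[OF XS] W(2)] X1],
        assumption, rule that) assumption+
  \<comment> \<open>The coefficients of \<open>X\<close> in the projected frame are used with the
    frame before projection.\<close>
  define X' where "X' x = (\<Sum>j\<in>B. c j x *\<^sub>R b j x)" for x
  have smX': "smooth_on W X'"
    unfolding X'_def by (intro smooth_on_sum W(1) smooth_on_scaleR c(1) sm)
  have X'K: "X' x \<in> G x" "X' x \<in> holonomic" if "x \<in> W" for x
  proof -
    have "x \<in> J.\<Omega>" using that W by blast
    then have "X' x \<in> G x \<inter> holonomic"
      unfolding X'_def by (intro subspace_sum[OF subspace_K] subspace_scale[OF subspace_K] bK that)
    then show "X' x \<in> G x" "X' x \<in> holonomic" by auto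
  qed
  have X'R: "X' x \<in> span ((\<lambda>r. J.jet x (S r)) ` R)" and X'H: "X' x \<in> span ((\<lambda>h. J.jet x (j1 A t (P h))) ` H)"
    if "x \<in> W" for x
    using X'K[OF that] spR[OF that] spH[OF that] by simp_all
  obtain f where f: "\<And>r. r \<in> R \<Longrightarrow> smooth_on W (f r)" "\<And>x. x \<in> W \<Longrightarrow> X' x = (\<Sum>r\<in>R. f r x *\<^sub>R J.jet x (S r))"
    by (rule smooth_coeffsE[OF coR W(1) subset_refl smX' X'R], assumption, rule that) assumption+
  obtain k where k: "\<And>h. h \<in> H \<Longrightarrow> smooth_on W (k h)" "\<And>x. x \<in> W \<Longrightarrow> X' x = (\<Sum>h\<in>H. k h x *\<^sub>R J.jet x (j1 A t (P h)))"
    by (rule smooth_coeffsE[OF coH W(1) subset_refl smX' X'H], assumption, rule that) assumption+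
  obtain F W1 where F: "\<And>r. r \<in> R \<Longrightarrow> F r \<in> Cinf A" "open W1" "x0 \<in> W1" "W1 \<subseteq> W"
    "\<And>r x. r \<in> R \<Longrightarrow> x \<in> W1 \<Longrightarrow> F r (J.\<kappa> x) = f r x"
    by (rule J.function_extension_family[OF fin(2) W x0 f(1)], assumption, rule that) assumption+
  obtain K W2 where K: "\<And>h. h \<in> H \<Longrightarrow> K h \<in> Cinf A" "open W2" "x0 \<in> W2" "W2 \<subseteq> W"
    "\<And>h x. h \<in> H \<Longrightarrow> x \<in> W2 \<Longrightarrow> K h (J.\<kappa> x) = k h x"
    by (rule J.function_extension_family[OF fin(3) W x0 k(1)], assumption, rule that) assumption+
  have FX': "(\<Sum>r\<in>R. F r (J.\<kappa> x) *\<^sub>R J.jet x (S r)) = X' x" if "x \<in> W1" for x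
    using f(2)[of x] F(4) that by (auto simp: F(5) intro!: sum.cong)
  have KX': "(\<Sum>h\<in>H. K h (J.\<kappa> x) *\<^sub>R J.jet x (j1 A t (P h))) = X' x" if "x \<in> W2" for x
    using k(2)[of x] K(4) that by (auto simp: K(5) intro!: sum.cong)
  show ?thesis
  proof (rule that[of F K "W1 \<inter> W2"])
    show "J.rep X x = (\<Sum>r\<in>R. F r (J.\<kappa> x) *\<^sub>R J.rep (S r) x)" if "x \<in> W1 \<inter> W2" for x
    proof -
      have "J.rep X x = fst (X' x)" using c(2)[of x] F(4) that by (auto simp: X'_def fst_sum)
      also have "\<dots> = fst (\<Sum>r\<in>R. F r (J.\<kappa> x) *\<^sub>R J.jet x (S r))" using FX'[of x] that by simp
      finally show ?thesis by (simp add: fst_sum)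
    qed
    show "(\<Sum>r\<in>R. F r (J.\<kappa> x) *\<^sub>R J.jet x (S r)) = (\<Sum>h\<in>H. K h (J.\<kappa> x) *\<^sub>R J.jet x (j1 A t (P h)))"
      if "x \<in> W1 \<inter> W2" for x using FX'[of x] KX'[of x] that by simp
  qed (use F K in auto)
qed

text \<open>The jet \<open>e\<close> projects to the bracket and is a combination of jets of
  sections of \<open>g\<close>. To see that it is holonomic, the frame \<open>S\<close> is traded
  for the prolongations \<open>Q\<close> in one slot at a time, since \<open>jet_bracket_eq\<close>
  allows this in the second slot of a bracket with a fixed section.\<close>

lemma bracket_in_Theta:
  assumes ad: "adapted W R S H P B b" and x0: "x0 \<in> W"
    and X: "X \<in> sub_sections A (J1 A t) (Theta_reduction A t g)"
    and Y: "Y \<in> sub_sections A (J1 A t) (Theta_reduction A t g)"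
  shows "jbr X Y (J.\<kappa> x0) \<in> Theta_reduction A t g (J.\<kappa> x0)"
proof -
  let ?q = "J.\<kappa> x0"
  have W: "open W" "W \<subseteq> J.\<Omega>" and fin: "finite R" "finite H"
    and Sg: "\<And>r. r \<in> R \<Longrightarrow> S r \<in> sub_sections A (J1 A t) g" and P: "\<And>h. h \<in> H \<Longrightarrow> P h \<in> sections A t"
    using ad unfolding adapted_def by simp_all
  define Q where "Q h = j1 A t (P h)" for h
  have S: "S r \<in> sections A (J1 A t)" if "r \<in> R" for r by (rule sub_sectionsD[OF Sg[OF that]])
  have Q: "Q h \<in> sections A (J1 A t)" if "h \<in> H" for h unfolding Q_def by (rule j1_section[OF P[OF that]])
  have x\<Omega>: "x0 \<in> J.\<Omega>" using x0 W by blast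
  have XS: "X \<in> sections A (J1 A t)" and YS: "Y \<in> sections A (J1 A t)" using X Y by (simp_all add: sub_sections_def)
  obtain F K W1 where F: "\<And>r. r \<in> R \<Longrightarrow> F r \<in> Cinf A" and K: "\<And>h. h \<in> H \<Longrightarrow> K h \<in> Cinf A"
    and W1: "open W1" "x0 \<in> W1" "W1 \<subseteq> W"
    and XF: "\<And>x. x \<in> W1 \<Longrightarrow> J.rep X x = (\<Sum>r\<in>R. F r (J.\<kappa> x) *\<^sub>R J.rep (S r) x)"
    and FK: "\<And>x. x \<in> W1 \<Longrightarrow> (\<Sum>r\<in>R. F r (J.\<kappa> x) *\<^sub>R J.jet x (S r)) = (\<Sum>h\<in>H. K h (J.\<kappa> x) *\<^sub>R J.jet x (j1 A t (P h)))"
    by (rule Theta_section_lift[OF ad x0 X], rule that) assumption+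
  note FK = FK[folded Q_def]
  obtain F' K' W2 where F': "\<And>r. r \<in> R \<Longrightarrow> F' r \<in> Cinf A" and K': "\<And>h. h \<in> H \<Longrightarrow> K' h \<in> Cinf A"
    and W2: "open W2" "x0 \<in> W2" "W2 \<subseteq> W"
    and YF: "\<And>x. x \<in> W2 \<Longrightarrow> J.rep Y x = (\<Sum>r\<in>R. F' r (J.\<kappa> x) *\<^sub>R J.rep (S r) x)"
    and FK': "\<And>x. x \<in> W2 \<Longrightarrow> (\<Sum>r\<in>R. F' r (J.\<kappa> x) *\<^sub>R J.jet x (S r)) = (\<Sum>h\<in>H. K' h (J.\<kappa> x) *\<^sub>R J.jet x (j1 A t (P h)))"
    by (rule Theta_section_lift[OF ad x0 Y], rule that) assumption+
  note FK' = FK'[folded Q_def]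
  have W\<Omega>: "W1 \<subseteq> J.\<Omega>" "W2 \<subseteq> J.\<Omega>" using W1(3) W2(3) W(2) by auto
  have repL: "J.rep (J.lincomb R f S) x = (\<Sum>r\<in>R. f r (J.\<kappa> x) *\<^sub>R J.rep (S r) x)" if "x \<in> J.\<Omega>" for f x
    by (rule J.rep_lincomb[OF S that])
  have repQ: "J.rep (J.lincomb H f Q) x = (\<Sum>h\<in>H. f h (J.\<kappa> x) *\<^sub>R J.rep (Q h) x)" if "x \<in> J.\<Omega>" for f x
    by (rule J.rep_lincomb[OF Q that])
  have XL: "X (J.\<kappa> x) = J.lincomb R F S (J.\<kappa> x)" if "x \<in> W1" for x
    using J.rep_eq_iff[OF XS J.lincomb_section[where I=R and f=F and S=S, OF F S], of x] repL[of x F] XF[OF that] that W\<Omega> by auto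
  have YL: "Y (J.\<kappa> x) = J.lincomb R F' S (J.\<kappa> x)" if "x \<in> W2" for x
    using J.rep_eq_iff[OF YS J.lincomb_section[where I=R and f=F' and S=S, OF F' S], of x] repL[of x F'] YF[OF that] that W\<Omega> by auto
  have XK: "X ?q = J.lincomb H K Q ?q"
  proof -
    have "J.rep X x0 = J.rep (J.lincomb H K Q) x0"
      using XF[OF W1(2)] arg_cong[OF FK[OF W1(2)], of fst] repQ[OF x\<Omega>, of K] by (simp add: fst_sum)
    then show ?thesis using J.rep_eq_iff[OF XS J.lincomb_section[where I=H and f=K and S=Q, OF K Q] x\<Omega>] by simp
  qed
  define a where "a T f = J.anc T f ?q" for T f
  define j where "j \<sigma> = J.jet x0 \<sigma>" for \<sigma>
  have aXK: "a X f = (\<Sum>h\<in>H. K h ?q * a (Q h) f)" if "f \<in> Cinf A" for f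
  proof -
    have "a X f = J.anc (J.lincomb H K Q) f ?q" by (simp add: a_def J.anc_def XK)
    also have "\<dots> = (\<Sum>h\<in>H. K h ?q * a (Q h) f)"
      unfolding a_def by (rule J.anc_lincomb[OF fin(2) Q that])
    finally show ?thesis .
  qed
  have aYF: "a Y f = (\<Sum>r\<in>R. F' r ?q * a (S r) f)" if "f \<in> Cinf A" for f
  proof -
    have "a Y f = J.anc (J.lincomb R F' S) f ?q" by (simp add: a_def J.anc_def YL[OF W2(2)])
    also have "\<dots> = (\<Sum>r\<in>R. F' r ?q * a (S r) f)"
      unfolding a_def by (rule J.anc_lincomb[OF fin(1) S that])
    finally show ?thesis .
  qed
  have keyX: "(\<Sum>s\<in>R. F s ?q *\<^sub>R j (jbr T (S s)) + a T (F s) *\<^sub>R j (S s)) =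
      (\<Sum>h\<in>H. K h ?q *\<^sub>R j (jbr T (Q h)) + a T (K h) *\<^sub>R j (Q h))" if "T \<in> sections A (J1 A t)" for T
    unfolding a_def j_def by (rule J.jet_bracket_eq[OF that fin F S K Q W1(1,2) W\<Omega>(1) FK])
  have keyY: "(\<Sum>r\<in>R. F' r ?q *\<^sub>R j (jbr T (S r)) + a T (F' r) *\<^sub>R j (S r)) =
      (\<Sum>h\<in>H. K' h ?q *\<^sub>R j (jbr T (Q h)) + a T (K' h) *\<^sub>R j (Q h))" if "T \<in> sections A (J1 A t)" for T
    unfolding a_def j_def by (rule J.jet_bracket_eq[OF that fin F' S K' Q W2(1,2) W\<Omega>(2) FK'])
  have anti: "j (jbr T' T) = - j (jbr T T')" if "T \<in> sections A (J1 A t)" "T' \<in> sections A (J1 A t)" for T T'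
    unfolding j_def J.br_antisym[OF that] J.jet_sec_mult[OF J.br_section[OF that] x\<Omega>] by simp
  \<comment> \<open>The Leibniz expansion at the point of the bracket of the lifts of
    \<open>X\<close> and \<open>Y\<close>. The bracket of \<open>X\<close> with \<open>S r\<close>
    is turned into that of \<open>S r\<close> with \<open>X\<close>, so that the combination stands
    in the second slot; hence the minus sign.\<close>
  define e where "e = (\<Sum>r\<in>R. a X (F' r) *\<^sub>R j (S r)) -
    (\<Sum>r\<in>R. F' r ?q *\<^sub>R (\<Sum>s\<in>R. F s ?q *\<^sub>R j (jbr (S r) (S s)) + a (S r) (F s) *\<^sub>R j (S s)))"
  have XY: "jbr X Y \<in> sections A (J1 A t)" by (rule J.br_section[OF XS YS])
  have fst_e: "fst e = J.rep (jbr X Y) x0"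
  proof -
    have inner: "J.rep (jbr X (S r)) x0 =
        - (\<Sum>s\<in>R. F s ?q *\<^sub>R J.rep (jbr (S r) (S s)) x0 + a (S r) (F s) *\<^sub>R J.rep (S s) x0)" if r: "r \<in> R" for r
    proof -
      have "J.rep (jbr X (S r)) x0 = - J.rep (jbr (S r) X) x0"
        using J.br_antisym[OF S[OF r] XS] J.rep_mult[OF J.br_section[OF S[OF r] XS] J.br_section[OF S[OF r] XS] x\<Omega>] by simp
      also have "J.rep (jbr (S r) X) x0 = J.rep (jbr (S r) (J.lincomb R F S)) x0"
        unfolding J.rep_eq by (simp only: J.br_local[OF S[OF r] XS J.lincomb_section[OF F S] W1(1) W\<Omega>(1) W1(2) XL])
      also have "\<dots> = (\<Sum>s\<in>R. F s ?q *\<^sub>R J.rep (jbr (S r) (S s)) x0 + a (S r) (F s) *\<^sub>R J.rep (S s) x0)"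
        unfolding a_def by (rule J.br_lincomb[OF S[OF r] fin(1) F S x\<Omega>])
      finally show ?thesis .
    qed
    have "J.rep (jbr X Y) x0 = J.rep (jbr X (J.lincomb R F' S)) x0"
      unfolding J.rep_eq by (simp only: J.br_local[OF XS YS J.lincomb_section[OF F' S] W2(1) W\<Omega>(2) W2(2) YL])
    also have "\<dots> = (\<Sum>r\<in>R. F' r ?q *\<^sub>R J.rep (jbr X (S r)) x0 + a X (F' r) *\<^sub>R J.rep (S r) x0)"
      unfolding a_def by (rule J.br_lincomb[OF XS fin(1) F' S x\<Omega>])
    moreover have "(\<Sum>r\<in>R. F' r ?q *\<^sub>R J.rep (jbr X (S r)) x0) =
        - (\<Sum>r\<in>R. F' r ?q *\<^sub>R (\<Sum>s\<in>R. F s ?q *\<^sub>R J.rep (jbr (S r) (S s)) x0 + a (S r) (F s) *\<^sub>R J.rep (S s) x0))"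
      unfolding sum_negf[symmetric] by (intro sum.cong refl) (simp only: inner scaleR_minus_right)
    ultimately show ?thesis
      by (simp add: e_def j_def fst_sum sum.distrib)
  qed
  have "e \<in> G x0"
  proof -
    have sG: "subspace (G x0)"
    proof -
      have "span ((\<lambda>r. J.jet x0 (S r)) ` R) = G x0" using ad x0 unfolding adapted_def by simp
      then show ?thesis using subspace_span by metis
    qed
    have "j (S r) \<in> G x0" if "r \<in> R" for r unfolding j_def G_def using Sg[OF that] by (rule imageI)
    moreover have "j (jbr (S r) (S s)) \<in> G x0" if "r \<in> R" "s \<in> R" for r s
      unfolding j_def G_def using jbr_g[OF Sg[OF that(1)] Sg[OF that(2)]] by (rule imageI)
    ultimately show ?thesis
      unfolding e_def by (intro subspace_diff[OF sG] subspace_sum[OF sG] subspace_scale[OF sG] subspace_add[OF sG])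
  qed
  moreover have "e \<in> holonomic"
  proof -
    \<comment> \<open>The anchor of \<open>X\<close> depends only on the value of \<open>X\<close>
      at the point, so the representation by the \<open>Q h\<close> may be used for it.\<close>
    have first: "(\<Sum>r\<in>R. a X (F' r) *\<^sub>R j (S r)) = (\<Sum>h\<in>H. K h ?q *\<^sub>R (\<Sum>r\<in>R. a (Q h) (F' r) *\<^sub>R j (S r)))"
    proof -
      have "(\<Sum>r\<in>R. a X (F' r) *\<^sub>R j (S r)) = (\<Sum>r\<in>R. \<Sum>h\<in>H. (K h ?q * a (Q h) (F' r)) *\<^sub>R j (S r))"
        by (intro sum.cong refl) (simp only: aXK[OF F'] scaleR_sum_left)
      also have "\<dots> = (\<Sum>h\<in>H. \<Sum>r\<in>R. (K h ?q * a (Q h) (F' r)) *\<^sub>R j (S r))" by (rule sum.swap)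
      finally show ?thesis by (simp add: scaleR_sum_right)
    qed
    \<comment> \<open>The slot of \<open>X\<close> is exchanged by \<open>keyX\<close>, once for
      each \<open>S r\<close>; antisymmetry then puts \<open>Q h\<close> first, ready for the other
      slot.\<close>
    have second: "(\<Sum>r\<in>R. F' r ?q *\<^sub>R (\<Sum>s\<in>R. F s ?q *\<^sub>R j (jbr (S r) (S s)) + a (S r) (F s) *\<^sub>R j (S s))) =
       (\<Sum>h\<in>H. a Y (K h) *\<^sub>R j (Q h)) - (\<Sum>h\<in>H. K h ?q *\<^sub>R (\<Sum>r\<in>R. F' r ?q *\<^sub>R j (jbr (Q h) (S r))))"
    proof -
      have "(\<Sum>r\<in>R. F' r ?q *\<^sub>R (\<Sum>s\<in>R. F s ?q *\<^sub>R j (jbr (S r) (S s)) + a (S r) (F s) *\<^sub>R j (S s))) =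
        (\<Sum>r\<in>R. \<Sum>h\<in>H. (F' r ?q * a (S r) (K h)) *\<^sub>R j (Q h) - (K h ?q * F' r ?q) *\<^sub>R j (jbr (Q h) (S r)))"
      proof (rule sum.cong[OF refl])
        fix r assume r: "r \<in> R"
        have "F' r ?q *\<^sub>R (\<Sum>s\<in>R. F s ?q *\<^sub>R j (jbr (S r) (S s)) + a (S r) (F s) *\<^sub>R j (S s)) =
          F' r ?q *\<^sub>R (\<Sum>h\<in>H. K h ?q *\<^sub>R j (jbr (S r) (Q h)) + a (S r) (K h) *\<^sub>R j (Q h))"
          by (simp only: keyX[OF S[OF r]])
        also have "\<dots> = (\<Sum>h\<in>H. (F' r ?q * a (S r) (K h)) *\<^sub>R j (Q h) - (K h ?q * F' r ?q) *\<^sub>R j (jbr (Q h) (S r)))"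
          unfolding scaleR_sum_right
          by (intro sum.cong refl) (simp add: anti[OF Q S[OF r]] algebra_simps)
        finally show "F' r ?q *\<^sub>R (\<Sum>s\<in>R. F s ?q *\<^sub>R j (jbr (S r) (S s)) + a (S r) (F s) *\<^sub>R j (S s)) = \<dots>" .
      qed
      also have "\<dots> = (\<Sum>h\<in>H. \<Sum>r\<in>R. (F' r ?q * a (S r) (K h)) *\<^sub>R j (Q h) - (K h ?q * F' r ?q) *\<^sub>R j (jbr (Q h) (S r)))"
        by (rule sum.swap)
      also have "\<dots> = (\<Sum>h\<in>H. a Y (K h) *\<^sub>R j (Q h) - K h ?q *\<^sub>R (\<Sum>r\<in>R. F' r ?q *\<^sub>R j (jbr (Q h) (S r))))"
        by (intro sum.cong refl) (simp add: aYF[OF K] scaleR_sum_left scaleR_sum_right sum_subtractf)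
      finally show ?thesis by (simp add: sum_subtractf)
    qed
    have "e = (\<Sum>h\<in>H. K h ?q *\<^sub>R (\<Sum>r\<in>R. F' r ?q *\<^sub>R j (jbr (Q h) (S r)) + a (Q h) (F' r) *\<^sub>R j (S r))) -
        (\<Sum>h\<in>H. a Y (K h) *\<^sub>R j (Q h))"
      unfolding e_def first second by (simp add: sum.distrib scaleR_add_right)
    \<comment> \<open>Now the slot of \<open>Y\<close> is exchanged, with \<open>Q h\<close> as the
      fixed section.\<close>
    also have "(\<Sum>h\<in>H. K h ?q *\<^sub>R (\<Sum>r\<in>R. F' r ?q *\<^sub>R j (jbr (Q h) (S r)) + a (Q h) (F' r) *\<^sub>R j (S r))) =
        (\<Sum>h\<in>H. K h ?q *\<^sub>R (\<Sum>l\<in>H. K' l ?q *\<^sub>R j (jbr (Q h) (Q l)) + a (Q h) (K' l) *\<^sub>R j (Q l)))"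
      by (intro sum.cong refl) (simp only: keyY[OF Q])
    finally have e: "e = (\<Sum>h\<in>H. K h ?q *\<^sub>R (\<Sum>l\<in>H. K' l ?q *\<^sub>R j (jbr (Q h) (Q l)) + a (Q h) (K' l) *\<^sub>R j (Q l))) -
        (\<Sum>h\<in>H. a Y (K h) *\<^sub>R j (Q h))" .
    have "j (Q h) \<in> holonomic" if "h \<in> H" for h
      unfolding j_def Q_def by (rule J_jet_j1_holonomic[OF P[OF that] x\<Omega>])
    \<comment> \<open>The bracket of two prolongations is the prolongation of a bracket in
      \<open>t\<close>, hence holonomic.\<close>
    moreover have "j (jbr (Q h) (Q l)) \<in> holonomic" if "h \<in> H" "l \<in> H" for h l
      unfolding j_def Q_def jbr_j1[OF P[OF that(1)] P[OF that(2)]]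
      by (rule J_jet_j1_holonomic[OF br_t[OF P[OF that(1)] P[OF that(2)]] x\<Omega>])
    ultimately show ?thesis
      unfolding e by (intro subspace_diff[OF subspace_holonomic] subspace_sum[OF subspace_holonomic]
          subspace_scale[OF subspace_holonomic] subspace_add[OF subspace_holonomic])
  qed
  ultimately have "J.rep (jbr X Y) x0 \<in> fst ` (G x0 \<inter> holonomic)"
    using fst_e by (metis IntI image_eqI)
  moreover have q: "?q \<in> D" "?q \<in> V" "\<psi> ?q = x0" using J.\<kappa>_inv(1-3)[OF x\<Omega>] by auto
  ultimately show ?thesis
    unfolding Theta_iff[OF q(1,2)] using J.section_fibre[OF XY] by (simp add: J.rep_eq)
qed

end

text \<open>For a symmetry \<open>W\<close> the jet of \<open>j1 A t W\<close> lies in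
  \<open>J\<^sup>1g\<close>, as this is a section of \<open>g\<close>, and in
  \<open>J\<^sup>2t\<close> by construction; its projection \<open>j1 A t W\<close> is therefore in
  the reduction. The converse follows from the inclusion in \<open>g\<close>.\<close>

lemma symmetries_Theta_reduction:
  assumes "vector_bundle A (J1 A t)" "smooth_atlas A"
  shows "(\<forall>m. Theta_reduction A t g m \<subseteq> g m) \<and> symmetries A t (Theta_reduction A t g) = symmetries A t g"
proof -
  interpret J: vbundle A "J1 A t" by unfold_locales (use assms in auto)
  have proj: "jet_proj m (j1 A (J1 A t) \<sigma> m) = \<sigma> m" if "\<sigma> \<in> sections A (J1 A t)" for \<sigma> m
    unfolding jet_proj_def by (rule the_equality) (use that in \<open>auto simp: j1_def same_1jet_def\<close>)
  have sub: "Theta_reduction A t g m \<subseteq> g m" for m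
    using proj by (auto simp: Theta_reduction_def prolongation_def J1_sub_def sub_sections_def)
  have "j1 A t W m \<in> Theta_reduction A t g m" if "W \<in> symmetries A t g" for W m
  proof -
    have W: "W \<in> sections A t" "j1 A t W \<in> sub_sections A (J1 A t) g" using that by (simp_all add: symmetries_def)
    then have "j1 A (J1 A t) (j1 A t W) m \<in> prolongation A t g m"
      by (auto simp: prolongation_def J1_sub_def J2_emb_def)
    moreover have "jet_proj m (j1 A (J1 A t) (j1 A t W) m) = j1 A t W m"
      by (rule proj) (use W(2) in \<open>simp add: sub_sections_def\<close>)
    ultimately show ?thesis unfolding Theta_reduction_def by (metis imageI)
  qed
  then show ?thesis using sub by (auto simp: symmetries_def sub_sections_def dest: subsetD[OF sub])
qed

theorem proposition2p5:
  fixes A :: "('m::{t2_space,second_countable_topology}, 'e::real_inner) chart set"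
    and t :: "('m, 'v, 'f::real_normed_vector) vbundle"
    and \<rho> :: "'m \<Rightarrow> 'v \<Rightarrow> ('m \<Rightarrow> real) \<Rightarrow> real"
    and br :: "('m \<Rightarrow> 'v) \<Rightarrow> ('m \<Rightarrow> 'v) \<Rightarrow> 'm \<Rightarrow> 'v"
    and jbr :: "('m \<Rightarrow> ('m \<Rightarrow> 'v) set) \<Rightarrow> ('m \<Rightarrow> ('m \<Rightarrow> 'v) set) \<Rightarrow> 'm \<Rightarrow> ('m \<Rightarrow> 'v) set"
    and g :: "'m \<Rightarrow> ('m \<Rightarrow> 'v) set set"
  assumes "smooth_atlas A"
    and "lie_algebroid A t \<rho> br"
    and "is_jet_bracket A t \<rho> br jbr"
    and "infinitesimal_structure A t jbr g"
  shows "(constant_rank (J1 A t) (Theta_reduction A t g) \<and>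
          constant_rank (J1 A (J1 A t)) (prolongation A t g) \<longrightarrow>
            reduction A t jbr g (Theta_reduction A t g)) \<and>
         (Theta_reduction A t g = g \<longleftrightarrow> surjective_prolongation A t g)"
proof (intro conjI impI)
  show "Theta_reduction A t g = g \<longleftrightarrow> surjective_prolongation A t g"
    by (auto simp: fun_eq_iff Theta_reduction_def surjective_prolongation_def)
next
  let ?E = "J1 A t" and ?T = "Theta_reduction A t g"
  define \<rho>' where "\<rho>' = (\<lambda>m \<theta>. \<rho> m (jet_proj m \<theta>))"
  have lieJ: "lie_algebroid A ?E \<rho>' jbr"
    and jbr: "\<forall>X\<in>sections A t. \<forall>Y\<in>sections A t. jbr (j1 A t X) (j1 A t Y) = j1 A t (br X Y)"
    using assms(3) unfolding is_jet_bracket_def \<rho>'_def by (rule conjunct1, rule conjunct2)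
  have vbt: "vector_bundle A t" using assms(2) unfolding lie_algebroid_def by (rule conjunct1)
  have vbJ: "vector_bundle A ?E" using lieJ unfolding lie_algebroid_def by (rule conjunct1)
  have brt: "\<forall>X\<in>sections A t. \<forall>Y\<in>sections A t. br X Y \<in> sections A t"
    using assms(2) unfolding lie_algebroid_def by blast
  have brJ: "\<forall>X\<in>sections A ?E. \<forall>Y\<in>sections A ?E. jbr X Y \<in> sections A ?E"
    using lieJ unfolding lie_algebroid_def by blast
  assume "constant_rank ?E ?T \<and> constant_rank (J1 A ?E) (prolongation A t g)"
  then obtain d k where rank0: "\<And>q. dim (coord ?E q ` ?T q) = d"
    and rank1: "\<And>q. dim (coord (J1 A ?E) q ` prolongation A t g q) = k"
    unfolding constant_rank_def by blast
  \<comment> \<open>Frames, fibres and the value of a bracket are checked around one point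
    \<open>m\<close> at a time. The rank \<open>d\<close> is fixed beforehand, so the frames fit
    together to a subbundle.\<close>
  have local: "(\<exists>U e. m \<in> U \<and> local_frame A ?E ?T U d e) \<and> ?T m \<subseteq> fibre ?E m \<and>
      (\<forall>X\<in>sub_sections A ?E ?T. \<forall>Y\<in>sub_sections A ?E ?T. jbr X Y m \<in> ?T m)" for m
  proof -
    interpret at: vbundle A t by unfold_locales (use assms(1) vbt in auto)
    obtain D \<psi> where c: "(D, \<psi>) \<in> A" "m \<in> D" by (rule at.chart_cover)
    obtain V \<phi> where v: "(V, \<phi>) \<in> trivs t" "m \<in> V" by (rule at.triv_cover)
    interpret t: triv_chart A t D \<psi> V \<phi> by unfold_locales (use c v in auto)
    interpret jet_chart A t D \<psi> V \<phi> \<rho>' jbr br g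
      by unfold_locales (use c v vbJ lieJ t.J1_triv_mem assms(4) brt jbr in \<open>auto simp: infinitesimal_structure_def\<close>)
    have x0: "\<psi> m \<in> J.\<Omega>" "J.\<kappa> (\<psi> m) = m" using J.\<kappa>_inv(4,5) c(2) v(2) by auto
    obtain W R S B b and H :: "(('f \<times> ('e \<Rightarrow>\<^sub>L 'f)) \<times> ('e \<Rightarrow>\<^sub>L ('f \<times> ('e \<Rightarrow>\<^sub>L 'f)))) set" and P
      where ad: "\<psi> m \<in> W" "card B = d" "adapted W R S H P B b"
      using adapted_exists[OF x0(1) rank1 rank0] by blast
    show ?thesis
      using Theta_frame[OF ad(3,1,2)] Theta_fibre[of m] bracket_in_Theta[OF ad(3,1)] unfolding x0(2) by blast
  qed
  have "subbundle A ?E ?T"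
    unfolding subbundle_iff using local by blast
  moreover have "jbr X Y \<in> sub_sections A ?E ?T" if "X \<in> sub_sections A ?E ?T" "Y \<in> sub_sections A ?E ?T" for X Y
    using local that brJ by (auto simp: sub_sections_def)
  ultimately have "subalgebroid A ?E jbr ?T" by (simp add: subalgebroid_def)
  then show "reduction A t jbr g ?T"
    using symmetries_Theta_reduction[OF vbJ assms(1)] by (simp add: reduction_def)
qed

end
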